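(* Consider the linear mixed-effects setting described in the context, assume (A0)–(A3), let $(\alpha,\gamma)\in\mathcal{A}_0\times\mathcal{G}_0$, and suppose the number of clusters $m$ is fixed. Let $a\in(0,1)$ and let $\chi^2_{m,u}$ denote the $(100u)$-th percentile of the chi-square distribution with $m$ degrees of freedom. Then for $k\in\gamma\cap\gamma_0$, \[ \bigg(\frac{m\hat{\sigma}_k^2(\alpha,\gamma)}{\chi^2_{m,1-a/2}},\ \frac{m\hat{\sigma}_k^2(\alpha,\gamma)}{\chi^2_{m,a/2}}\bigg) \] is an (asymptotically, as $N\to\infty$) $100(1-a)\%$ confidence interval for $\sigma_{k,0}^2$.
   Context: Data: $m\ge1$ clusters, cluster $i$ having $n_i$ observations; $N=\sum_{i=1}^m n_i$, $n_{\min}=\min_i n_i$. For cluster $i$: response $\bm{y}_i\in\mathbb{R}^{n_i}$, fixed-effects design $\bm{X}_i\in\mathbb{R}^{n_i\times p}$ with columns $\bm{x}_{i,j}$, random-effects design $\bm{Z}_i\in\mathbb{R}^{n_i\times q}$ with columns $\bm{z}_{i,k}$. $\bm{X}$ (row-stacking of $\bm X_i$) and $\bm{Z}=\mathrm{diag}(\bm{Z}_1,\dots,\bm{Z}_m)$ have full column rank. Data are generated as $\bm{y}_i=\bm{X}_i\bm{\beta}_0+\bm{Z}_i\bm{b}_i+\bm{\epsilon}_i$, with $\bm{b}_i=(b_{i,1},\dots,b_{i,q})'\sim N(\bm 0,\mathrm{diag}(\sigma_{1,0}^2,\dots,\sigma_{q,0}^2))$, $\bm\epsilon_i\sim N(\bm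 0,v_0^2\bm{I}_{n_i})$, all mutually independent, $v_0^2>0$, $\sigma_{k,0}^2\ge0$; $\theta_{k,0}=\sigma_{k,0}^2/v_0^2$, $\bm\mu_0=\bm X\bm\beta_0$. Candidate models $(\alpha,\gamma)\in\mathcal{A}\times\mathcal{G}\subset 2^{\{1,\dots,p\}}\times2^{\{1,\dots,q\}}$; $\bm X(\alpha)$ the columns indexed by $\alpha$. For $\bm\theta\in[0,\infty)^{|\gamma|}$, $\bm H(\gamma,\bm\theta)=\mathrm{diag}_i(\bm I_{n_i}+\sum_{k\in\gamma}\theta_k\bm z_{i,k}\bm z_{i,k}')$, $\bm M(\alpha,\gamma;\bm\theta)=\bm X(\alpha)(\bm X(\alpha)'\bm H^{-1}\bm X(\alpha))^{-1}\bm X(\alpha)'\bm H^{-1}$, $-2\log L(\bm\theta,v^2;\alpha,\gamma)=N\log(2\pi)+N\log v^2+\log\det\bm H+\bm y'\bm H^{-1}(\bm I_N-\bm M)\bm y/v^2$; ML estimators $(\hat{\bm\theta},\hat v^2)$ minimize it over $[0,\infty)^{|\gamma|}\times(0,\infty)$, and $\hat\sigma_k^2(\alpha,\gamma)=\hat\theta_k\hat v^2$. $\alpha$ is correct if $\bm\mu_0=\bm X(\alpha)\bm\beta(\alpha)$ for some $\bm\beta(\alpha)$; $\gamma$ is correct if $\{k:\theta_{k,0}>0\}\subset\gamma$; $\mathcal A_0,\mathcal G_0$ the sets of correct candidate models; $(\alpha_0,\gamma_0)$ the smallest correct model (minimal cardinalities), with $|\alpha_0|,|\gamma_0|>0$ fixed.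 Conditions: (A0) $p=c_p+o(n_{\min}^\tau)$, $q=c_q+o(n_{\min}^\tau)$, some $\tau\in[0,1/2)$, $c_p,c_q>0$. (A1) $\exists\,\xi\in(2\tau,1]$, $d_{i,j}>0$ bounded away from $0$ and $\infty$: $\bm x_{i,j}'\bm x_{i,j^*}=d_{i,j}n_i^\xi+o(n_i^\xi)$ if $j=j^*$, $o(n_i^{\xi-\tau})$ otherwise. (A2) $\exists\,\ell\in(2\tau,1]$, $c_{i,k}>0$ bounded away from $0$ and $\infty$: $\bm z_{i,k}'\bm z_{i,k^*}=c_{i,k}n_i^\ell+o(n_i^\ell)$ if $k=k^*$, $o(n_i^{\ell-\tau})$ otherwise. (A3) $\bm x_{i,j}'\bm z_{i,k}=o(n_i^{(\xi+\ell)/2-\tau})$. *)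

theory Defs
  imports "HOL-Probability.Probability" "Jordan_Normal_Form.Gauss_Jordan_Elimination"
          "Jordan_Normal_Form.Determinant"
begin

text \<open>There are m clusters with sizes n 0, ..., n (m-1). Observations are stacked
row-wise; the rows of cluster i are off n i, ..., off n i + n i - 1.\<close>

definition off :: "(nat \<Rightarrow> nat) \<Rightarrow> nat \<Rightarrow> nat" where
  "off n i = (\<Sum>i'<i. n i')"

definition Ntot :: "nat \<Rightarrow> (nat \<Rightarrow> nat) \<Rightarrow> nat" where
  "Ntot m n = off n m"

definition nmin :: "nat \<Rightarrow> (nat \<Rightarrow> nat) \<Rightarrow> nat" where
  "nmin m n = Min (n ` {..<m})"

definition clus :: "(nat \<Rightarrow> nat) \<Rightarrow> nat \<Rightarrow> nat" where
  "clus n r = (LEAST i. r < off n (Suc i))"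

text \<open>Inner product of the cluster-i parts of two (stacked) columns f and g,
  e.g. x_{i,j}' x_{i,j*} with f = (\<lambda>r. x r j), g = (\<lambda>r. x r j*).\<close>
definition cip :: "(nat \<Rightarrow> nat) \<Rightarrow> nat \<Rightarrow> (nat \<Rightarrow> real) \<Rightarrow> (nat \<Rightarrow> real) \<Rightarrow> real" where
  "cip n i f g = (\<Sum>t<n i. f (off n i + t) * g (off n i + t))"

text \<open>x r j: entry of the fixed-effects design X at row r, column j (j < p).
  z r k: entry of Z_i at the row r (in cluster i = clus n r), column k (k < q);
  the full Z is diag(Z_1,...,Z_m).\<close>

definition full_col_rank_X :: "nat \<Rightarrow> nat \<Rightarrow> (nat \<Rightarrow> nat \<Rightarrow> real) \<Rightarrow> bool" where
  "full_col_rank_X N p x \<longleftrightarrow>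
     (\<forall>c. (\<forall>r<N. (\<Sum>j<p. x r j * c j) = 0) \<longrightarrow> (\<forall>j<p. c j = 0))"

text \<open>Z = diag(Z_1..Z_m) has full column rank iff every Z_i does.\<close>
definition full_col_rank_Z :: "nat \<Rightarrow> (nat \<Rightarrow> nat) \<Rightarrow> nat \<Rightarrow> (nat \<Rightarrow> nat \<Rightarrow> real) \<Rightarrow> bool" where
  "full_col_rank_Z m n q z \<longleftrightarrow>
     (\<forall>i<m. \<forall>c. (\<forall>t<n i. (\<Sum>k<q. z (off n i + t) k * c k) = 0) \<longrightarrow> (\<forall>k<q. c k = 0))"

definition Xsub :: "nat \<Rightarrow> (nat \<Rightarrow> nat \<Rightarrow> real) \<Rightarrow> nat set \<Rightarrow> real mat" where
  "Xsub N x \<alpha> = mat N (card \<alpha>) (\<lambda>(r, j). x r (sorted_list_of_set \<alpha> ! j))"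

text \<open>H(gamma, theta) = diag_i (I + sum_{k in gamma} theta_k z_{i,k} z_{i,k}')\<close>
definition Hmat :: "nat \<Rightarrow> (nat \<Rightarrow> nat) \<Rightarrow> (nat \<Rightarrow> nat \<Rightarrow> real) \<Rightarrow> nat set \<Rightarrow> (nat \<Rightarrow> real) \<Rightarrow> real mat" where
  "Hmat m n z \<gamma> \<theta> = mat (Ntot m n) (Ntot m n) (\<lambda>(r, s).
      (if r = s then 1 else 0) +
      (if clus n r = clus n s then (\<Sum>k\<in>\<gamma>. \<theta> k * z r k * z s k) else 0))"

definition minv :: "real mat \<Rightarrow> real mat" where
  "minv A = (case mat_inverse A of Some B \<Rightarrow> B | None \<Rightarrow> 0\<^sub>m (dim_row A) (dim_col A))"

definition Mmat :: "nat \<Rightarrow> (nat \<Rightarrow> nat) \<Rightarrow> (nat \<Rightarrow> nat \<Rightarrow> real) \<Rightarrow> (nat \<Rightarrow> nat \<Rightarrow> real)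
                     \<Rightarrow> nat set \<Rightarrow> nat set \<Rightarrow> (nat \<Rightarrow> real) \<Rightarrow> real mat" where
  "Mmat m n x z \<alpha> \<gamma> \<theta> =
     (let Xa = Xsub (Ntot m n) x \<alpha>; Hi = minv (Hmat m n z \<gamma> \<theta>)
      in Xa * minv (transpose_mat Xa * Hi * Xa) * transpose_mat Xa * Hi)"

definition neg2loglik :: "nat \<Rightarrow> (nat \<Rightarrow> nat) \<Rightarrow> (nat \<Rightarrow> nat \<Rightarrow> real) \<Rightarrow> (nat \<Rightarrow> nat \<Rightarrow> real)
     \<Rightarrow> nat set \<Rightarrow> nat set \<Rightarrow> real vec \<Rightarrow> (nat \<Rightarrow> real) \<Rightarrow> real \<Rightarrow> real" where
  "neg2loglik m n x z \<alpha> \<gamma> y \<theta> v2 =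
     (let N = Ntot m n; H = Hmat m n z \<gamma> \<theta>
      in real N * ln (2 * pi) + real N * ln v2 + ln (det H)
         + (y \<bullet> (minv H *\<^sub>v ((1\<^sub>m N - Mmat m n x z \<alpha> \<gamma> \<theta>) *\<^sub>v y))) / v2)"

text \<open>(theta, v2) is a maximum-likelihood estimate: a minimiser of -2 log L over
  theta_k \<ge> 0 (k in gamma), v2 > 0. (Coordinates of theta outside gamma are irrelevant.)\<close>
definition is_mle :: "nat \<Rightarrow> (nat \<Rightarrow> nat) \<Rightarrow> (nat \<Rightarrow> nat \<Rightarrow> real) \<Rightarrow> (nat \<Rightarrow> nat \<Rightarrow> real)
     \<Rightarrow> nat set \<Rightarrow> nat set \<Rightarrow> real vec \<Rightarrow> (nat \<Rightarrow> real) \<Rightarrow> real \<Rightarrow> bool" where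
  "is_mle m n x z \<alpha> \<gamma> y \<theta> v2 \<longleftrightarrow>
     (\<forall>k\<in>\<gamma>. 0 \<le> \<theta> k) \<and> 0 < v2 \<and>
     (\<forall>\<theta>' v2'. (\<forall>k\<in>\<gamma>. 0 \<le> \<theta>' k) \<longrightarrow> 0 < v2' \<longrightarrow>
        neg2loglik m n x z \<alpha> \<gamma> y \<theta> v2 \<le> neg2loglik m n x z \<alpha> \<gamma> y \<theta>' v2')"

definition std_normal :: "real measure" where
  "std_normal = density lborel std_normal_density"

text \<open>Underlying probability space: i.i.d. standard normals
  g (Inl (i,k)) (random effects) and e (Inr r) (errors).\<close>
definition Omega :: "((nat \<times> nat) + nat \<Rightarrow> real) measure" where
  "Omega = PiM UNIV (\<lambda>_. std_normal)"

text \<open>y = X beta_0 + Z b + eps with b_{i,k} = sigma_{k,0} g_{i,k}, eps_r = v_0 e_r,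
  so b_i ~ N(0, diag(sigma_{k,0}^2)), eps ~ N(0, v_0^2 I), all independent.\<close>
definition Yobs :: "nat \<Rightarrow> (nat \<Rightarrow> nat) \<Rightarrow> nat \<Rightarrow> nat \<Rightarrow> (nat \<Rightarrow> nat \<Rightarrow> real) \<Rightarrow> (nat \<Rightarrow> nat \<Rightarrow> real)
     \<Rightarrow> (nat \<Rightarrow> real) \<Rightarrow> (nat \<Rightarrow> real) \<Rightarrow> real \<Rightarrow> ((nat \<times> nat) + nat \<Rightarrow> real) \<Rightarrow> real vec" where
  "Yobs m n p q x z \<beta>0 \<sigma>0sq v0sq \<omega> = vec (Ntot m n) (\<lambda>r.
      (\<Sum>j<p. x r j * \<beta>0 j)
      + (\<Sum>k<q. z r k * (sqrt (\<sigma>0sq k) * \<omega> (Inl (clus n r, k))))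
      + sqrt v0sq * \<omega> (Inr r))"

definition chisq_space :: "(nat \<Rightarrow> real) measure" where
  "chisq_space = PiM UNIV (\<lambda>_. std_normal)"

definition chisq_cdf :: "nat \<Rightarrow> real \<Rightarrow> real" where
  "chisq_cdf m t = measure chisq_space {\<omega> \<in> space chisq_space. (\<Sum>i<m. (\<omega> i)^2) \<le> t}"

definition chisq_quantile :: "nat \<Rightarrow> real \<Rightarrow> real" where
  "chisq_quantile m u = Inf {t. u \<le> chisq_cdf m t}"

end

theory Submission
  imports Defs
begin

text \<open>
  Write \<open>w = H(\<theta>)\<^sup>-\<^sup>1(I - M)y\<close> for the generalised residual and \<open>b\<^sub>i\<^sub>k\<close> for the random effect of column
  \<open>k\<close> in cluster \<open>i\<close>. The normal equations for \<open>w\<close> are those of a ridge regression on all columns of the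
  design, with penalty \<open>1/\<theta>\<^sub>k\<close> on random effects and none on fixed effects. By (A0)-(A3) the
  normalised Gram matrix of these columns is diagonally dominant, so a sup-norm estimate gives
  \<open>z\<^sub>i\<^sub>k'w = (b\<^sub>i\<^sub>k + o(1)) / (\<theta>\<^sub>k + 1/|z\<^sub>i\<^sub>k|\<^sup>2)\<close> uniformly in the other variance ratios, and likewise
  \<open>z\<^sub>i\<^sub>k'H\<^sup>-\<^sup>1z\<^sub>i\<^sub>k = (1 + o(1)) / (\<theta>\<^sub>k + 1/|z\<^sub>i\<^sub>k|\<^sup>2)\<close>. The first-order condition in \<open>\<theta>\<^sub>k\<close>, namely
  \<open>\<Sum>\<^sub>i z\<^sub>i\<^sub>k'H\<^sup>-\<^sup>1z\<^sub>i\<^sub>k = v\<^sup>-\<^sup>2 \<Sum>\<^sub>i (z\<^sub>i\<^sub>k'w)\<^sup>2\<close>, then forces \<open>\<theta>\<^sub>kv\<^sup>2\<close> to be close to \<open>m\<^sup>-\<^sup>1 \<Sum>\<^sub>i b\<^sub>i\<^sub>k\<^sup>2\<close>, which is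
  \<open>\<sigma>\<^sub>k\<^sup>2/m\<close> times a chi-square variable with \<open>m\<close> degrees of freedom.

  The clusters may have very different sizes, and the estimate above is at first uniform only for the
  largest cluster. That suffices to bound every \<open>\<theta>\<^sub>k\<close> with \<open>k \<in> \<gamma>\<^sub>0\<close> away from 0, after which it
  holds in all clusters.
\<close>

text \<open>The first-order condition presupposes a minimiser, but \<open>mle\<close> provides one
  only where one exists, so existence itself has to be proved, outside a null event. The danger is a
  vanishing residual, which would make -2 log L unbounded below as v tends to 0. A vector
  \<open>w0\<close> orthogonal to all columns keeps the residual sum of squares away from 0
  uniformly in \<theta>, unless \<open>w0\<close> happens to be orthogonal to the noise.

  Probability enters only through a few bad events; on their complement every estimate is
  deterministic. The constants are fixed in an order that avoids circularity. Tightness gives the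
  range \<open>\<eta>0\<close>, \<open>R\<close> of the true effects, which form a fixed finite
  family even if the number of columns grows. These determine the bound \<open>V\<close> for the
  variance estimate and the lower bound \<open>\<eta>1\<close> for the variance ratios. Then follow
  the accuracy \<open>u\<close>, the noise level \<open>\<eta>\<close> and last the coherence
  \<delta> demanded of the design.\<close>

section \<open>Ridge systems with a nearly orthogonal design\<close>

text \<open>Here \<open>\<rho>\<close> is the estimation error and \<open>t\<close> the true coefficient; the shrinkage \<open>sh a\<close> is 0 for an
  unpenalised column and 1 for a coefficient forced to be 0.\<close>

lemma ridge_offdiag_bound:
  fixes G :: "'i \<Rightarrow> 'i \<Rightarrow> real"
  assumes fin: "finite C"
    and pos: "\<And>a. a \<in> C \<Longrightarrow> 0 < G a a"
    and coh: "\<And>a b. a \<in> C \<Longrightarrow> b \<in> C \<Longrightarrow> a \<noteq> b \<Longrightarrow> \<bar>G a b\<bar> \<le> \<kappa> * sqrt (G a a) * sqrt (G b b)"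
    and kap: "0 \<le> \<kappa>" "real (card C) * \<kappa> \<le> \<delta>" "\<delta> \<le> 1/2"
    and sh: "\<And>a. a \<in> C \<Longrightarrow> 0 \<le> sh a \<and> sh a \<le> 1"
    and ofd: "\<And>a. a \<in> C \<Longrightarrow> ofd a = (\<Sum>b\<in>C-{a}. G a b * \<rho> b) + e a"
    and rho: "\<And>a. a \<in> C \<Longrightarrow> \<rho> a = sh a * t a - (1 - sh a) * ofd a / G a a"
    and e: "\<And>a. a \<in> C \<Longrightarrow> \<bar>e a\<bar> \<le> E * sqrt (G a a)"
    and B: "\<And>a. a \<in> C \<Longrightarrow> \<bar>sh a * t a\<bar> * sqrt (G a a) \<le> B"
    and a: "a \<in> C"
  shows "\<bar>ofd a\<bar> \<le> (2 * \<delta> * (B + E) + E) * sqrt (G a a)"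
proof -
  \<comment> \<open>Sup norm of the errors, weighted by the column norms: in this scaling every
    off-diagonal coefficient is at most \<open>\<kappa>\<close>, so a row sum costs at most \<delta>
    times \<open>\<Phi>\<close>.\<close>
  define \<Phi> where "\<Phi> = Max ((\<lambda>a. \<bar>\<rho> a\<bar> * sqrt (G a a)) ` C)"
  have \<Phi>_ge: "\<bar>\<rho> a\<bar> * sqrt (G a a) \<le> \<Phi>" if "a \<in> C" for a
    unfolding \<Phi>_def using fin that by (intro Max_ge) auto
  have \<Phi>0: "0 \<le> \<Phi>" using \<Phi>_ge[OF a] pos[OF a]
    by (smt (verit) mult_nonneg_nonneg real_sqrt_ge_zero)
  have \<delta>0: "0 \<le> \<delta>" using kap by (meson mult_nonneg_nonneg of_nat_0_le_iff order_trans)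
  have offb: "\<bar>ofd a\<bar> \<le> (\<delta> * \<Phi> + E) * sqrt (G a a)" if a: "a \<in> C" for a
  proof -
    have "\<bar>\<Sum>b\<in>C-{a}. G a b * \<rho> b\<bar> \<le> (\<Sum>b\<in>C-{a}. \<bar>G a b * \<rho> b\<bar>)" by (rule sum_abs)
    also have "\<dots> \<le> (\<Sum>b\<in>C-{a}. \<kappa> * sqrt (G a a) * \<Phi>)"
    proof (rule sum_mono)
      fix b assume b: "b \<in> C - {a}"
      have "\<bar>G a b * \<rho> b\<bar> \<le> (\<kappa> * sqrt (G a a) * sqrt (G b b)) * \<bar>\<rho> b\<bar>"
        unfolding abs_mult using coh[OF a, of b] b by (intro mult_right_mono) auto
      also have "\<dots> = \<kappa> * sqrt (G a a) * (\<bar>\<rho> b\<bar> * sqrt (G b b))" by (simp add: ac_simps)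
      also have "\<dots> \<le> \<kappa> * sqrt (G a a) * \<Phi>"
        using \<Phi>_ge[of b] b kap pos[OF a] by (intro mult_left_mono) auto
      finally show "\<bar>G a b * \<rho> b\<bar> \<le> \<kappa> * sqrt (G a a) * \<Phi>" .
    qed
    also have "\<dots> = real (card (C-{a})) * \<kappa> * (sqrt (G a a) * \<Phi>)" by simp
    also have "\<dots> \<le> \<delta> * (sqrt (G a a) * \<Phi>)"
    proof (rule mult_right_mono)
      have "real (card (C-{a})) * \<kappa> \<le> real (card C) * \<kappa>"
        using kap fin by (intro mult_right_mono) (auto intro: card_mono)
      then show "real (card (C-{a})) * \<kappa> \<le> \<delta>" using kap by linarith
    qed (use \<Phi>0 pos[OF a] in auto)
    finally show ?thesis unfolding ofd[OF a] using e[OF a] by (simp add: algebra_simps)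
  qed
  have rb: "\<bar>\<rho> a\<bar> * sqrt (G a a) \<le> B + (\<delta> * \<Phi> + E)" if a: "a \<in> C" for a
  proof -
    have s: "0 < sqrt (G a a)" "sqrt (G a a) * sqrt (G a a) = G a a" using pos[OF a] by auto
    have q: "\<bar>ofd a\<bar> / G a a * sqrt (G a a) \<le> ((\<delta> * \<Phi> + E) * sqrt (G a a)) / G a a * sqrt (G a a)"
      using offb[OF a] pos[OF a] s by (intro mult_right_mono divide_right_mono) auto
    have "\<bar>(1 - sh a) * ofd a / G a a\<bar> * sqrt (G a a) = (1 - sh a) * (\<bar>ofd a\<bar> / G a a * sqrt (G a a))"
      using sh[OF a] pos[OF a] by (simp add: abs_mult)
    also have "\<dots> \<le> 1 * (\<bar>ofd a\<bar> / G a a * sqrt (G a a))"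
      using sh[OF a] pos[OF a] by (intro mult_right_mono) auto
    also have "\<dots> \<le> ((\<delta> * \<Phi> + E) * sqrt (G a a)) / G a a * sqrt (G a a)" using q by simp
    also have "\<dots> = \<delta> * \<Phi> + E" using s pos[OF a] by (simp add: field_simps)
    finally have 2: "\<bar>(1 - sh a) * ofd a / G a a\<bar> * sqrt (G a a) \<le> \<delta> * \<Phi> + E" .
    have "\<bar>\<rho> a\<bar> * sqrt (G a a) \<le> (\<bar>sh a * t a\<bar> + \<bar>(1 - sh a) * ofd a / G a a\<bar>) * sqrt (G a a)"
      unfolding rho[OF a] using s by (intro mult_right_mono) (use abs_triangle_ineq4 in blast, simp)
    with 2 B[OF a] show ?thesis by (simp add: algebra_simps)
  qed
  \<comment> \<open>Self-bounding inequality: since \<delta> \<le> 1/2, the \<open>\<Phi>\<close> on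
    the right is absorbed into half of the one on the left.\<close>
  have "\<Phi> \<le> B + (\<delta> * \<Phi> + E)" unfolding \<Phi>_def
    by (subst Max_le_iff) (use fin a rb \<Phi>_def in auto)
  moreover have "\<delta> * \<Phi> \<le> 1/2 * \<Phi>" using kap \<Phi>0 by (intro mult_right_mono)
  ultimately have "\<Phi> \<le> 2 * (B + E)" by argo
  then have "\<delta> * \<Phi> \<le> \<delta> * (2 * (B + E))" using \<delta>0 by (intro mult_left_mono)
  then have "(\<delta> * \<Phi> + E) * sqrt (G a a) \<le> (2 * \<delta> * (B + E) + E) * sqrt (G a a)"
    using pos[OF a] by (intro mult_right_mono) (auto simp: algebra_simps)
  with offb[OF a] show ?thesis by linarith
qed

section \<open>Inner products and the clustered design\<close>

definition ip :: "nat \<Rightarrow> (nat \<Rightarrow> real) \<Rightarrow> (nat \<Rightarrow> real) \<Rightarrow> real" where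
  "ip N f g = (\<Sum>r<N. f r * g r)"

lemma ip_commute: "ip N f g = ip N g f"
  by (simp add: ip_def mult.commute)

lemma ip_add_right: "ip N f (\<lambda>r. g r + h r) = ip N f g + ip N f h"
  by (simp add: ip_def algebra_simps sum.distrib)

lemma ip_diff_right: "ip N f (\<lambda>r. g r - h r) = ip N f g - ip N f h"
  by (simp add: ip_def algebra_simps sum_subtractf)

lemma ip_scale_right: "ip N f (\<lambda>r. c * g r) = c * ip N f g"
  by (simp add: ip_def sum_distrib_left algebra_simps)

lemma ip_sum_right: "ip N f (\<lambda>r. \<Sum>a\<in>A. g a r) = (\<Sum>a\<in>A. ip N f (g a))"
  unfolding ip_def by (subst sum.swap) (simp add: sum_distrib_left)

lemma ip_cong: "(\<And>r. r < N \<Longrightarrow> f r = f' r) \<Longrightarrow> (\<And>r. r < N \<Longrightarrow> g r = g' r) \<Longrightarrow> ip N f g = ip N f' g'"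
  by (simp add: ip_def)

lemma ip_nonneg: "0 \<le> ip N f f"
  by (simp add: ip_def sum_nonneg)

lemmas ip_right = ip_add_right ip_diff_right ip_scale_right ip_sum_right

text \<open>Each \<open>Z i l\<close> is a column of the block-diagonal Z, padded by zeros outside
  cluster \<open>i\<close>. Disjointness of supports is all that remains of the block structure, so
  no block matrices have to be handled.\<close>

locale design =
  fixes N m :: nat and X :: "nat \<Rightarrow> nat \<Rightarrow> real" and Z :: "nat \<Rightarrow> nat \<Rightarrow> nat \<Rightarrow> real"
    and \<gamma> :: "nat set"
  assumes fin_\<gamma>: "finite \<gamma>"
    and clusters_disjoint: "\<And>i i' l l' r. i \<noteq> i' \<Longrightarrow> Z i l r * Z i' l' r = 0"
begin

abbreviation zz :: "nat \<Rightarrow> nat \<Rightarrow> real" where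
  "zz i l \<equiv> ip N (Z i l) (Z i l)"

text \<open>The action of the matrix H(\<theta>) on a vector. Equations
  \<open>Hop \<theta> w r = y r\<close> replace applications of its inverse.\<close>

definition Hop :: "(nat \<Rightarrow> real) \<Rightarrow> (nat \<Rightarrow> real) \<Rightarrow> nat \<Rightarrow> real" where
  "Hop \<theta> w r = w r + (\<Sum>i<m. \<Sum>l\<in>\<gamma>. \<theta> l * ip N (Z i l) w * Z i l r)"

text \<open>\<open>gls \<alpha> y \<theta> w\<close> characterises \<open>w = H(\<theta>)\<^sup>-\<^sup>1(I - M)y\<close> without inverting a matrix.\<close>

definition gls :: "nat set \<Rightarrow> (nat \<Rightarrow> real) \<Rightarrow> (nat \<Rightarrow> real) \<Rightarrow> (nat \<Rightarrow> real) \<Rightarrow> bool" where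
  "gls \<alpha> y \<theta> w \<longleftrightarrow> (\<forall>j\<in>\<alpha>. ip N (X j) w = 0) \<and>
     (\<exists>\<beta>. \<forall>r<N. Hop \<theta> w r = y r - (\<Sum>j\<in>\<alpha>. \<beta> j * X j r))"

definition col :: "nat + nat \<times> nat \<Rightarrow> nat \<Rightarrow> real" where
  "col a = (case a of Inl j \<Rightarrow> X j | Inr (i, l) \<Rightarrow> Z i l)"

lemma col_simps [simp]: "col (Inl j) = X j" "col (Inr (i, l)) = Z i l"
  by (simp_all add: col_def)

text \<open>Fixed and random columns share one index type so that the ridge estimate treats both
  alike; they differ only in the shrinkage factor.\<close>

definition cols :: "nat set \<Rightarrow> (nat + nat \<times> nat) set" where
  "cols \<alpha> = Inl ` \<alpha> \<union> Inr ` ({..<m} \<times> \<gamma>)"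

lemma finite_cols: "finite \<alpha> \<Longrightarrow> finite (cols \<alpha>)"
  using fin_\<gamma> by (auto simp: cols_def)

lemma sum_cols: "finite \<alpha> \<Longrightarrow> (\<Sum>a\<in>cols \<alpha>. f a) = (\<Sum>j\<in>\<alpha>. f (Inl j)) + (\<Sum>i<m. \<Sum>l\<in>\<gamma>. f (Inr (i, l)))"
  unfolding cols_def using fin_\<gamma>
  by (subst sum.union_disjoint) (auto simp: sum.reindex sum.cartesian_product split_def)

text \<open>Diagonal dominance of the Gram matrix after scaling the columns to unit length: a row
  has at most \<open>card (cols \<alpha>)\<close> off-diagonal entries of size at most
  \<open>\<kappa>\<close>, hence absolute off-diagonal sum at most \<delta>.\<close>

definition coherent :: "nat set \<Rightarrow> real \<Rightarrow> bool" where
  "coherent \<alpha> \<delta> \<longleftrightarrow> finite \<alpha> \<and> \<delta> \<le> 1/2 \<and> (\<forall>a\<in>cols \<alpha>. 0 < ip N (col a) (col a)) \<and>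
    (\<exists>\<kappa>\<ge>0. real (card (cols \<alpha>)) * \<kappa> \<le> \<delta> \<and>
      (\<forall>a\<in>cols \<alpha>. \<forall>b\<in>cols \<alpha>. a \<noteq> b \<longrightarrow>
        \<bar>ip N (col a) (col b)\<bar> \<le> \<kappa> * sqrt (ip N (col a) (col a)) * sqrt (ip N (col b) (col b))))"

text \<open>Leverages involve the inverse of H without any projection off the fixed effects; they
  are therefore estimated in the model with no fixed effects.\<close>

lemma coherent_empty: "coherent \<alpha> \<delta> \<Longrightarrow> coherent {} \<delta>"
proof -
  assume c: "coherent \<alpha> \<delta>"
  then have fin: "finite \<alpha>" by (simp add: coherent_def)
  have sub: "cols {} \<subseteq> cols \<alpha>" by (auto simp: cols_def)
  obtain \<kappa> where k: "\<kappa> \<ge> 0" "real (card (cols \<alpha>)) * \<kappa> \<le> \<delta>"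
    "\<forall>a\<in>cols \<alpha>. \<forall>b\<in>cols \<alpha>. a \<noteq> b \<longrightarrow>
        \<bar>ip N (col a) (col b)\<bar> \<le> \<kappa> * sqrt (ip N (col a) (col a)) * sqrt (ip N (col b) (col b))"
    using c by (auto simp: coherent_def)
  have "real (card (cols {})) * \<kappa> \<le> real (card (cols \<alpha>)) * \<kappa>"
    using k(1) card_mono[OF finite_cols[OF fin] sub] by (intro mult_right_mono) auto
  then have "real (card (cols {})) * \<kappa> \<le> \<delta>" using k by linarith
  then show ?thesis using c k sub unfolding coherent_def by (intro conjI exI[of _ \<kappa>]) auto
qed

text \<open>\<open>\<theta> l * ip N (Z i l) w\<close> is the best linear unbiased predictor of
  \<open>b i l\<close>. Written as noise plus a combination of all columns whose coefficients are
  the estimation errors, \<open>w\<close> satisfies the ridge system estimated above.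
  \<open>B\<close> bounds the effects after shrinkage by 1 / (1 + \<theta> zz), in units of the
  column norm. It is used in two ways: with no shrinkage at all, and with \<theta> bounded away from
  0.\<close>

lemma blup_approx:
  assumes coh: "coherent \<alpha> \<delta>"
    and w: "gls \<alpha> y \<theta> w"
    and \<theta>: "\<And>l. l \<in> \<gamma> \<Longrightarrow> 0 \<le> \<theta> l"
    and y: "\<And>r. r < N \<Longrightarrow> y r = (\<Sum>j\<in>\<alpha>. bx j * X j r) + (\<Sum>i<m. \<Sum>l\<in>\<gamma>. b i l * Z i l r) + \<epsilon> r"
    and E: "\<And>a. a \<in> cols \<alpha> \<Longrightarrow> \<bar>ip N (col a) \<epsilon>\<bar> \<le> E * sqrt (ip N (col a) (col a))"
    and B: "\<And>i l. i < m \<Longrightarrow> l \<in> \<gamma> \<Longrightarrow>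
        \<bar>b i l\<bar> * sqrt (zz i l) \<le> B * (1 + \<theta> l * zz i l)"
    and B0: "0 \<le> B"
    and ik: "i < m" "k \<in> \<gamma>"
  shows "\<exists>r. ip N (Z i k) w * (\<theta> k + 1 / zz i k) = b i k + r \<and>
     \<bar>r\<bar> * sqrt (zz i k) \<le> 2 * \<delta> * (B + E) + E"
proof -
  obtain \<beta> where perp: "\<And>j. j \<in> \<alpha> \<Longrightarrow> ip N (X j) w = 0"
    and \<beta>: "\<And>r. r < N \<Longrightarrow> Hop \<theta> w r = y r - (\<Sum>j\<in>\<alpha>. \<beta> j * X j r)"
    using w by (auto simp: gls_def)
  have fin: "finite \<alpha>" using coh by (simp add: coherent_def)
  define G where "G a c = ip N (col a) (col c)" for a c
  have pos: "0 < G a a" if "a \<in> cols \<alpha>" for a using coh that by (simp add: coherent_def G_def)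
  define \<rho> where "\<rho> a = (case a of Inl j \<Rightarrow> bx j - \<beta> j | Inr (i, l) \<Rightarrow> b i l - \<theta> l * ip N (Z i l) w)" for a
  define ofd where "ofd a = (\<Sum>c\<in>cols \<alpha>-{a}. G a c * \<rho> c) + ip N (col a) \<epsilon>" for a
  define sh where "sh a = (case a of Inl j \<Rightarrow> 0 | Inr (i, l) \<Rightarrow> 1 / (1 + \<theta> l * zz i l))"
    for a :: "nat + nat \<times> nat"
  define t where "t a = (case a of Inl j \<Rightarrow> 0 | Inr (i, l) \<Rightarrow> b i l)" for a :: "nat + nat \<times> nat"
  \<comment> \<open>Fitted fixed effects and predicted random effects are subtracted from the true
    ones column by column, which leaves the errors \<open>\<rho>\<close> as coefficients.\<close>
  have weq: "w r = (\<Sum>a\<in>cols \<alpha>. \<rho> a * col a r) + \<epsilon> r" if "r < N" for r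
    using \<beta>[OF that] y[OF that] unfolding sum_cols[OF fin] Hop_def
    by (simp add: \<rho>_def algebra_simps sum_subtractf sum.distrib)
  have ipw: "ip N (col a) w = G a a * \<rho> a + ofd a" if "a \<in> cols \<alpha>" for a
  proof -
    have "ip N (col a) w = ip N (col a) (\<lambda>r. (\<Sum>c\<in>cols \<alpha>. \<rho> c * col c r) + \<epsilon> r)"
      by (rule ip_cong) (auto simp: weq)
    also have "\<dots> = (\<Sum>c\<in>cols \<alpha>. G a c * \<rho> c) + ip N (col a) \<epsilon>"
      by (simp add: ip_right G_def mult.commute)
    also have "(\<Sum>c\<in>cols \<alpha>. G a c * \<rho> c) = G a a * \<rho> a + (\<Sum>c\<in>cols \<alpha>-{a}. G a c * \<rho> c)"
      using finite_cols[OF fin] that by (rule sum.remove)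
    finally show ?thesis by (simp add: ofd_def)
  qed
  have zrho: "sh (Inr (i, l)) * b i l - (1 - sh (Inr (i, l))) * ofd (Inr (i, l)) / G (Inr (i, l)) (Inr (i, l)) = \<rho> (Inr (i, l))
      \<and> 0 \<le> sh (Inr (i,l)) \<and> sh (Inr (i,l)) \<le> 1" if "i < m" "l \<in> \<gamma>" for i l
  proof -
    let ?a = "Inr (i, l)"
    define D where "D = G ?a ?a"
    have a: "?a \<in> cols \<alpha>" using that by (auto simp: cols_def)
    have D: "0 < D" using pos[OF a] by (simp add: D_def)
    have t0: "0 \<le> \<theta> l" using \<theta> that by auto
    then have p: "0 < 1 + \<theta> l * D" using D by (smt (verit) mult_nonneg_nonneg)
    have sh: "sh ?a = 1 / (1 + \<theta> l * D)" by (simp add: sh_def D_def G_def)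
    have "ip N (Z i l) w = D * \<rho> ?a + ofd ?a" using ipw[OF a] by (simp add: D_def)
    \<comment> \<open>The error occurs on both sides because the predictor itself is computed from
      \<open>w\<close>; solving for it produces the shrinkage factor 1 / (1 + \<theta> l *
      D).\<close>
    then have r: "\<rho> ?a = b i l - \<theta> l * (D * \<rho> ?a + ofd ?a)" by (simp add: \<rho>_def)
    have "\<rho> ?a * (1 + \<theta> l * D) = b i l - \<theta> l * ofd ?a" using r by (simp add: algebra_simps)
    then have r2: "\<rho> ?a = (b i l - \<theta> l * ofd ?a) / (1 + \<theta> l * D)" using p by (simp add: field_simps)
    have "sh ?a * b i l - (1 - sh ?a) * ofd ?a / D = \<rho> ?a"
    proof -
      have "1 - sh ?a = \<theta> l * D / (1 + \<theta> l * D)" unfolding sh using p by (simp add: field_simps)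
      then have "(1 - sh ?a) * ofd ?a / D = \<theta> l * ofd ?a / (1 + \<theta> l * D)" using D by simp
      then show ?thesis unfolding r2 sh by (simp add: diff_divide_distrib)
    qed
    moreover have "0 \<le> sh ?a" "sh ?a \<le> 1" unfolding sh using p D t0 by (auto simp: field_simps)
    ultimately show ?thesis by (simp add: D_def)
  qed
  obtain \<kappa> where k: "\<kappa> \<ge> 0" "real (card (cols \<alpha>)) * \<kappa> \<le> \<delta>"
    "\<And>a c. a\<in>cols \<alpha> \<Longrightarrow> c\<in>cols \<alpha> \<Longrightarrow> a \<noteq> c \<Longrightarrow> \<bar>G a c\<bar> \<le> \<kappa> * sqrt (G a a) * sqrt (G c c)"
    using coh by (auto simp: coherent_def G_def)
  have \<delta>: "\<delta> \<le> 1/2" using coh by (simp add: coherent_def)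
  have bound: "\<bar>ofd a\<bar> \<le> (2 * \<delta> * (B + E) + E) * sqrt (G a a)" if "a \<in> cols \<alpha>" for a
  proof (rule ridge_offdiag_bound[where C = "cols \<alpha>" and G = G and \<kappa> = \<kappa> and sh = sh and t = t and \<rho> = \<rho> and e = "\<lambda>a. ip N (col a) \<epsilon>"])
    show "\<rho> a = sh a * t a - (1 - sh a) * ofd a / G a a" if aC: "a \<in> cols \<alpha>" for a
    proof (cases a)
      case (Inl j)
      then have "0 = G a a * \<rho> a + ofd a" using ipw[OF that] perp that by (auto simp: cols_def)
      then have "\<rho> a = - ofd a / G a a" using pos[OF that] by (simp add: field_simps)
      then show ?thesis by (simp add: Inl sh_def t_def)
    next
      case (Inr il)
      then obtain i l where "a = Inr (i, l)" "i < m" "l \<in> \<gamma>" using aC by (auto simp: cols_def)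
      then show ?thesis using zrho[of i l] by (simp add: t_def)
    qed
    show "0 \<le> sh a \<and> sh a \<le> 1" if aC: "a \<in> cols \<alpha>" for a
    proof (cases a)
      case (Inl j) then show ?thesis by (simp add: sh_def)
    next
      case (Inr il)
      then obtain i l where "a = Inr (i, l)" "i < m" "l \<in> \<gamma>" using aC by (auto simp: cols_def)
      then show ?thesis using zrho[of i l] by simp
    qed
    show "\<bar>sh a * t a\<bar> * sqrt (G a a) \<le> B" if aC: "a \<in> cols \<alpha>" for a
    proof (cases a)
      case (Inl j) then show ?thesis using B0 by (simp add: sh_def)
    next
      case (Inr il)
      then obtain i l where a: "a = Inr (i, l)" and il: "i < m" "l \<in> \<gamma>" using aC by (auto simp: cols_def)
      define D where "D = G a a"
      have D: "0 < D" using pos[OF that] by (simp add: D_def)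
      have p: "0 < 1 + \<theta> l * D" using D \<theta>[OF il(2)] by (smt (verit) mult_nonneg_nonneg)
      have "\<bar>b i l\<bar> * sqrt D \<le> B * (1 + \<theta> l * D)" using B[OF il] by (simp add: D_def G_def a)
      moreover have "\<bar>sh a * t a\<bar> = \<bar>b i l\<bar> / (1 + \<theta> l * D)"
        using p by (simp add: a sh_def t_def D_def G_def abs_mult)
      ultimately show ?thesis using p by (simp add: D_def[symmetric] divide_le_eq)
    qed
  qed (use finite_cols[OF fin] pos k \<delta> E that in \<open>auto simp: ofd_def G_def[symmetric]\<close>)
  let ?a = "Inr (i, k)"
  have a: "?a \<in> cols \<alpha>" using ik by (auto simp: cols_def)
  define D where "D = zz i k"
  have D: "0 < D" and GD: "G ?a ?a = D" using pos[OF a] by (auto simp: D_def G_def)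
  have t0: "0 \<le> \<theta> k" using \<theta> ik by auto
  have w1: "ip N (Z i k) w = D * (b i k - \<theta> k * ip N (Z i k) w) + ofd ?a"
    using ipw[OF a] GD by (simp add: \<rho>_def)
  \<comment> \<open>Dividing the normal equation by \<open>D\<close> collects the factor \<theta> k
    + 1/D, which stays positive at \<theta> k = 0.\<close>
  have 1: "ip N (Z i k) w * (\<theta> k + 1/D) = b i k + ofd ?a / D"
  proof -
    have "ip N (Z i k) w * (\<theta> k + 1/D) = (D * (ip N (Z i k) w * \<theta> k) + ip N (Z i k) w) / D"
      using D by (simp add: field_simps)
    also have "D * (ip N (Z i k) w * \<theta> k) + ip N (Z i k) w = D * b i k + ofd ?a"
      using w1 by (simp add: algebra_simps)
    finally show ?thesis using D by (simp add: field_simps)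
  qed
  have "\<bar>ofd ?a / D\<bar> * sqrt D = \<bar>ofd ?a\<bar> / sqrt D"
    using D by (simp add: field_simps)
  also have "\<dots> \<le> 2 * \<delta> * (B + E) + E"
    using bound[OF a] D unfolding GD by (simp add: divide_le_eq)
  finally show ?thesis using 1 unfolding D_def by blast
qed

end

section \<open>The covariance matrix and its determinant\<close>

lemma minv_inverse:
  assumes A: "A \<in> carrier_mat n n" and d: "det A \<noteq> 0"
  shows "A * minv A = 1\<^sub>m n \<and> minv A * A = 1\<^sub>m n \<and> minv A \<in> carrier_mat n n"
proof (cases "mat_inverse A")
  case None
  from mat_inverse(1)[OF A this, of "()"] det_non_zero_imp_unit[OF A d, of "()"] show ?thesis by blast
next
  case (Some B)
  from mat_inverse(2)[OF A this] show ?thesis by (simp add: minv_def Some)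
qed

text \<open>Sylvester's identity det(1 + uv) = det(1 + vu) for a column u and a row v. The update
  direction has the form \<open>A *\<^sub>v a\<close>, so no inverse of \<open>A\<close> appears:
  the caller supplies the solution \<open>a\<close>.\<close>

lemma det_rank_one_update:
  fixes A :: "real mat"
  assumes A: "A \<in> carrier_mat N N" and a: "a \<in> carrier_vec N"
  shows "det (mat N N (\<lambda>(r, s). A $$ (r, s) + h * (A *\<^sub>v a) $ r * z s))
       = det A * (1 + h * (\<Sum>s<N. z s * a $ s))"
proof -
  define u where "u = mat N 1 (\<lambda>(r, s). h * a $ r)"
  define v where "v = mat 1 N (\<lambda>(r, s). z s)"
  have c: "u \<in> carrier_mat N 1" "v \<in> carrier_mat 1 N" by (auto simp: u_def v_def)
  have uv: "u * v \<in> carrier_mat N N" and vu: "v * u \<in> carrier_mat 1 1" using c by auto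
  \<comment> \<open>The bordered matrix with blocks 1, -v, u, 1 is factored in two ways into block
    triangular matrices; their determinants are det(1 + uv) and det(1 + vu).\<close>
  have P: "four_block_mat (1\<^sub>m 1) (0\<^sub>m 1 N) u (1\<^sub>m N) * four_block_mat (1\<^sub>m 1) (- v) (0\<^sub>m N 1) (1\<^sub>m N + u * v)
     = four_block_mat (1\<^sub>m 1) (- v) u (1\<^sub>m N)"
  proof -
    have "u * (- v) + (1\<^sub>m N + u * v) = 1\<^sub>m N"
      using c uv by (intro eq_matI) (auto simp: scalar_prod_def)
    moreover have "four_block_mat (1\<^sub>m 1) (0\<^sub>m 1 N) u (1\<^sub>m N) * four_block_mat (1\<^sub>m 1) (- v) (0\<^sub>m N 1) (1\<^sub>m N + u * v)
       = four_block_mat (1\<^sub>m 1 * 1\<^sub>m 1 + 0\<^sub>m 1 N * 0\<^sub>m N 1) (1\<^sub>m 1 * (- v) + 0\<^sub>m 1 N * (1\<^sub>m N + u * v))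
         (u * 1\<^sub>m 1 + 1\<^sub>m N * 0\<^sub>m N 1) (u * (- v) + 1\<^sub>m N * (1\<^sub>m N + u * v))"
      by (rule mult_four_block_mat) (use c uv in auto)
    moreover have "1\<^sub>m N * (1\<^sub>m N + u * v) = 1\<^sub>m N + u * v"
      by (rule left_mult_one_mat) (use c uv in auto)
    ultimately show ?thesis using c uv
      by (simp add: left_mult_zero_mat[where nc = N] )
  qed
  have Q: "four_block_mat (1\<^sub>m 1 + v * u) (- v) (0\<^sub>m N 1) (1\<^sub>m N) * four_block_mat (1\<^sub>m 1) (0\<^sub>m 1 N) u (1\<^sub>m N)
     = four_block_mat (1\<^sub>m 1) (- v) u (1\<^sub>m N)"
  proof -
    have "(1\<^sub>m 1 + v * u) + (- v) * u = 1\<^sub>m 1"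
      using c vu by (intro eq_matI) (auto simp: scalar_prod_def sum_negf)
    moreover have "four_block_mat (1\<^sub>m 1 + v * u) (- v) (0\<^sub>m N 1) (1\<^sub>m N) * four_block_mat (1\<^sub>m 1) (0\<^sub>m 1 N) u (1\<^sub>m N)
       = four_block_mat ((1\<^sub>m 1 + v * u) * 1\<^sub>m 1 + (- v) * u) ((1\<^sub>m 1 + v * u) * 0\<^sub>m 1 N + (- v) * 1\<^sub>m N)
         (0\<^sub>m N 1 * 1\<^sub>m 1 + 1\<^sub>m N * u) (0\<^sub>m N 1 * 0\<^sub>m 1 N + 1\<^sub>m N * 1\<^sub>m N)"
      by (rule mult_four_block_mat) (use c vu in auto)
    moreover have "(1\<^sub>m 1 + v * u) * 1\<^sub>m 1 = 1\<^sub>m 1 + v * u"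
      by (rule right_mult_one_mat) (use c vu in auto)
    moreover have "(1\<^sub>m 1 + v * u) * 0\<^sub>m 1 N = 0\<^sub>m 1 N"
      by (rule right_mult_zero_mat) (use c vu in auto)
    ultimately show ?thesis using c vu by simp
  qed
  have "det (four_block_mat (1\<^sub>m 1) (0\<^sub>m 1 N) u (1\<^sub>m N)) = 1"
    using c by (subst det_four_block_mat_upper_right_zero[where n = 1 and m = N]) auto
  moreover have "det (four_block_mat (1\<^sub>m 1) (- v) (0\<^sub>m N 1) (1\<^sub>m N + u * v)) = det (1\<^sub>m N + u * v)"
    using c uv by (subst det_four_block_mat_lower_left_zero[where n = 1 and m = N]) auto
  moreover have "det (four_block_mat (1\<^sub>m 1 + v * u) (- v) (0\<^sub>m N 1) (1\<^sub>m N)) = det (1\<^sub>m 1 + v * u)"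
    using c vu by (subst det_four_block_mat_lower_left_zero[where n = 1 and m = N]) auto
  ultimately have "det (1\<^sub>m N + u * v) = det (1\<^sub>m 1 + v * u)"
    using arg_cong[OF trans[OF P Q[symmetric]], of det] c uv vu
    by (subst (asm) (1 2) det_mult[where n = "1 + N"]) (auto intro!: four_block_carrier_mat)
  also have "\<dots> = 1 + h * (\<Sum>s<N. z s * a $ s)"
    using c vu
    by (subst det_single) (auto simp: u_def v_def scalar_prod_def sum_distrib_left lessThan_atLeast0 algebra_simps)
  finally have d: "det (1\<^sub>m N + u * v) = 1 + h * (\<Sum>s<N. z s * a $ s)" .
  have "mat N N (\<lambda>(r, s). A $$ (r, s) + h * (A *\<^sub>v a) $ r * z s) = A * (1\<^sub>m N + u * v)"
  proof -
    have "A * (1\<^sub>m N + u * v) = A * 1\<^sub>m N + A * (u * v)"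
      by (rule mult_add_distrib_mat) (use A c uv in auto)
    also have "A * (u * v) = (A * u) * v" using A c by (intro assoc_mult_mat[symmetric])
    finally show ?thesis using A c a
      by (intro eq_matI)
        (auto simp: u_def v_def scalar_prod_def sum_distrib_left mult_mat_vec_def algebra_simps)
  qed
  then show ?thesis using A uv d by (simp add: det_mult[where n = N])
qed

context design
begin

definition HM :: "(nat \<Rightarrow> real) \<Rightarrow> real mat" where
  "HM \<theta> = mat N N (\<lambda>(r, s). (if r = s then 1 else 0) + (\<Sum>i<m. \<Sum>l\<in>\<gamma>. \<theta> l * Z i l r * Z i l s))"

lemma HM_carrier [simp]: "HM \<theta> \<in> carrier_mat N N"
  by (simp add: HM_def)

lemma dim_HM [simp]: "dim_row (HM \<theta>) = N" "dim_col (HM \<theta>) = N"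
  by (simp_all add: HM_def)

lemma HM_mult_vec:
  assumes "w \<in> carrier_vec N" "r < N"
  shows "(HM \<theta> *\<^sub>v w) $ r = Hop \<theta> (\<lambda>s. w $ s) r"
proof -
  have "(HM \<theta> *\<^sub>v w) $ r = (\<Sum>s<N. ((if r = s then 1 else 0) + (\<Sum>i<m. \<Sum>l\<in>\<gamma>. \<theta> l * Z i l r * Z i l s)) * w $ s)"
    using assms by (simp add: HM_def scalar_prod_def lessThan_atLeast0)
  also have "\<dots> = w $ r + (\<Sum>s<N. \<Sum>i<m. \<Sum>l\<in>\<gamma>. \<theta> l * Z i l r * Z i l s * w $ s)"
    using assms by (simp add: distrib_right sum.distrib sum_distrib_right if_distrib[of "\<lambda>x. x * _"] cong: if_cong)
  also have "(\<Sum>s<N. \<Sum>i<m. \<Sum>l\<in>\<gamma>. \<theta> l * Z i l r * Z i l s * w $ s)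
      = (\<Sum>i<m. \<Sum>l\<in>\<gamma>. \<Sum>s<N. \<theta> l * Z i l r * Z i l s * w $ s)"
    by (subst sum.swap, rule sum.cong[OF refl], subst sum.swap, rule refl)
  finally show ?thesis by (simp add: Hop_def ip_def sum_distrib_left sum_distrib_right algebra_simps)
qed

lemma Hop_cong: "(\<And>r. r < N \<Longrightarrow> v r = w r) \<Longrightarrow> r < N \<Longrightarrow> Hop \<theta> v r = Hop \<theta> w r"
  unfolding Hop_def by (simp cong: ip_cong)

lemma ip_Hop: "ip N u (Hop \<theta> v) = ip N u v + (\<Sum>i<m. \<Sum>l\<in>\<gamma>. \<theta> l * ip N (Z i l) u * ip N (Z i l) v)"
proof -
  have "Hop \<theta> v = (\<lambda>r. v r + (\<Sum>i<m. \<Sum>l\<in>\<gamma>. (\<theta> l * ip N (Z i l) v) * Z i l r))"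
    by (simp add: Hop_def fun_eq_iff)
  then have "ip N u (Hop \<theta> v) = ip N u v + (\<Sum>i<m. \<Sum>l\<in>\<gamma>. (\<theta> l * ip N (Z i l) v) * ip N u (Z i l))"
    by (simp only: ip_right)
  then show ?thesis by (simp add: ip_commute[of N u] algebra_simps)
qed

lemma ip_Hop_symmetric: "ip N u (Hop \<theta> v) = ip N v (Hop \<theta> u)"
  unfolding ip_Hop by (simp add: ip_commute[of N u v] algebra_simps)

lemma ip_self_le_Hop:
  assumes "\<And>l. l \<in> \<gamma> \<Longrightarrow> 0 \<le> \<theta> l"
  shows "ip N w w \<le> ip N w (Hop \<theta> w)"
proof -
  have "0 \<le> (\<Sum>i<m. \<Sum>l\<in>\<gamma>. \<theta> l * ip N (Z i l) w * ip N (Z i l) w)"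
    using assms by (intro sum_nonneg) (simp add: mult.assoc)
  then show ?thesis unfolding ip_Hop by linarith
qed

lemma ip_self_zero: "ip N w w \<le> 0 \<Longrightarrow> r < N \<Longrightarrow> w r = 0"
proof -
  assume "ip N w w \<le> 0" "r < N"
  moreover have "w r * w r \<le> ip N w w"
    unfolding ip_def using \<open>r < N\<close> by (intro member_le_sum) auto
  ultimately show "w r = 0" by (smt (verit) not_real_square_gt_zero)
qed

lemma det_HM_nonzero:
  assumes "\<And>l. l \<in> \<gamma> \<Longrightarrow> 0 \<le> \<theta> l"
  shows "det (HM \<theta>) \<noteq> 0"
proof
  assume "det (HM \<theta>) = 0"
  then obtain w where w: "w \<in> carrier_vec N" "w \<noteq> 0\<^sub>v N" "HM \<theta> *\<^sub>v w = 0\<^sub>v N"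
    using det_0_iff_vec_prod_zero_field[OF HM_carrier] by blast
  have "Hop \<theta> (\<lambda>s. w $ s) r = 0" if "r < N" for r
    using HM_mult_vec[OF w(1) that, of \<theta>] w(3) that by simp
  then have "ip N (\<lambda>s. w $ s) (Hop \<theta> (\<lambda>s. w $ s)) = 0" by (simp add: ip_def)
  then have "ip N (\<lambda>s. w $ s) (\<lambda>s. w $ s) \<le> 0" using ip_self_le_Hop[of \<theta>] assms by metis
  from ip_self_zero[OF this] have "w = 0\<^sub>v N" using w(1) by (intro eq_vecI) auto
  with w show False by simp
qed

lemma Hop_solvable:
  assumes "\<And>l. l \<in> \<gamma> \<Longrightarrow> 0 \<le> \<theta> l"
  shows "\<exists>w. \<forall>r<N. Hop \<theta> w r = y r"
proof -
  have i: "HM \<theta> * minv (HM \<theta>) = 1\<^sub>m N" "minv (HM \<theta>) \<in> carrier_mat N N"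
    using minv_inverse[OF HM_carrier det_HM_nonzero[OF assms]] by auto
  define w where "w = minv (HM \<theta>) *\<^sub>v vec N y"
  have w: "w \<in> carrier_vec N" using i by (simp add: w_def)
  have "HM \<theta> *\<^sub>v w = vec N y"
    unfolding w_def using i by (subst assoc_mult_mat_vec[symmetric, of _ N N _ N]) auto
  then have "Hop \<theta> (\<lambda>s. w $ s) r = y r" if "r < N" for r
    using HM_mult_vec[OF w that, of \<theta>] that by simp
  then show ?thesis by blast
qed

lemma cluster_orth: "i \<noteq> i' \<Longrightarrow> ip N (Z i l) (Z i' l') = 0"
  unfolding ip_def using clusters_disjoint by (intro sum.neutral) auto

text \<open>The inverse of H is block diagonal too. To see this without blocks, let \<open>v\<close>
  be the part of \<open>Hop \<theta> a\<close> minus \<open>a\<close> that lies in cluster i'. The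
  columns of that cluster have opposite inner products with \<open>a\<close> and \<open>v\<close>,
  so the squared norm of \<open>v\<close> is a sum of nonpositive terms.\<close>

lemma Hop_solution_orth:
  assumes \<theta>: "\<And>l. l \<in> \<gamma> \<Longrightarrow> 0 \<le> \<theta> l"
    and a: "\<And>r. r < N \<Longrightarrow> Hop \<theta> a r = Z i k r"
    and i': "i' < m" "i' \<noteq> i"
  shows "ip N (Z i' k') a = 0"
proof -
  define v where "v r = (\<Sum>l\<in>\<gamma>. (\<theta> l * ip N (Z i' l) a) * Z i' l r)" for r
  have veq: "v = (\<lambda>r. \<Sum>l\<in>\<gamma>. (\<theta> l * ip N (Z i' l) a) * Z i' l r)" by (simp add: v_def fun_eq_iff)
  have key: "ip N (Z i' l') a = - ip N (Z i' l') v" for l'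
  proof -
    have "0 = ip N (Z i' l') (Hop \<theta> a)"
      using ip_cong[of N "Z i' l'" "Z i' l'" "Hop \<theta> a" "Z i k"] a cluster_orth[OF i'(2)] by simp
    also have "\<dots> = ip N (Z i' l') a + (\<Sum>i<m. \<Sum>l\<in>\<gamma>. \<theta> l * ip N (Z i l) (Z i' l') * ip N (Z i l) a)"
      by (rule ip_Hop)
    also have "(\<Sum>i<m. \<Sum>l\<in>\<gamma>. \<theta> l * ip N (Z i l) (Z i' l') * ip N (Z i l) a)
       = (\<Sum>l\<in>\<gamma>. \<theta> l * ip N (Z i' l) (Z i' l') * ip N (Z i' l) a)"
      using i'(1) by (subst sum.remove[of _ i']) (auto simp: cluster_orth intro!: sum.neutral)
    also have "\<dots> = ip N (Z i' l') v"
      unfolding v_def ip_right by (simp add: ip_commute[of N _ "Z i' l'"] algebra_simps)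
    finally show ?thesis by simp
  qed
  have "ip N v v = (\<Sum>l\<in>\<gamma>. (\<theta> l * ip N (Z i' l) a) * ip N (Z i' l) v)"
    by (subst (2) veq) (simp add: ip_right ip_commute[of N v])
  also have "\<dots> \<le> 0"
  proof (rule sum_nonpos)
    fix l assume "l \<in> \<gamma>"
    then have "0 \<le> \<theta> l * (ip N (Z i' l) v * ip N (Z i' l) v)" using \<theta> by simp
    then show "(\<theta> l * ip N (Z i' l) a) * ip N (Z i' l) v \<le> 0" by (simp add: key algebra_simps)
  qed
  finally have "v r = 0" if "r < N" for r using ip_self_zero that by blast
  then have "ip N (Z i' k') v = 0" by (simp add: ip_def)
  then show ?thesis by (simp add: key)
qed

text \<open>Moving \<theta> k by h adds one rank-one term per cluster. A solution \<open>a i\<close>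
  for the original matrix stays valid after other clusters have been updated, being orthogonal to
  their columns; hence the determinant factors exactly, for h of either sign.\<close>

lemma det_HM_update:
  assumes \<theta>: "\<And>l. l \<in> \<gamma> \<Longrightarrow> 0 \<le> \<theta> l" and k: "k \<in> \<gamma>"
    and a: "\<And>i r. i < m \<Longrightarrow> r < N \<Longrightarrow> Hop \<theta> (a i) r = Z i k r"
  shows "det (HM (\<theta>(k := \<theta> k + h))) = det (HM \<theta>) * (\<Prod>i<m. 1 + h * ip N (Z i k) (a i))"
proof -
  \<comment> \<open>Only the clusters below \<open>j\<close> have received their update;
    \<open>A m\<close> is the target matrix.\<close>
  define A where "A j = mat N N (\<lambda>(r, s). HM \<theta> $$ (r, s) + (\<Sum>i<j. h * Z i k r * Z i k s))" for j
  have A0: "A 0 = HM \<theta>" by (intro eq_matI) (auto simp: A_def HM_def)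
  have step: "det (A (Suc j)) = det (A j) * (1 + h * ip N (Z j k) (a j))" if j: "j < m" for j
  proof -
    define w where "w = vec N (a j)"
    have w: "w \<in> carrier_vec N" by (simp add: w_def)
    have Aw: "(A j *\<^sub>v w) $ r = Z j k r" if r: "r < N" for r
    proof -
      have "(A j *\<^sub>v w) $ r = (\<Sum>s<N. (HM \<theta> $$ (r, s) + (\<Sum>i<j. h * Z i k r * Z i k s)) * w $ s)"
        using r w by (simp add: A_def scalar_prod_def lessThan_atLeast0)
      also have "\<dots> = (HM \<theta> *\<^sub>v w) $ r + (\<Sum>s<N. \<Sum>i<j. h * Z i k r * Z i k s * w $ s)"
        using r w HM_carrier[of \<theta>]
        by (simp add: scalar_prod_def lessThan_atLeast0 distrib_right sum.distrib sum_distrib_right)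
      also have "(HM \<theta> *\<^sub>v w) $ r = Hop \<theta> (a j) r"
        unfolding HM_mult_vec[OF w r] by (rule Hop_cong[OF _ r]) (simp add: w_def)
      also have "(\<Sum>s<N. \<Sum>i<j. h * Z i k r * Z i k s * w $ s) = (\<Sum>i<j. h * Z i k r * ip N (Z i k) (a j))"
        by (subst sum.swap) (simp add: ip_def w_def sum_distrib_left algebra_simps)
      also have "\<dots> = 0"
        using Hop_solution_orth[OF \<theta> a[OF j]] j by (intro sum.neutral) auto
      finally show ?thesis using a[OF j r] by simp
    qed
    have "A (Suc j) = mat N N (\<lambda>(r, s). A j $$ (r, s) + h * (A j *\<^sub>v w) $ r * Z j k s)"
      by (intro eq_matI) (auto simp: A_def Aw[unfolded A_def] simp del: index_mult_mat_vec)
    moreover have "det (mat N N (\<lambda>(r, s). A j $$ (r, s) + h * (A j *\<^sub>v w) $ r * Z j k s))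
      = det (A j) * (1 + h * (\<Sum>s<N. Z j k s * w $ s))"
      by (rule det_rank_one_update) (auto simp: A_def w)
    ultimately show ?thesis by (simp add: ip_def w_def)
  qed
  have ind: "j \<le> m \<Longrightarrow> det (A j) = det (HM \<theta>) * (\<Prod>i<j. 1 + h * ip N (Z i k) (a i))" for j
    by (induction j) (auto simp: A0 step)
  have "HM (\<theta>(k := \<theta> k + h)) = A m"
  proof (intro eq_matI)
    fix r s assume "r < dim_row (A m)" "s < dim_col (A m)"
    then have rs: "r < N" "s < N" by (auto simp: A_def)
    have "(\<Sum>l\<in>\<gamma>. (\<theta>(k := \<theta> k + h)) l * Z i l r * Z i l s) = (\<Sum>l\<in>\<gamma>. \<theta> l * Z i l r * Z i l s) + h * Z i k r * Z i k s" for i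
      using k fin_\<gamma> by (subst (1 2) sum.remove[of _ k]) (auto simp: algebra_simps intro!: sum.cong)
    then show "HM (\<theta>(k := \<theta> k + h)) $$ (r, s) = A m $$ (r, s)"
      using rs by (simp add: A_def HM_def sum.distrib del: fun_upd_apply)
  qed (auto simp: A_def HM_def)
  then show ?thesis using ind[of m] by simp
qed

text \<open>Bridge from the matrix expression to \<open>gls\<close>. The point to check is that the
  weighted normal matrix \<open>S\<close> is invertible, since otherwise \<open>minv\<close> would
  return its default value; this is where the rank of X enters.\<close>

lemma gls_of_minv:
  assumes \<theta>: "\<And>l. l \<in> \<gamma> \<Longrightarrow> 0 \<le> \<theta> l"
    and fin: "finite \<alpha>"
    and rank: "\<And>c. (\<And>r. r < N \<Longrightarrow> (\<Sum>j\<in>\<alpha>. c j * X j r) = 0) \<Longrightarrow> \<forall>j\<in>\<alpha>. c j = 0"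
    and Xa: "Xa = mat N (card \<alpha>) (\<lambda>(r, j). X (sorted_list_of_set \<alpha> ! j) r)"
    and M: "M = Xa * minv (transpose_mat Xa * minv (HM \<theta>) * Xa) * transpose_mat Xa * minv (HM \<theta>)"
    and y: "y \<in> carrier_vec N"
  shows "gls \<alpha> (\<lambda>r. y $ r) \<theta> (\<lambda>r. (minv (HM \<theta>) *\<^sub>v ((1\<^sub>m N - M) *\<^sub>v y)) $ r)"
proof -
  define sl where "sl = sorted_list_of_set \<alpha>"
  define K where "K = card \<alpha>"
  define Hi where "Hi = minv (HM \<theta>)"
  have bij: "bij_betw (\<lambda>j. sl ! j) {..<K} \<alpha>"
    unfolding sl_def K_def using bij_betw_nth[of "sorted_list_of_set \<alpha>" "{..<card \<alpha>}" \<alpha>] fin by simp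
  have Xa': "Xa = mat N K (\<lambda>(r, j). X (sl ! j) r)" by (simp add: Xa sl_def K_def)
  have cX: "Xa \<in> carrier_mat N K" by (simp add: Xa')
  have Hi: "HM \<theta> * Hi = 1\<^sub>m N" "Hi * HM \<theta> = 1\<^sub>m N" "Hi \<in> carrier_mat N N"
    using minv_inverse[OF HM_carrier det_HM_nonzero[OF \<theta>]] by (auto simp: Hi_def)
  have HHi: "HM \<theta> *\<^sub>v (Hi *\<^sub>v v) = v" if "v \<in> carrier_vec N" for v
    using that Hi by (subst assoc_mult_mat_vec[symmetric, of _ N N _ N]) auto
  \<comment> \<open>Coefficient vectors are indexed by positions in the sorted list of \<alpha>;
    \<open>c\<close> reindexes them by the column numbers themselves.\<close>
  define c where "c v j = v $ (inv_into {..<K} (\<lambda>j. sl ! j) j)" for v :: "real vec" and j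
  have Xv: "(Xa *\<^sub>v v) $ r = (\<Sum>j\<in>\<alpha>. c v j * X j r)" if "v \<in> carrier_vec K" "r < N" for v r
  proof -
    have "(Xa *\<^sub>v v) $ r = (\<Sum>j<K. X (sl ! j) r * v $ j)"
      using that by (simp add: Xa' scalar_prod_def lessThan_atLeast0)
    also have "\<dots> = (\<Sum>j<K. c v (sl ! j) * X (sl ! j) r)"
      using bij by (intro sum.cong) (auto simp: c_def bij_betw_def)
    also have "\<dots> = (\<Sum>j\<in>\<alpha>. c v j * X j r)"
      by (rule sum.reindex_bij_betw[OF bij])
    finally show ?thesis .
  qed
  have Xt: "(transpose_mat Xa *\<^sub>v v) $ j = ip N (X (sl ! j)) (\<lambda>s. v $ s)" if "v \<in> carrier_vec N" "j < K" for v j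
    using that by (simp add: Xa' ip_def scalar_prod_def lessThan_atLeast0)
  define S where "S = transpose_mat Xa * Hi * Xa"
  have cS: "S \<in> carrier_mat K K" using cX Hi by (auto simp: S_def)
  have Sv: "S *\<^sub>v v = transpose_mat Xa *\<^sub>v (Hi *\<^sub>v (Xa *\<^sub>v v))" if "v \<in> carrier_vec K" for v
    unfolding S_def using that cX Hi
    by (simp add: assoc_mult_mat_vec[of _ K N _ K] assoc_mult_mat_vec[of _ K N _ N])
  have "det S \<noteq> 0"
  proof
    assume "det S = 0"
    then obtain v where v: "v \<in> carrier_vec K" "v \<noteq> 0\<^sub>v K" "S *\<^sub>v v = 0\<^sub>v K"
      using det_0_iff_vec_prod_zero_field[OF cS] by blast
    define u where "u = Hi *\<^sub>v (Xa *\<^sub>v v)"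
    have u: "u \<in> carrier_vec N" using Hi cX v by (simp add: u_def)
    have Hu: "Hop \<theta> (\<lambda>s. u $ s) r = (\<Sum>j\<in>\<alpha>. c v j * X j r)" if "r < N" for r
      using HM_mult_vec[OF u that, of \<theta>] HHi[of "Xa *\<^sub>v v"] cX v Xv[OF v(1) that] by (simp add: u_def)
    have perp: "ip N (X j) (\<lambda>s. u $ s) = 0" if jA: "j \<in> \<alpha>" for j
    proof -
      obtain j' where "j' < K" "j = sl ! j'" using bij jA by (auto simp: bij_betw_def)
      moreover have "transpose_mat Xa *\<^sub>v u = 0\<^sub>v K" using Sv[OF v(1)] v(3) by (simp add: u_def)
      ultimately show ?thesis using Xt[OF u, of j'] by simp
    qed
    \<comment> \<open>H u lies in the span of the columns of X(\<alpha>) while u is orthogonal to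
      it, so positivity of H forces u = 0, and then the combination of columns given by
      \<open>v\<close> vanishes.\<close>
    have "ip N (\<lambda>s. u $ s) (Hop \<theta> (\<lambda>s. u $ s)) = ip N (\<lambda>s. u $ s) (\<lambda>r. \<Sum>j\<in>\<alpha>. c v j * X j r)"
      by (rule ip_cong) (auto simp: Hu)
    also have "\<dots> = 0" by (simp add: ip_right ip_commute[of N "\<lambda>s. u $ s"] perp)
    finally have "ip N (\<lambda>s. u $ s) (\<lambda>s. u $ s) \<le> 0" using ip_self_le_Hop[of \<theta> "\<lambda>s. u $ s"] \<theta> by simp
    from ip_self_zero[OF this] have u0: "u $ r = 0" if "r < N" for r using that by simp
    have "(\<Sum>j\<in>\<alpha>. c v j * X j r) = 0" if "r < N" for r
      using Hu[OF that] u0 that by (simp add: Hop_def ip_def)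
    from rank[OF this] have c0: "\<And>j. j \<in> \<alpha> \<Longrightarrow> c v j = 0" by blast
    have "v = 0\<^sub>v K"
    proof (intro eq_vecI)
      fix j assume "j < dim_vec (0\<^sub>v K :: real vec)"
      then have "j < K" by simp
      then have "sl ! j \<in> \<alpha>" "c v (sl ! j) = v $ j" using bij by (auto simp: bij_betw_def c_def)
      then show "v $ j = 0\<^sub>v K $ j" using c0 \<open>j < K\<close> by simp
    qed (use v in auto)
    with v show False by simp
  qed
  from minv_inverse[OF cS this] have G: "S * minv S = 1\<^sub>m K" "minv S \<in> carrier_mat K K" by auto
  define g where "g = minv S *\<^sub>v (transpose_mat Xa *\<^sub>v (Hi *\<^sub>v y))"
  have g: "g \<in> carrier_vec K" using G cX Hi y by (simp add: g_def)
  have MX: "M = Xa * minv S * transpose_mat Xa * Hi" by (simp add: M S_def Hi_def)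
  have cM: "M \<in> carrier_mat N N" unfolding MX using cX G Hi by auto
  have My: "M *\<^sub>v y = Xa *\<^sub>v g"
    unfolding MX g_def using cX G Hi y
    by (simp add: assoc_mult_mat_vec[of _ N N _ N] assoc_mult_mat_vec[of _ N K _ N] assoc_mult_mat_vec[of _ N K _ K])
  have res: "(1\<^sub>m N - M) *\<^sub>v y = y - Xa *\<^sub>v g"
    using cM y My by (simp add: minus_mult_distrib_mat_vec[of _ N N])
  define w where "w = Hi *\<^sub>v (y - Xa *\<^sub>v g)"
  have cy: "y - Xa *\<^sub>v g \<in> carrier_vec N" using y cX g by auto
  have w: "w \<in> carrier_vec N" using Hi cy by (simp add: w_def)
  have "Hop \<theta> (\<lambda>s. w $ s) r = y $ r - (\<Sum>j\<in>\<alpha>. c g j * X j r)" if "r < N" for r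
    using HM_mult_vec[OF w that, of \<theta>] HHi[OF cy] Xv[OF g that] y cX g that by (simp add: w_def)
  moreover have "ip N (X j) (\<lambda>s. w $ s) = 0" if jA: "j \<in> \<alpha>" for j
  proof -
    obtain j' where j': "j' < K" "j = sl ! j'" using bij jA by (auto simp: bij_betw_def)
    have "transpose_mat Xa *\<^sub>v w = transpose_mat Xa *\<^sub>v (Hi *\<^sub>v y) - S *\<^sub>v g"
      unfolding w_def Sv[OF g] using Hi y cX g
      by (simp add: mult_minus_distrib_mat_vec[of _ N N] mult_minus_distrib_mat_vec[of _ K N])
    also have "S *\<^sub>v g = transpose_mat Xa *\<^sub>v (Hi *\<^sub>v y)"
    proof -
      have "S *\<^sub>v g = (S * minv S) *\<^sub>v (transpose_mat Xa *\<^sub>v (Hi *\<^sub>v y))"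
        unfolding g_def using cS G cX Hi y by (intro assoc_mult_mat_vec[symmetric, of _ K K _ K]) auto
      then show ?thesis using G cX Hi y by simp
    qed
    finally show ?thesis using Xt[OF w j'(1)] j' cX Hi y by simp
  qed
  ultimately have "gls \<alpha> (\<lambda>r. y $ r) \<theta> (\<lambda>s. w $ s)" unfolding gls_def by blast
  then show ?thesis unfolding res w_def Hi_def[symmetric] .
qed

end

section \<open>Generalised least squares and the score inequality\<close>

context design
begin

lemma HM_cong: "(\<And>l. l \<in> \<gamma> \<Longrightarrow> \<theta> l = \<theta>' l) \<Longrightarrow> HM \<theta> = HM \<theta>'"
  by (intro eq_matI) (auto simp: HM_def intro!: sum.cong)

lemma Hop_cong_\<theta>: "(\<And>l. l \<in> \<gamma> \<Longrightarrow> \<theta> l = \<theta>' l) \<Longrightarrow> Hop \<theta> = Hop \<theta>'"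
  by (auto simp: Hop_def fun_eq_iff intro!: sum.cong)

text \<open>Testing against a vector orthogonal to X(\<alpha>) eliminates the unspecified
  coefficients in \<open>gls\<close>.\<close>

lemma gls_ip:
  assumes "finite \<alpha>" "gls \<alpha> y \<theta> w" "\<And>j. j \<in> \<alpha> \<Longrightarrow> ip N (X j) u = 0"
  shows "ip N u (Hop \<theta> w) = ip N u y"
proof -
  obtain \<beta> where \<beta>: "\<And>r. r < N \<Longrightarrow> Hop \<theta> w r = y r - (\<Sum>j\<in>\<alpha>. \<beta> j * X j r)"
    using assms(2) by (auto simp: gls_def)
  have "ip N u (Hop \<theta> w) = ip N u (\<lambda>r. y r - (\<Sum>j\<in>\<alpha>. \<beta> j * X j r))"
    by (rule ip_cong) (auto simp: \<beta>)
  also have "\<dots> = ip N u y" using assms(3) by (simp add: ip_right ip_commute[of N u "X _"])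
  finally show ?thesis .
qed

lemma gls_perp: "gls \<alpha> y \<theta> w \<Longrightarrow> j \<in> \<alpha> \<Longrightarrow> ip N (X j) w = 0"
  by (simp add: gls_def)

lemma Hop_diff: "Hop \<theta> (\<lambda>r. v r - w r) r = Hop \<theta> v r - Hop \<theta> w r"
  unfolding Hop_def by (simp add: ip_right algebra_simps sum_subtractf)

lemma Hop_scale: "Hop \<theta> (\<lambda>r. c * w r) r = c * Hop \<theta> w r"
  unfolding Hop_def by (simp add: ip_right algebra_simps sum_distrib_left)

text \<open>The generalised residual sum of squares as a maximum of functions affine in \<open>\<theta>\<close>.\<close>

lemma gls_maximal:
  assumes fin: "finite \<alpha>" and w: "gls \<alpha> y \<theta> w" and \<theta>: "\<And>l. l \<in> \<gamma> \<Longrightarrow> 0 \<le> \<theta> l"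
    and u: "\<And>j. j \<in> \<alpha> \<Longrightarrow> ip N (X j) u = 0"
  shows "2 * ip N u y - ip N u (Hop \<theta> u) \<le> ip N y w"
proof -
  define e where "e r = w r - u r" for r
  have "0 \<le> ip N e (Hop \<theta> e)"
    using ip_self_le_Hop[of \<theta> e] \<theta> ip_nonneg[of N e] by fastforce
  also have "ip N e (Hop \<theta> e) = ip N e (\<lambda>r. Hop \<theta> w r - Hop \<theta> u r)"
    unfolding e_def[abs_def] by (rule ip_cong) (auto simp: Hop_diff)
  also have "\<dots> = ip N w (Hop \<theta> w) - ip N u (Hop \<theta> w) - (ip N w (Hop \<theta> u) - ip N u (Hop \<theta> u))"
  proof -
    have "ip N e g = ip N w g - ip N u g" for g
      by (simp add: ip_commute[of N _ g] e_def[abs_def] ip_diff_right)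
    then show ?thesis by (simp add: ip_diff_right)
  qed
  also have "\<dots> = ip N w y - 2 * ip N u y + ip N u (Hop \<theta> u)"
    using gls_ip[OF fin w gls_perp[OF w]] gls_ip[OF fin w u] ip_Hop_symmetric[of w \<theta> u] by simp
  finally show ?thesis by (simp add: ip_commute[of N w y])
qed

lemma gls_quad: "finite \<alpha> \<Longrightarrow> gls \<alpha> y \<theta> w \<Longrightarrow> ip N y w = ip N w (Hop \<theta> w)"
  using gls_ip[of \<alpha> y \<theta> w w] gls_perp by (simp add: ip_commute)

text \<open>An upper bound uniform in \<theta>, from which the variance estimate is bounded. The
  fixed part drops out, H \<ge> 1 gives |w|^2 \<le> w'e, and 0 \<le> |e - w|^2 finishes.\<close>

lemma gls_le_residual:
  assumes fin: "finite \<alpha>" and w: "gls \<alpha> y \<theta> w" and \<theta>: "\<And>l. l \<in> \<gamma> \<Longrightarrow> 0 \<le> \<theta> l"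
    and y: "\<And>r. r < N \<Longrightarrow> y r = (\<Sum>j\<in>\<alpha>. bx j * X j r) + e r"
  shows "ip N y w \<le> ip N e e"
proof -
  have "ip N w y = ip N w (\<lambda>r. (\<Sum>j\<in>\<alpha>. bx j * X j r) + e r)" by (rule ip_cong) (auto simp: y)
  also have "\<dots> = ip N w e" using gls_perp[OF w] by (simp add: ip_right ip_commute[of N w "X _"])
  finally have 1: "ip N y w = ip N w e" by (simp add: ip_commute)
  have "ip N w w \<le> ip N y w" using ip_self_le_Hop[of \<theta> w] \<theta> gls_quad[OF fin w] by simp
  moreover have "0 \<le> ip N (\<lambda>r. e r - w r) (\<lambda>r. e r - w r)" by (rule ip_nonneg)
  moreover have "ip N (\<lambda>r. e r - w r) (\<lambda>r. e r - w r) = ip N e e - 2 * ip N w e + ip N w w"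
    by (simp add: ip_right ip_commute[of N "\<lambda>r. e r - w r"] ip_commute[of N e w])
  ultimately show ?thesis using 1 by linarith
qed

section \<open>Leverages and the determinant of the covariance matrix\<close>

lemma leverage_bounds:
  assumes \<theta>: "\<And>l. l \<in> \<gamma> \<Longrightarrow> 0 \<le> \<theta> l" and ik: "i < m" "k \<in> \<gamma>"
    and a: "\<And>r. r < N \<Longrightarrow> Hop \<theta> a r = Z i k r"
  shows "0 \<le> ip N (Z i k) a" "ip N (Z i k) a * \<theta> k \<le> 1" "ip N (Z i k) a \<le> zz i k"
proof -
  let ?K = "ip N (Z i k) a"
  have "?K = ip N a (Hop \<theta> a)" by (subst ip_commute, rule ip_cong) (auto simp: a)
  also have "\<dots> = ip N a a + (\<Sum>i<m. \<Sum>l\<in>\<gamma>. \<theta> l * ip N (Z i l) a * ip N (Z i l) a)" by (rule ip_Hop)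
  \<comment> \<open>The leverage equals |a|^2 plus nonnegative terms, one of which is \<theta> k
    times its own square; the three bounds start from this identity.\<close>
  finally have K: "?K = ip N a a + (\<Sum>i<m. \<Sum>l\<in>\<gamma>. \<theta> l * ip N (Z i l) a * ip N (Z i l) a)" .
  have nn: "0 \<le> \<theta> l * ip N (Z i l) a * ip N (Z i l) a" if "l \<in> \<gamma>" for i l
    using \<theta>[OF that] by (simp add: mult.assoc)
  have "\<theta> k * ?K * ?K \<le> (\<Sum>l\<in>\<gamma>. \<theta> l * ip N (Z i l) a * ip N (Z i l) a)"
    using nn fin_\<gamma> ik by (intro member_le_sum[of k \<gamma> "\<lambda>l. \<theta> l * ip N (Z i l) a * ip N (Z i l) a"]) auto
  also have "\<dots> \<le> (\<Sum>i<m. \<Sum>l\<in>\<gamma>. \<theta> l * ip N (Z i l) a * ip N (Z i l) a)"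
    using nn ik by (intro member_le_sum[of i "{..<m}" "\<lambda>i. \<Sum>l\<in>\<gamma>. \<theta> l * ip N (Z i l) a * ip N (Z i l) a"]) (auto intro: sum_nonneg)
  finally have 1: "ip N a a + \<theta> k * ?K * ?K \<le> ?K" using K by linarith
  have aa: "0 \<le> ip N a a" by (rule ip_nonneg)
  have tk: "0 \<le> \<theta> k * ?K * ?K" using \<theta>[OF ik(2)] by (simp add: mult.assoc)
  show K0: "0 \<le> ?K" using 1 aa tk by linarith
  show "?K * \<theta> k \<le> 1"
  proof (cases "?K = 0")
    case False
    then have "?K > 0" using K0 by simp
    moreover have "(?K * \<theta> k) * ?K \<le> 1 * ?K" using 1 aa by (simp add: mult.commute)
    ultimately show ?thesis using mult_le_cancel_right_pos by blast
  qed simp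
  have "0 \<le> ip N (\<lambda>r. Z i k r - a r) (\<lambda>r. Z i k r - a r)" by (rule ip_nonneg)
  also have "\<dots> = zz i k - 2 * ?K + ip N a a"
    by (simp add: ip_right ip_commute[of N "\<lambda>r. Z i k r - a r"] ip_commute[of N a "Z i k"])
  finally show "?K \<le> zz i k" using 1 tk by linarith
qed

lemma coherent_Z_pos:
  assumes "coherent \<alpha> \<delta>" "i < m" "k \<in> \<gamma>"
  shows "0 < zz i k"
proof -
  have "Inr (i, k) \<in> cols \<alpha>" using assms by (auto simp: cols_def)
  then have "0 < ip N (col (Inr (i, k))) (col (Inr (i, k)))" using assms(1) unfolding coherent_def by blast
  then show ?thesis by simp
qed

text \<open>\<open>a\<close> is itself a generalised residual, for the noise-free response
  \<open>Z i k\<close> whose only effect is a single 1. The predictor estimate therefore applies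
  with E = 0 and with B equal to the norm of that column.\<close>

lemma leverage_lower:
  assumes coh: "coherent \<alpha> \<delta>" and \<theta>: "\<And>l. l \<in> \<gamma> \<Longrightarrow> 0 \<le> \<theta> l" and ik: "i < m" "k \<in> \<gamma>"
    and a: "\<And>r. r < N \<Longrightarrow> Hop \<theta> a r = Z i k r"
  shows "1 - 2 * \<delta> \<le> ip N (Z i k) a * (\<theta> k + 1 / zz i k)"
proof -
  define D where "D = zz i k"
  have D: "0 < D" unfolding D_def by (rule coherent_Z_pos[OF coh ik])
  define b where "b i' l = (if i' = i \<and> l = k then 1 else 0 :: real)" for i' l
  have *: "\<exists>r. ip N (Z i k) a * (\<theta> k + 1 / zz i k) = b i k + r \<and>
     \<bar>r\<bar> * sqrt (zz i k) \<le> 2 * \<delta> * (sqrt D + 0) + 0"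
  proof (rule blup_approx[OF coherent_empty[OF coh], where y = "Z i k" and bx = "\<lambda>_. 0" and \<epsilon> = "\<lambda>_. 0" and b = b])
    show "gls {} (Z i k) \<theta> a" using a by (simp add: gls_def)
    show "Z i k r = (\<Sum>j\<in>{}. 0 * X j r) + (\<Sum>i'<m. \<Sum>l\<in>\<gamma>. b i' l * Z i' l r) + 0" for r
    proof -
      have "(\<Sum>i'<m. \<Sum>l\<in>\<gamma>. b i' l * Z i' l r) = (\<Sum>i'<m. if i' = i then Z i k r else 0)"
        using ik fin_\<gamma> by (intro sum.cong refl) (auto simp: b_def if_distrib[of "\<lambda>x. x * _"] cong: if_cong)
      then show ?thesis using ik by simp
    qed
    show "\<bar>b i' l\<bar> * sqrt (zz i' l) \<le> sqrt D * (1 + \<theta> l * zz i' l)"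
      if "i' < m" "l \<in> \<gamma>" for i' l
      using \<theta>[OF that(2)] ip_nonneg[of N "Z i' l"] D
      by (auto simp: b_def D_def[symmetric] intro!: mult_nonneg_nonneg)
  qed (use \<theta> ik D in \<open>auto simp: ip_def\<close>)
  then obtain r where r: "ip N (Z i k) a * (\<theta> k + 1 / D) = 1 + r" "\<bar>r\<bar> * sqrt D \<le> 2 * \<delta> * sqrt D"
    by (auto simp: b_def D_def)
  then have "\<bar>r\<bar> \<le> 2 * \<delta>" using D by simp
  then show ?thesis using r(1) unfolding D_def[symmetric] by linarith
qed

lemma det_HM_zero: "det (HM (\<lambda>_. 0)) = 1"
proof -
  have "HM (\<lambda>_. 0) = 1\<^sub>m N" by (intro eq_matI) (auto simp: HM_def)
  then show ?thesis by simp
qed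

lemma det_HM_mono:
  assumes \<theta>: "\<And>l. l \<in> \<gamma> \<Longrightarrow> 0 \<le> \<theta> l" and k: "k \<in> \<gamma>" and h: "0 \<le> h" and pos: "0 \<le> det (HM \<theta>)"
  shows "det (HM \<theta>) \<le> det (HM (\<theta>(k := \<theta> k + h)))"
proof -
  have "\<exists>a. \<forall>r<N. Hop \<theta> a r = Z i k r" for i by (rule Hop_solvable[OF \<theta>])
  then have "\<exists>a. \<forall>i. \<forall>r<N. Hop \<theta> (a i) r = Z i k r" by (intro choice allI)
  then obtain a where a: "\<And>i r. r < N \<Longrightarrow> Hop \<theta> (a i) r = Z i k r" by blast
  then have a': "\<And>i r. i < m \<Longrightarrow> r < N \<Longrightarrow> Hop \<theta> (a i) r = Z i k r" by blast
  have "1 \<le> (\<Prod>i<m. 1 + h * ip N (Z i k) (a i))"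
  proof (rule prod_ge_1)
    fix i assume "i \<in> {..<m}"
    then have "0 \<le> ip N (Z i k) (a i)" by (intro leverage_bounds(1)[OF \<theta> _ k a]) auto
    then show "1 \<le> 1 + h * ip N (Z i k) (a i)" using h by simp
  qed
  then have "det (HM \<theta>) * 1 \<le> det (HM \<theta>) * (\<Prod>i<m. 1 + h * ip N (Z i k) (a i))"
    using pos by (rule mult_left_mono)
  moreover have "det (HM (\<theta>(k := \<theta> k + h))) = det (HM \<theta>) * (\<Prod>i<m. 1 + h * ip N (Z i k) (a i))"
    by (rule det_HM_update[OF \<theta> k a'])
  ultimately show ?thesis by simp
qed

text \<open>Starting from H(0) = 1, the coordinates of \<theta> are switched on one at a time, each
  multiplying the determinant by factors \<ge> 1. Nonsingularity alone would leave the sign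
  open.\<close>

lemma det_HM_ge_1:
  assumes \<theta>: "\<And>l. l \<in> \<gamma> \<Longrightarrow> 0 \<le> \<theta> l"
  shows "1 \<le> det (HM \<theta>)"
proof -
  have "S \<subseteq> \<gamma> \<Longrightarrow> 1 \<le> det (HM (\<lambda>l. if l \<in> S then \<theta> l else 0))" if "finite S" for S
    using that
  proof (induction S)
    case empty then show ?case by (simp add: det_HM_zero)
  next
    case (insert k S)
    let ?t = "\<lambda>l. if l \<in> S then \<theta> l else 0"
    have 1: "1 \<le> det (HM ?t)" using insert by simp
    have e: "?t(k := ?t k + \<theta> k) = (\<lambda>l. if l \<in> insert k S then \<theta> l else 0)"
      using insert by (auto simp: fun_eq_iff)
    have "det (HM ?t) \<le> det (HM (?t(k := ?t k + \<theta> k)))"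
      by (rule det_HM_mono) (use \<theta> insert 1 in auto)
    then show ?case unfolding e using 1 by linarith
  qed
  from this[OF fin_\<gamma>] have "1 \<le> det (HM (\<lambda>l. if l \<in> \<gamma> then \<theta> l else 0))" by simp
  also have "HM (\<lambda>l. if l \<in> \<gamma> then \<theta> l else 0) = HM \<theta>" by (rule HM_cong) simp
  finally show ?thesis .
qed

text \<open>Growth in every single coordinate, which later confines the minimisation to a bounded
  box. With \<theta> k switched on last, cluster \<open>i\<close> contributes a factor 1 + \<theta>
  k K whose leverage K, taken at \<open>\<theta>(k := 0)\<close>, is at least (1 - 2\<delta>)
  \<open>zz i k\<close>; all other factors are at least 1.\<close>

lemma det_HM_coercive:
  assumes coh: "coherent \<alpha> \<delta>" and \<theta>: "\<And>l. l \<in> \<gamma> \<Longrightarrow> 0 \<le> \<theta> l" and ik: "i < m" "k \<in> \<gamma>"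
  shows "1 + \<theta> k * ((1 - 2 * \<delta>) * zz i k) \<le> det (HM \<theta>)"
proof -
  let ?t = "\<theta>(k := 0)"
  have \<theta>0: "0 \<le> ?t l" if "l \<in> \<gamma>" for l using \<theta> that by simp
  have "\<exists>a. \<forall>r<N. Hop ?t a r = Z i k r" for i by (rule Hop_solvable[OF \<theta>0])
  then have "\<exists>a. \<forall>i. \<forall>r<N. Hop ?t (a i) r = Z i k r" by (intro choice allI)
  then obtain a where a: "\<And>i r. r < N \<Longrightarrow> Hop ?t (a i) r = Z i k r" by blast
  then have a': "\<And>i r. i < m \<Longrightarrow> r < N \<Longrightarrow> Hop ?t (a i) r = Z i k r" by blast
  have D: "0 < zz i k" by (rule coherent_Z_pos[OF coh ik])
  have "1 - 2 * \<delta> \<le> ip N (Z i k) (a i) * (?t k + 1 / zz i k)"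
    by (rule leverage_lower[OF coh \<theta>0 ik a])
  then have 1: "(1 - 2 * \<delta>) * zz i k \<le> ip N (Z i k) (a i)"
    using D by (simp add: field_simps)
  have ge: "1 \<le> 1 + \<theta> k * ip N (Z i' k) (a i')" if "i' < m" for i'
  proof -
    have "0 \<le> ip N (Z i' k) (a i')" by (rule leverage_bounds(1)[OF \<theta>0 that ik(2) a])
    then show ?thesis using \<theta>[OF ik(2)] by simp
  qed
  have d1: "1 \<le> det (HM ?t)" by (rule det_HM_ge_1[OF \<theta>0])
  have "1 + \<theta> k * ((1 - 2 * \<delta>) * zz i k) \<le> 1 + \<theta> k * ip N (Z i k) (a i)"
    using 1 \<theta>[OF ik(2)] by (simp add: mult_left_mono)
  also have "\<dots> = (1 + \<theta> k * ip N (Z i k) (a i)) * 1" by simp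
  also have "\<dots> \<le> (1 + \<theta> k * ip N (Z i k) (a i)) * (\<Prod>i\<in>{..<m}-{i}. 1 + \<theta> k * ip N (Z i k) (a i))"
  proof (rule mult_left_mono)
    show "1 \<le> (\<Prod>i\<in>{..<m}-{i}. 1 + \<theta> k * ip N (Z i k) (a i))"
      using ge by (intro prod_ge_1) auto
  qed (use ge[OF ik(1)] in linarith)
  also have "\<dots> = (\<Prod>i<m. 1 + \<theta> k * ip N (Z i k) (a i))"
    using ik by (intro prod.remove[symmetric]) auto
  also have "\<dots> \<le> det (HM ?t) * (\<Prod>i<m. 1 + \<theta> k * ip N (Z i k) (a i))"
  proof -
    have "1 * (\<Prod>i<m. 1 + \<theta> k * ip N (Z i k) (a i)) \<le> det (HM ?t) * (\<Prod>i<m. 1 + \<theta> k * ip N (Z i k) (a i))"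
      using d1 ge by (intro mult_right_mono prod_nonneg ballI order_trans[OF zero_le_one]) auto
    then show ?thesis by simp
  qed
  also have "\<dots> = det (HM (?t(k := ?t k + \<theta> k)))"
    by (rule det_HM_update[OF \<theta>0 ik(2) a', symmetric])
  also have "?t(k := ?t k + \<theta> k) = \<theta>" by (simp add: fun_eq_iff)
  finally show ?thesis .
qed

text \<open>Concavity of the logarithm, ln (1 + x) \<le> x, covers both signs of h. The factors stay
  positive because a leverage K satisfies K \<theta> k \<le> 1, whence 1 + h K \<ge> K (\<theta> k +
  h).\<close>

lemma ln_det_HM_update_le:
  assumes \<theta>: "\<And>l. l \<in> \<gamma> \<Longrightarrow> 0 \<le> \<theta> l" and k: "k \<in> \<gamma>" and h: "0 < \<theta> k + h"
    and a: "\<And>i r. i < m \<Longrightarrow> r < N \<Longrightarrow> Hop \<theta> (a i) r = Z i k r"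
  shows "ln (det (HM (\<theta>(k := \<theta> k + h)))) - ln (det (HM \<theta>)) \<le> h * (\<Sum>i<m. ip N (Z i k) (a i))"
proof -
  have pos: "0 < 1 + h * ip N (Z i k) (a i)" if i: "i < m" for i
  proof (cases "ip N (Z i k) (a i) = 0")
    case False
    have "0 \<le> ip N (Z i k) (a i)" by (rule leverage_bounds(1)[OF \<theta> i k a[OF i]])
    with False have K: "0 < ip N (Z i k) (a i)" by simp
    then have "0 < ip N (Z i k) (a i) * (\<theta> k + h)" using h by simp
    moreover have "ip N (Z i k) (a i) * \<theta> k \<le> 1" by (rule leverage_bounds(2)[OF \<theta> i k a[OF i]])
    ultimately show ?thesis by (simp add: algebra_simps)
  qed simp
  have upd: "det (HM (\<theta>(k := \<theta> k + h))) = det (HM \<theta>) * (\<Prod>i<m. 1 + h * ip N (Z i k) (a i))"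
    by (rule det_HM_update[OF \<theta> k a])
  have d1: "1 \<le> det (HM \<theta>)" by (rule det_HM_ge_1[OF \<theta>])
  have "ln (det (HM (\<theta>(k := \<theta> k + h)))) = ln (det (HM \<theta>)) + ln (\<Prod>i<m. 1 + h * ip N (Z i k) (a i))"
    unfolding upd
    using d1 pos by (intro ln_mult_pos) (auto intro!: prod_pos)
  also have "ln (\<Prod>i<m. 1 + h * ip N (Z i k) (a i)) = (\<Sum>i<m. ln (1 + h * ip N (Z i k) (a i)))"
    by (rule ln_prod) (simp, metis lessThan_iff less_irrefl pos)
  also have "\<dots> \<le> (\<Sum>i<m. h * ip N (Z i k) (a i))"
    using pos by (intro sum_mono ln_add_one_self_le_self2) fastforce
  finally show ?thesis by (simp add: sum_distrib_left del: fun_upd_apply)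
qed

text \<open>-2 log L up to the constant N log(2 pi). The residual map \<open>W\<close> is left
  abstract; it is accessible through \<open>gls\<close> at nonnegative \<theta>.\<close>

definition pobj :: "((nat \<Rightarrow> real) \<Rightarrow> nat \<Rightarrow> real) \<Rightarrow> (nat \<Rightarrow> real) \<Rightarrow> (nat \<Rightarrow> real) \<Rightarrow> real \<Rightarrow> real" where
  "pobj W y \<theta> v = real N * ln v + ln (det (HM \<theta>)) + ip N y (W \<theta>) / v"

definition pmin :: "((nat \<Rightarrow> real) \<Rightarrow> nat \<Rightarrow> real) \<Rightarrow> (nat \<Rightarrow> real) \<Rightarrow> (nat \<Rightarrow> real) \<Rightarrow> real \<Rightarrow> bool" where
  "pmin W y \<theta> v \<longleftrightarrow> (\<forall>l\<in>\<gamma>. 0 \<le> \<theta> l) \<and> 0 < v \<and>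
     (\<forall>\<theta>' v'. (\<forall>l\<in>\<gamma>. 0 \<le> \<theta>' l) \<longrightarrow> 0 < v' \<longrightarrow> pobj W y \<theta> v \<le> pobj W y \<theta>' v')"

text \<open>The first-order condition in finite-difference form: for small \<open>h\<close> of either sign it yields the two
  inequalities of the score equation, and \<open>W\<close> need not be differentiated.\<close>

lemma score_inequality:
  assumes fin: "finite \<alpha>"
    and W: "\<And>\<theta>. (\<And>l. l \<in> \<gamma> \<Longrightarrow> 0 \<le> \<theta> l) \<Longrightarrow> gls \<alpha> y \<theta> (W \<theta>)"
    and min: "pmin W y \<theta> v" and k: "k \<in> \<gamma>" and h: "0 < \<theta> k + h"
    and a: "\<And>i r. i < m \<Longrightarrow> r < N \<Longrightarrow> Hop \<theta> (a i) r = Z i k r"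
  shows "0 \<le> h * ((\<Sum>i<m. ip N (Z i k) (a i)) - (\<Sum>i<m. (ip N (Z i k) (W (\<theta>(k := \<theta> k + h))))^2) / v)"
proof -
  let ?t = "\<theta>(k := \<theta> k + h)"
  let ?w = "W ?t"
  have \<theta>: "0 \<le> \<theta> l" if "l \<in> \<gamma>" for l using min that by (simp add: pmin_def)
  have v: "0 < v" using min by (simp add: pmin_def)
  have t: "0 \<le> ?t l" if "l \<in> \<gamma>" for l using \<theta> h that by auto
  have w: "gls \<alpha> y ?t ?w" using W[OF t] .
  have "pobj W y \<theta> v \<le> pobj W y ?t v" using min t v by (simp add: pmin_def)
  then have 1: "0 \<le> h * (\<Sum>i<m. ip N (Z i k) (a i)) + (ip N y ?w - ip N y (W \<theta>)) / v"
  proof -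
    have "ln (det (HM ?t)) - ln (det (HM \<theta>)) \<le> h * (\<Sum>i<m. ip N (Z i k) (a i))"
      by (rule ln_det_HM_update_le[OF \<theta> k h a])
    with \<open>pobj W y \<theta> v \<le> pobj W y ?t v\<close> show ?thesis by (simp add: pobj_def diff_divide_distrib)
  qed
  \<comment> \<open>The residual at the shifted parameter serves as trial vector for the maximum at
    \<theta>. The quadratic forms at the two parameters differ exactly by h times the squared inner
    products with the columns of effect k.\<close>
  have "2 * ip N ?w y - ip N ?w (Hop \<theta> ?w) \<le> ip N y (W \<theta>)"
    by (rule gls_maximal[OF fin W[OF \<theta>] \<theta> gls_perp[OF w]])
  moreover have "ip N ?w (Hop ?t ?w) = ip N ?w (Hop \<theta> ?w) + h * (\<Sum>i<m. (ip N (Z i k) ?w)^2)"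
  proof -
    have "(\<Sum>l\<in>\<gamma>. ?t l * ip N (Z i l) ?w * ip N (Z i l) ?w)
       = (\<Sum>l\<in>\<gamma>. \<theta> l * ip N (Z i l) ?w * ip N (Z i l) ?w) + h * (ip N (Z i k) ?w)^2" for i
      using k fin_\<gamma> by (subst (1 2) sum.remove[of _ k]) (auto simp: algebra_simps power2_eq_square intro!: sum.cong)
    then show ?thesis unfolding ip_Hop by (simp add: sum.distrib sum_distrib_left del: fun_upd_apply)
  qed
  moreover have "ip N y ?w = ip N ?w (Hop ?t ?w)" by (rule gls_quad[OF fin w])
  ultimately have "ip N y ?w - ip N y (W \<theta>) \<le> - h * (\<Sum>i<m. (ip N (Z i k) ?w)^2)"
    by (simp add: ip_commute[of N ?w y])
  then have "(ip N y ?w - ip N y (W \<theta>)) / v \<le> - h * (\<Sum>i<m. (ip N (Z i k) ?w)^2) / v"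
    using divide_right_mono[of _ _ v] v by (meson less_imp_le)
  with 1 show ?thesis by (simp add: right_diff_distrib)
qed

text \<open>Comparison with v = Q/N forces equality in ln x \<le> x - 1 at x = Q/(N v), which
  happens only at x = 1.\<close>

lemma pmin_variance:
  assumes N: "0 < N" and min: "pmin W y \<theta> v" and Q: "0 < ip N y (W \<theta>)"
  shows "v = ip N y (W \<theta>) / real N"
proof -
  define q where "q = ip N y (W \<theta>)"
  have v: "0 < v" using min by (simp add: pmin_def)
  have "pobj W y \<theta> v \<le> pobj W y \<theta> (q / N)" using min N Q by (simp add: pmin_def q_def)
  then have "real N * ln v + q / v \<le> real N * ln (q / N) + real N"
    using N Q by (simp add: pobj_def q_def)
  then have "q / v \<le> real N * (ln (q / N) - ln v + 1)" by (simp add: algebra_simps)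
  also have "ln (q / N) - ln v = ln (q / N / v)" using N Q v by (simp add: ln_div ln_mult q_def)
  finally have "q / v \<le> real N * (ln (q / N / v) + 1)" .
  then have "q / v / N \<le> ln (q / N / v) + 1" using N by (subst pos_divide_le_eq) (simp_all add: mult.commute)
  then have "q / N / v - 1 \<le> ln (q / N / v)" by (simp add: mult.commute)
  moreover have p: "0 < q / N / v" using N Q v by (simp add: q_def)
  ultimately have "ln (q / N / v) = q / N / v - 1" using ln_le_minus_one[OF p] by linarith
  from ln_eq_minus_one[OF p this] show ?thesis using N v by (simp add: q_def field_simps)
qed

end

section \<open>Localisation of the variance component estimates\<close>

text \<open>Here \<open>s\<close> stands for \<theta> k v and \<open>T\<close> for the mean squared
  effect. The errors are partly multiplicative in \<open>s\<close>, so the crude bound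
  \<open>s \<le> 4 * (R + 1)^2\<close> is derived first and then fed back. The constant 30 is
  generous.\<close>

lemma two_sided_to_close:
  fixes s T R u :: real
  assumes u: "0 < u" "u \<le> 1/8" and R: "0 \<le> R" and T: "0 \<le> T" "T \<le> R^2"
    and lo: "T - 2 * R * u \<le> (1 + 2 * u)^2 * s"
    and up: "(1 - 2 * u) * (1 - u)^2 * s \<le> (1 + u) * (T + 2 * R * u + u^2)"
    and s: "0 \<le> s"
  shows "\<bar>s - T\<bar> \<le> 30 * (R + 1)^2 * u"
proof -
  have uu: "u * u \<le> u / 8" using u mult_left_mono[of u "1/8" u] by simp
  have "1 - 4 * u \<le> (1 - 2 * u) * (1 - u)^2"
  proof -
    have "(1 - 2 * u) * (1 - u)^2 - (1 - 4 * u) = u * u * (5 - 2 * u)"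
      by (simp add: power2_eq_square algebra_simps)
    moreover have "0 \<le> u * u * (5 - 2 * u)" using u by simp
    ultimately show ?thesis by linarith
  qed
  then have a: "(1 - 4 * u) * s \<le> (1 + u) * (T + 2 * R * u + u^2)"
    using up s by (meson mult_right_mono order_trans)
  have Ru: "R * u \<le> R * (1/8)" using u R by (intro mult_left_mono) auto
  have Ru0: "0 \<le> R * u" using u R by simp
  have b: "(1 + u) * (T + 2 * R * u + u^2) \<le> 2 * (R + 1)^2"
  proof -
    have "2 * R * u \<le> 2 * R" using Ru R by linarith
    moreover have "u^2 \<le> 1" using uu u unfolding power2_eq_square by linarith
    ultimately have "T + 2 * R * u + u^2 \<le> R^2 + 2 * R + 1" using T by linarith
    then have "(1 + u) * (T + 2 * R * u + u^2) \<le> 2 * (R^2 + 2 * R + 1)"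
      using u R T by (intro mult_mono) (auto intro!: add_nonneg_nonneg)
    then show ?thesis by (simp add: power2_eq_square algebra_simps)
  qed
  have "1/2 * s \<le> (1 - 4 * u) * s" using u s by (intro mult_right_mono) auto
  with a b have s4: "s \<le> 4 * (R + 1)^2" by linarith
  then have us: "u * s \<le> u * (4 * (R + 1)^2)" using u by (intro mult_left_mono) auto
  have uus: "u * u * s \<le> u / 8 * s" using uu s by (intro mult_right_mono) auto
  have uT: "u * T \<le> u * R^2" using T u by (intro mult_left_mono) auto
  have uRu: "u * (R * u) \<le> (1/8) * (R * u)" using u Ru0 by (intro mult_right_mono) auto
  have uuu: "u * (u * u) \<le> u / 8 * 1" using uu u mult_mono[of u 1 "u * u" "u/8"] by simp
  have lo': "T - s \<le> 4 * (u * s) + 4 * (u * u * s) + 2 * (R * u)"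
    using lo by (simp add: power2_eq_square algebra_simps)
  have up': "s - T \<le> 4 * (u * s) + u * T + 2 * (R * u) + u * u + 2 * (u * (R * u)) + u * (u * u)"
    using a by (simp add: power2_eq_square algebra_simps)
  have e: "30 * (R + 1)^2 * u = 30 * (u * R^2) + 60 * (R * u) + 30 * u"
     "u * (4 * (R + 1)^2) = 4 * (u * R^2) + 8 * (R * u) + 4 * u"
    by (simp_all add: power2_eq_square algebra_simps)
  have "0 \<le> u * R^2" using u by simp
  then show ?thesis using lo' up' us uus uT uRu uuu uu Ru0 u unfolding e abs_le_iff by linarith
qed

context design
begin

lemma coherent_nonneg: "coherent \<alpha> \<delta> \<Longrightarrow> 0 \<le> \<delta>"
  unfolding coherent_def by (meson mult_nonneg_nonneg of_nat_0_le_iff order_trans)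

lemma coherent_fin: "coherent \<alpha> \<delta> \<Longrightarrow> finite \<alpha>"
  by (simp add: coherent_def)

text \<open>\<open>Dm\<close> bounds all squared column norms of random effects from below and sets
  the scale of the noise; \<open>c\<close> makes every such column comparable with those of cluster
  \<open>I\<close>; \<open>R\<close> and \<open>V\<close> bound the effects and the variance
  estimate from above, and \<open>\<eta>0\<close> is the lower bound for effects in cluster
  \<open>I\<close>.\<close>

context
  fixes \<alpha> :: "nat set" and \<delta> \<eta> \<eta>0 \<eta>1 Dm c R v V :: real and y bx \<epsilon> \<theta> :: "nat \<Rightarrow> real"
    and W :: "(nat \<Rightarrow> real) \<Rightarrow> nat \<Rightarrow> real" and b :: "nat \<Rightarrow> nat \<Rightarrow> real" and I :: nat
  assumes coh: "coherent \<alpha> \<delta>"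
    and W: "\<And>\<theta>. (\<And>l. l \<in> \<gamma> \<Longrightarrow> 0 \<le> \<theta> l) \<Longrightarrow> gls \<alpha> y \<theta> (W \<theta>)"
    and min: "pmin W y \<theta> v"
    and y: "\<And>r. r < N \<Longrightarrow> y r = (\<Sum>j\<in>\<alpha>. bx j * X j r) + (\<Sum>i<m. \<Sum>l\<in>\<gamma>. b i l * Z i l r) + \<epsilon> r"
    and E: "\<And>a. a \<in> cols \<alpha> \<Longrightarrow> \<bar>ip N (col a) \<epsilon>\<bar> \<le> \<eta> * sqrt Dm * sqrt (ip N (col a) (col a))"
    and Dm: "0 < Dm" "\<And>i l. i < m \<Longrightarrow> l \<in> \<gamma> \<Longrightarrow> Dm \<le> zz i l"
    and I: "I < m" and c: "1 \<le> c"
      "\<And>i l l'. i < m \<Longrightarrow> l \<in> \<gamma> \<Longrightarrow> l' \<in> \<gamma> \<Longrightarrow> zz i l \<le> c * zz I l'"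
    and R: "0 \<le> R" "\<And>i l. i < m \<Longrightarrow> l \<in> \<gamma> \<Longrightarrow> \<bar>b i l\<bar> \<le> R"
    and b0: "0 < \<eta>0" and V: "v \<le> V"
    and small: "2 * \<delta> * (R * c + \<eta>) + \<eta> \<le> \<eta>0 / 2" and \<eta>: "0 \<le> \<eta>"
    and \<eta>1: "\<eta>1 = \<eta>0^2 / (32 * real m * (1 + c) * V)"
begin

text \<open>Only the largest cluster \<open>I\<close> enters: contributions of big clusters are transmitted to small ones
  through the fixed effects and are not yet under control there.\<close>

lemma mle_lower_bound:
  assumes l: "l \<in> \<gamma>" and bI: "\<eta>0 \<le> \<bar>b I l\<bar>" and Dm\<eta>: "1 / Dm \<le> \<eta>1"
  shows "\<eta>1 \<le> \<theta> l"
proof -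
  define D where "D = zz I l"
  have D: "0 < D" unfolding D_def by (rule coherent_Z_pos[OF coh I l])
  have DmD: "Dm \<le> D" unfolding D_def by (rule Dm(2)[OF I l])
  have \<theta>: "0 \<le> \<theta> l" if "l \<in> \<gamma>" for l using min that by (simp add: pmin_def)
  have v: "0 < v" using min by (simp add: pmin_def)
  have \<delta>: "0 \<le> \<delta>" by (rule coherent_nonneg[OF coh])
  define t where "t = \<theta> l"
  define T where "T = t + 1 / D"
  have t: "0 \<le> t" using \<theta>[OF l] by (simp add: t_def)
  have T: "0 < T" using t D by (simp add: T_def add_nonneg_pos)
  \<comment> \<open>The increment 1/D is positive even if \<theta> l = 0, and it at most doubles T =
    \<theta> l + 1/D.\<close>
  define \<theta>' where "\<theta>' = \<theta>(l := \<theta> l + 1 / D)"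
  have \<theta>': "0 \<le> \<theta>' l" if "l \<in> \<gamma>" for l using \<theta> that D by (auto simp: \<theta>'_def)
  define g where "g i = ip N (Z i l) (W \<theta>')" for i
  \<comment> \<open>Shrinkage is used only as 1 + \<theta> zz \<ge> 1. The bound
    \<open>R * c * sqrt D\<close> is proportional to the norm of the column in cluster
    \<open>I\<close>, so after division by \<open>sqrt D\<close> the error is at most half of
    \<open>\<eta>0\<close>.\<close>
  have "\<exists>r. ip N (Z I l) (W \<theta>') * (\<theta>' l + 1 / zz I l) = b I l + r \<and>
     \<bar>r\<bar> * sqrt (zz I l) \<le> 2 * \<delta> * (R * c * sqrt D + \<eta> * sqrt Dm) + \<eta> * sqrt Dm"
  proof (rule blup_approx[OF coh W[OF \<theta>'] \<theta>' y E _ _ I l])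
    fix i l' assume il: "i < m" "l' \<in> \<gamma>"
    have "sqrt (zz i l') \<le> sqrt (c * D)"
      using c(2)[OF il l] by (simp add: D_def)
    also have "\<dots> \<le> c * sqrt D"
    proof -
      have "sqrt c \<le> c" using c(1) by (intro real_le_lsqrt) (auto simp: power2_eq_square)
      then show ?thesis using D by (simp add: real_sqrt_mult)
    qed
    finally have "\<bar>b i l'\<bar> * sqrt (zz i l') \<le> R * (c * sqrt D)"
      using R(2)[OF il] R(1) by (intro mult_mono) (auto simp: ip_nonneg)
    also have "\<dots> \<le> R * (c * sqrt D) * (1 + \<theta>' l' * zz i l')"
      using \<theta>'[OF il(2)] ip_nonneg[of N "Z i l'"] R(1) c(1) D
      by (simp add: distrib_left)
    finally show "\<bar>b i l'\<bar> * sqrt (zz i l') \<le> R * c * sqrt D * (1 + \<theta>' l' * zz i l')"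
      by (simp add: mult.assoc)
  qed (use R c D in auto)
  then obtain r where r': "g I * (\<theta>' l + 1 / D) = b I l + r"
    and rb: "\<bar>r\<bar> * sqrt D \<le> 2 * \<delta> * (R * c * sqrt D + \<eta> * sqrt Dm) + \<eta> * sqrt Dm"
    unfolding g_def D_def by blast
  have "\<theta>' l + 1 / D = t + 2 / D" by (simp add: \<theta>'_def t_def)
  with r' have r: "g I * (t + 2 / D) = b I l + r" by simp
  have sD: "sqrt Dm \<le> sqrt D" "0 < sqrt D" using DmD D by auto
  have "2 * \<delta> * (R * c * sqrt D + \<eta> * sqrt Dm) + \<eta> * sqrt Dm \<le> 2 * \<delta> * (R * c * sqrt D + \<eta> * sqrt D) + \<eta> * sqrt D"
    using sD \<delta> \<eta> by (intro add_mono mult_left_mono order_refl) auto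
  also have "\<dots> = (2 * \<delta> * (R * c + \<eta>) + \<eta>) * sqrt D" by (simp add: algebra_simps)
  finally have "\<bar>r\<bar> * sqrt D \<le> (2 * \<delta> * (R * c + \<eta>) + \<eta>) * sqrt D" using rb by linarith
  then have "\<bar>r\<bar> \<le> \<eta>0 / 2" using small sD(2) by (simp add: mult_le_cancel_right)
  then have "\<eta>0 / 2 \<le> \<bar>g I * (t + 2 / D)\<bar>" unfolding r using bI by linarith
  also have "\<dots> \<le> \<bar>g I\<bar> * (2 * T)"
    unfolding abs_mult T_def using t D by (intro mult_left_mono) auto
  finally have "\<eta>0 / 4 \<le> \<bar>g I\<bar> * T" by simp
  then have "(\<eta>0 / 4)^2 \<le> (\<bar>g I\<bar> * T)^2" using b0 by (intro power_mono) auto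
  then have gT: "\<eta>0^2 \<le> 16 * T * ((g I)^2 * T)"
    by (simp add: power_mult_distrib power_divide power2_eq_square algebra_simps)
  have "\<exists>a. \<forall>r<N. Hop \<theta> a r = Z i l r" for i by (rule Hop_solvable[OF \<theta>])
  then have "\<exists>a. \<forall>i. \<forall>r<N. Hop \<theta> (a i) r = Z i l r" by (intro choice allI)
  then obtain a where a: "\<And>i r. r < N \<Longrightarrow> Hop \<theta> (a i) r = Z i l r" by blast
  have "0 \<le> (1 / D) * ((\<Sum>i<m. ip N (Z i l) (a i)) - (\<Sum>i<m. (ip N (Z i l) (W (\<theta>(l := \<theta> l + 1 / D))))^2) / v)"
    by (rule score_inequality[OF coherent_fin[OF coh] W min l _ a]) (use t D in \<open>auto simp: t_def add_nonneg_pos\<close>)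
  then have "(\<Sum>i<m. (g i)^2) / v \<le> (\<Sum>i<m. ip N (Z i l) (a i))"
    using D by (simp add: zero_le_mult_iff zero_le_divide_iff g_def \<theta>'_def)
  moreover have "(g I)^2 \<le> (\<Sum>i<m. (g i)^2)" using I by (intro member_le_sum) auto
  ultimately have "(g I)^2 \<le> v * (\<Sum>i<m. ip N (Z i l) (a i))"
    using v by (simp add: pos_divide_le_eq mult.commute)
  then have "(g I)^2 * T \<le> v * (\<Sum>i<m. ip N (Z i l) (a i)) * T" using T by (intro mult_right_mono) auto
  also have "\<dots> = v * (\<Sum>i<m. ip N (Z i l) (a i) * T)" by (simp add: sum_distrib_right)
  \<comment> \<open>The two leverage bounds, K \<theta> \<le> 1 and K \<le> zz, take care of the two
    summands of T; comparing zz with D costs the factor c.\<close>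
  also have "(\<Sum>i<m. ip N (Z i l) (a i) * T) \<le> (\<Sum>i<m. 1 + c)"
  proof (rule sum_mono)
    fix i assume "i \<in> {..<m}"
    then have i: "i < m" by simp
    have "ip N (Z i l) (a i) * \<theta> l \<le> 1" by (rule leverage_bounds(2)[OF \<theta> i l a])
    moreover have "ip N (Z i l) (a i) \<le> zz i l" by (rule leverage_bounds(3)[OF \<theta> i l a])
    then have "ip N (Z i l) (a i) / D \<le> c" using c(2)[OF i l l] D by (simp add: D_def pos_divide_le_eq)
    ultimately show "ip N (Z i l) (a i) * T \<le> 1 + c" by (simp add: T_def t_def distrib_left)
  qed
  finally have "(g I)^2 * T \<le> v * (real m * (1 + c))" using v by simp
  also have "\<dots> \<le> V * (real m * (1 + c))" using V c by (intro mult_right_mono) auto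
  finally have "16 * T * ((g I)^2 * T) \<le> 16 * T * (V * (real m * (1 + c)))" using T by (intro mult_left_mono) auto
  with gT have 1: "\<eta>0^2 \<le> T * (16 * V * (real m * (1 + c)))" by (simp add: algebra_simps)
  \<comment> \<open>Origin of \<open>\<eta>1\<close>: the previous inequality says T \<ge> 2
    \<open>\<eta>1\<close>, where 32 is twice 16, and one of the two is spent on 1/D \<le>
    1/Dm.\<close>
  have "0 < 16 * V * (real m * (1 + c))" using v V I c by (intro mult_pos_pos) auto
  then have "2 * \<eta>1 \<le> T" using 1 unfolding \<eta>1 by (simp add: field_simps)
  moreover have "1 / D \<le> 1 / Dm" using DmD Dm(1) by (simp add: frac_le)
  ultimately show ?thesis using Dm\<eta> by (simp add: T_def t_def)
qed

text \<open>Once the ratios in \<open>\<gamma>0\<close> are bounded below, all true effects are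
  strongly shrunk in every cluster and the predictor estimate is accurate everywhere. Probing the
  score at \<theta> k (1 + u) and at \<theta> k (1 - u) gives the two one-sided bounds.\<close>

lemma mle_close:
  assumes \<gamma>0: "\<gamma>0 \<subseteq> \<gamma>" "\<And>i l. i < m \<Longrightarrow> l \<in> \<gamma> \<Longrightarrow> l \<notin> \<gamma>0 \<Longrightarrow> b i l = 0"
    and bI: "\<And>l. l \<in> \<gamma>0 \<Longrightarrow> \<eta>0 \<le> \<bar>b I l\<bar>"
    and u: "0 < u" "u \<le> 1/8" "\<delta> \<le> u" "1 / Dm \<le> u * \<eta>1" "2 * R / (\<eta>1 * Dm) + 2 * \<eta> \<le> u"
    and k: "k \<in> \<gamma>0"
  shows "\<bar>\<theta> k * v - (\<Sum>i<m. (b i k)^2) / real m\<bar> \<le> 30 * (R + 1)^2 * u"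
proof -
  have v: "0 < v" using min by (simp add: pmin_def)
  have m: "0 < real m" using I by simp
  have \<eta>1p: "0 < \<eta>1" unfolding \<eta>1 using b0 m c v V by (intro divide_pos_pos mult_pos_pos) auto
  have \<delta>: "0 \<le> \<delta>" by (rule coherent_nonneg[OF coh])
  have Dm\<eta>: "1 / Dm \<le> \<eta>1"
    using u(4) mult_right_mono[of u 1 \<eta>1] u(2) \<eta>1p by linarith
  have \<theta>: "0 \<le> \<theta> l" if "l \<in> \<gamma>" for l using min that by (simp add: pmin_def)
  have lb: "\<eta>1 \<le> \<theta> l" if "l \<in> \<gamma>0" for l
    by (rule mle_lower_bound[OF _ bI[OF that] Dm\<eta>]) (use that \<gamma>0 in auto)
  have kg: "k \<in> \<gamma>" using k \<gamma>0 by auto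
  define t where "t = \<theta> k"
  have t: "\<eta>1 \<le> t" "0 < t" using lb[OF k] \<eta>1p by (auto simp: t_def)
  define D where "D i = zz i k" for i
  have D: "0 < D i" "Dm \<le> D i" if "i < m" for i
    using coherent_Z_pos[OF coh that kg] Dm(2)[OF that kg] by (auto simp: D_def)
  have D1: "1 / D i \<le> u * t" "0 < 1 / D i" if "i < m" for i
  proof -
    have "1 / D i \<le> 1 / Dm" using D[OF that] Dm(1) by (simp add: frac_le)
    also have "\<dots> \<le> u * \<eta>1" by (rule u)
    also have "\<dots> \<le> u * t" using t u by (intro mult_left_mono) auto
    finally show "1 / D i \<le> u * t" .
  qed (use D that in auto)
  have "\<exists>a. \<forall>r<N. Hop \<theta> a r = Z i k r" for i by (rule Hop_solvable[OF \<theta>])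
  then have "\<exists>a. \<forall>i. \<forall>r<N. Hop \<theta> (a i) r = Z i k r" by (intro choice allI)
  then obtain a where a: "\<And>i r. r < N \<Longrightarrow> Hop \<theta> (a i) r = Z i k r" by blast
  define K where "K i = ip N (Z i k) (a i)" for i
  define G where "G h i = ip N (Z i k) (W (\<theta>(k := \<theta> k + h)))" for h i
  have score: "0 \<le> h * ((\<Sum>i<m. K i) - (\<Sum>i<m. (G h i)^2) / v)" if "0 < t + h" for h
    unfolding K_def G_def
    by (rule score_inequality[OF coherent_fin[OF coh] W min kg _ a]) (use that in \<open>auto simp: t_def\<close>)
  have Kt: "K i * t \<le> 1" if "i < m" for i
    unfolding K_def t_def by (rule leverage_bounds(2)[OF \<theta> that kg a])
  have Klow: "1 - 2 * \<delta> \<le> K i * (t + 1 / D i)" if "i < m" for i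
    unfolding K_def t_def D_def by (rule leverage_lower[OF coh \<theta> that kg a])
  have K0: "0 \<le> K i" if "i < m" for i
    unfolding K_def by (rule leverage_bounds(1)[OF \<theta> that kg a])
  \<comment> \<open>The estimate is applied at the shifted parameter, where coordinate k may have
    decreased; the threshold \<open>\<eta>1 / 2\<close> leaves room for this.\<close>
  have approx: "\<exists>r. G h i * (t + h + 1 / D i) = b i k + r \<and> \<bar>r\<bar> \<le> u"
    if i: "i < m" and h: "\<eta>1 / 2 \<le> t + h" for i h
  proof -
    define \<theta>' where "\<theta>' = \<theta>(k := \<theta> k + h)"
    have \<theta>': "0 \<le> \<theta>' l" if "l \<in> \<gamma>" for l using \<theta> that h \<eta>1p by (auto simp: \<theta>'_def t_def)
    have lb': "\<eta>1 / 2 \<le> \<theta>' l" if "l \<in> \<gamma>0" for l using lb[OF that] h \<eta>1p by (auto simp: \<theta>'_def t_def)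
    \<comment> \<open>A shrunken effect obeys |b| sqrt d / (1 + \<theta> d) \<le> R / (\<theta> sqrt
      d), here with \<theta> \<ge> \<open>\<eta>1 / 2\<close> and d \<ge> Dm.\<close>
    define B where "B = 2 * R / (\<eta>1 * sqrt Dm)"
    have B0: "0 \<le> B" using R \<eta>1p Dm by (simp add: B_def)
    have "\<exists>r. ip N (Z i k) (W \<theta>') * (\<theta>' k + 1 / zz i k) = b i k + r \<and>
       \<bar>r\<bar> * sqrt (zz i k) \<le> 2 * \<delta> * (B + \<eta> * sqrt Dm) + \<eta> * sqrt Dm"
    proof (rule blup_approx[OF coh W[OF \<theta>'] \<theta>' y E _ B0 i kg])
      fix i l assume il: "i < m" "l \<in> \<gamma>"
      define d where "d = zz i l"
      have d: "0 < d" "Dm \<le> d" using coherent_Z_pos[OF coh il] Dm(2)[OF il] by (auto simp: d_def)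
      show "\<bar>b i l\<bar> * sqrt (zz i l) \<le> B * (1 + \<theta>' l * zz i l)"
      proof (cases "l \<in> \<gamma>0")
        case False
        then show ?thesis using \<gamma>0(2)[OF il] B0 \<theta>'[OF il(2)] ip_nonneg[of N "Z i l"] by simp
      next
        case True
        have "\<bar>b i l\<bar> * sqrt d \<le> R * sqrt d" using R(2)[OF il] d by (intro mult_right_mono) auto
        also have "\<dots> \<le> R * (d / sqrt Dm)"
        proof (rule mult_left_mono)
          have "sqrt Dm * sqrt d \<le> sqrt d * sqrt d" using d by (intro mult_right_mono) auto
          then show "sqrt d \<le> d / sqrt Dm" using d Dm(1) by (simp add: pos_le_divide_eq mult.commute)
        qed (rule R)
        also have "\<dots> = B * (\<eta>1 / 2 * d)" using \<eta>1p Dm(1) by (simp add: B_def)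
        also have "\<dots> \<le> B * (1 + \<theta>' l * d)"
        proof (rule mult_left_mono[OF _ B0])
          have "\<eta>1 / 2 * d \<le> \<theta>' l * d" using lb'[OF True] d by (intro mult_right_mono) auto
          then show "\<eta>1 / 2 * d \<le> 1 + \<theta>' l * d" by linarith
        qed
        finally show ?thesis by (simp add: d_def)
      qed
    qed
    then obtain r where r: "G h i * (t + h + 1 / D i) = b i k + r"
      and rb: "\<bar>r\<bar> * sqrt (D i) \<le> 2 * \<delta> * (B + \<eta> * sqrt Dm) + \<eta> * sqrt Dm"
      by (auto simp: G_def \<theta>'_def t_def D_def[symmetric])
    have "0 \<le> B + \<eta> * sqrt Dm" using B0 \<eta> Dm by simp
    then have "2 * \<delta> * (B + \<eta> * sqrt Dm) \<le> 1 * (B + \<eta> * sqrt Dm)" using u by (intro mult_right_mono) auto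
    moreover have "\<bar>r\<bar> * sqrt Dm \<le> \<bar>r\<bar> * sqrt (D i)" using D(2)[OF i] by (intro mult_left_mono) auto
    ultimately have "\<bar>r\<bar> * sqrt Dm \<le> B + 2 * \<eta> * sqrt Dm" using rb by argo
    also have "\<dots> = (2 * R / (\<eta>1 * Dm) + 2 * \<eta>) * sqrt Dm"
      using Dm(1) \<eta>1p by (simp add: B_def distrib_right) (simp add: field_simps)
    also have "\<dots> \<le> u * sqrt Dm" using u(5) Dm(1) by (intro mult_right_mono) auto
    finally have "\<bar>r\<bar> \<le> u" using Dm(1) by simp
    with r show ?thesis by blast
  qed
  have br: "(b i k)^2 - 2 * R * u \<le> (b i k + r)^2" "(b i k + r)^2 \<le> (b i k)^2 + 2 * R * u + u^2"
    if "i < m" "\<bar>r\<bar> \<le> u" for i r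
  proof -
    have "\<bar>b i k * r\<bar> \<le> R * u" unfolding abs_mult using R that kg u by (intro mult_mono) auto
    moreover have "r^2 \<le> u^2" using that by (simp add: abs_le_square_iff[symmetric])
    moreover have "(b i k + r)^2 = (b i k)^2 + 2 * (b i k * r) + r^2" by (simp add: power2_sum)
    moreover have "0 \<le> r^2" by simp
    ultimately show "(b i k)^2 - 2 * R * u \<le> (b i k + r)^2" "(b i k + r)^2 \<le> (b i k)^2 + 2 * R * u + u^2"
      by linarith+
  qed
  define S where "S = (\<Sum>i<m. (b i k)^2)"
  have lo: "S - real m * (2 * R * u) \<le> (1 + 2 * u)^2 * (real m * (t * v))"
  proof -
    \<comment> \<open>Upward step: the score bounds the sum of \<open>(G h i)^2\<close> by v times
      the sum of leverages, and K t \<le> 1 turns this into a lower bound for t v.\<close>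
    define h where "h = u * t"
    have h: "0 < h" using u t by (simp add: h_def)
    have "(b i k)^2 - 2 * R * u \<le> (G h i)^2 * (t * (1 + 2 * u))^2" if i: "i < m" for i
    proof -
      obtain r where r: "G h i * (t + h + 1 / D i) = b i k + r" "\<bar>r\<bar> \<le> u"
        using approx[OF i, of h] t h \<eta>1p by auto
      have "(b i k)^2 - 2 * R * u \<le> (G h i * (t + h + 1 / D i))^2" using br(1)[OF i r(2)] r(1) by simp
      also have "\<dots> = (G h i)^2 * (t + h + 1 / D i)^2" by (simp add: power_mult_distrib)
      also have "\<dots> \<le> (G h i)^2 * (t * (1 + 2 * u))^2"
        using D1[OF i] t h by (intro mult_left_mono power_mono) (auto simp: h_def algebra_simps)
      finally show ?thesis .
    qed
    then have "(\<Sum>i<m. (b i k)^2 - 2 * R * u) \<le> (\<Sum>i<m. (G h i)^2 * (t * (1 + 2 * u))^2)"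
      by (intro sum_mono) auto
    then have 1: "S - real m * (2 * R * u) \<le> (\<Sum>i<m. (G h i)^2) * (t * (1 + 2 * u))^2"
      by (simp add: S_def sum_subtractf sum_distrib_right)
    have "(\<Sum>i<m. (G h i)^2) / v \<le> (\<Sum>i<m. K i)" using score[of h] h t by (simp add: zero_le_mult_iff)
    then have "(\<Sum>i<m. (G h i)^2) \<le> v * (\<Sum>i<m. K i)" using v by (simp add: pos_divide_le_eq mult.commute)
    then have "(\<Sum>i<m. (G h i)^2) * t \<le> v * (\<Sum>i<m. K i) * t" using t by (intro mult_right_mono) auto
    also have "\<dots> = v * (\<Sum>i<m. K i * t)" by (simp add: sum_distrib_right)
    also have "\<dots> \<le> v * (\<Sum>i<m. 1)" using v Kt by (intro mult_left_mono sum_mono) auto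
    finally have "(\<Sum>i<m. (G h i)^2) * t \<le> v * real m" by simp
    then have "(\<Sum>i<m. (G h i)^2) * t * (t * (1 + 2 * u)^2) \<le> v * real m * (t * (1 + 2 * u)^2)"
      using t by (intro mult_right_mono) auto
    then show ?thesis using 1 by (simp add: power2_eq_square algebra_simps)
  qed
  have up: "(1 - 2 * u) * (1 - u)^2 * (real m * (t * v)) \<le> (1 + u) * (S + real m * (2 * R * u + u^2))"
  proof -
    \<comment> \<open>Downward step, admissible because t > 0: the negative factor h reverses the
      score inequality, and the lower leverage bound replaces K t \<le> 1.\<close>
    define h where "h = - u * t"
    have th: "\<eta>1 / 2 \<le> t + h" "t + h = t * (1 - u)" "0 < t + h"
    proof -
      show e: "t + h = t * (1 - u)" by (simp add: h_def algebra_simps)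
      have "\<eta>1 * (1/2) \<le> t * (1 - u)" using t u \<eta>1p by (intro mult_mono) auto
      then show "\<eta>1 / 2 \<le> t + h" using e by simp
      then show "0 < t + h" using \<eta>1p by linarith
    qed
    have "(G h i)^2 * (t * (1 - u))^2 \<le> (b i k)^2 + 2 * R * u + u^2" if i: "i < m" for i
    proof -
      obtain r where r: "G h i * (t + h + 1 / D i) = b i k + r" "\<bar>r\<bar> \<le> u"
        using approx[OF i th(1)] by auto
      have "(G h i)^2 * (t * (1 - u))^2 \<le> (G h i)^2 * (t + h + 1 / D i)^2"
        using D1[OF i] th by (intro mult_left_mono power_mono) auto
      also have "\<dots> = (G h i * (t + h + 1 / D i))^2" by (simp add: power_mult_distrib)
      also have "\<dots> \<le> (b i k)^2 + 2 * R * u + u^2" using br(2)[OF i r(2)] r(1) by simp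
      finally show ?thesis .
    qed
    then have "(\<Sum>i<m. (G h i)^2 * (t * (1 - u))^2) \<le> (\<Sum>i<m. (b i k)^2 + (2 * R * u + u^2))"
      by (intro sum_mono) (auto simp: add.assoc)
    then have 1: "(\<Sum>i<m. (G h i)^2) * (t * (1 - u))^2 \<le> S + real m * (2 * R * u + u^2)"
      by (simp add: S_def sum.distrib sum_distrib_right)
    have hneg: "h < 0" using u t by (simp add: h_def)
    have "(\<Sum>i<m. K i) \<le> (\<Sum>i<m. (G h i)^2) / v"
      using score[OF th(3)] hneg by (simp add: zero_le_mult_iff)
    then have 2: "v * (\<Sum>i<m. K i) \<le> (\<Sum>i<m. (G h i)^2)" using v by (simp add: pos_le_divide_eq mult.commute)
    have "1 - 2 * u \<le> K i * (t * (1 + u))" if i: "i < m" for i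
    proof -
      have "1 - 2 * u \<le> K i * (t + 1 / D i)" using Klow[OF i] u by linarith
      also have "\<dots> \<le> K i * (t * (1 + u))" using K0[OF i] D1[OF i] by (intro mult_left_mono) (auto simp: algebra_simps)
      finally show ?thesis .
    qed
    then have "(\<Sum>i<m. 1 - 2 * u) \<le> (\<Sum>i<m. K i * (t * (1 + u)))" by (intro sum_mono) auto
    then have "real m * (1 - 2 * u) \<le> (\<Sum>i<m. K i) * (t * (1 + u))" by (simp add: sum_distrib_right)
    then have "v * (real m * (1 - 2 * u)) \<le> v * ((\<Sum>i<m. K i) * (t * (1 + u)))" using v by (intro mult_left_mono) auto
    also have "\<dots> = v * (\<Sum>i<m. K i) * (t * (1 + u))" by simp
    also have "\<dots> \<le> (\<Sum>i<m. (G h i)^2) * (t * (1 + u))" using 2 t u by (intro mult_right_mono) auto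
    finally have "v * (real m * (1 - 2 * u)) * (t * (1 - u)^2) \<le> (\<Sum>i<m. (G h i)^2) * (t * (1 + u)) * (t * (1 - u)^2)"
      using t by (intro mult_right_mono) auto
    also have "\<dots> = (1 + u) * ((\<Sum>i<m. (G h i)^2) * (t * (1 - u))^2)" by (simp add: power2_eq_square)
    also have "\<dots> \<le> (1 + u) * (S + real m * (2 * R * u + u^2))" using 1 u by (intro mult_left_mono) auto
    finally show ?thesis by (simp add: algebra_simps)
  qed
  have "\<bar>t * v - S / real m\<bar> \<le> 30 * (R + 1)^2 * u"
  proof (rule two_sided_to_close[OF u(1,2) R(1)])
    show "0 \<le> S / real m" by (simp add: S_def sum_nonneg)
    have "S \<le> (\<Sum>i<m. R^2)" unfolding S_def
      using R kg by (intro sum_mono) (auto simp: abs_le_square_iff[symmetric])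
    then show "S / real m \<le> R^2" using m by (simp add: pos_divide_le_eq mult.commute)
    show "S / real m - 2 * R * u \<le> (1 + 2 * u)^2 * (t * v)"
    proof -
      have "S / real m - 2 * R * u = (S - real m * (2 * R * u)) / real m" using m by (simp add: field_simps)
      also have "\<dots> \<le> (1 + 2 * u)^2 * (real m * (t * v)) / real m" using lo m by (intro divide_right_mono) auto
      finally show ?thesis using m by simp
    qed
    show "(1 - 2 * u) * (1 - u)^2 * (t * v) \<le> (1 + u) * (S / real m + 2 * R * u + u^2)"
    proof -
      have "(1 - 2 * u) * (1 - u)^2 * (t * v) = (1 - 2 * u) * (1 - u)^2 * (real m * (t * v)) / real m" using m by simp
      also have "\<dots> \<le> (1 + u) * (S + real m * (2 * R * u + u^2)) / real m" using up m by (intro divide_right_mono) auto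
      also have "\<dots> = (1 + u) * (S / real m + 2 * R * u + u^2)" using m by (simp add: field_simps)
      finally show ?thesis .
    qed
  qed (use t v in auto)
  then show ?thesis by (simp add: t_def S_def)
qed

end

end

section \<open>Existence of the maximum likelihood estimate\<close>

text \<open>Padded with zero rows, the vectors form a square matrix whose last row is zero; any
  kernel vector will do. Such a direction ignores fixed and random effects alike and sees only the
  noise.\<close>

lemma exists_orthogonal:
  fixes f :: "'i \<Rightarrow> nat \<Rightarrow> real"
  assumes fin: "finite J" and card: "card J < N"
  shows "\<exists>w. (\<exists>r<N. w r \<noteq> 0) \<and> (\<forall>a\<in>J. ip N (f a) w = 0)"
proof -
  obtain g where g: "bij_betw g {0..<card J} J" using ex_bij_betw_nat_finite[OF fin] by blast
  define A where "A = mat N N (\<lambda>(i, r). if i < card J then f (g i) r else 0)"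
  have A: "A \<in> carrier_mat N N" by (simp add: A_def)
  have "transpose_mat A *\<^sub>v unit_vec N (N - 1) = 0\<^sub>v N"
    using card by (intro eq_vecI) (auto simp: A_def)
  moreover have "unit_vec N (N - 1) \<noteq> (0\<^sub>v N :: real vec)"
  proof
    assume "unit_vec N (N - 1) = (0\<^sub>v N :: real vec)"
    then have "(unit_vec N (N - 1) :: real vec) $ (N - 1) = 0\<^sub>v N $ (N - 1)" by simp
    then show False using card by simp
  qed
  ultimately have "det (transpose_mat A) = 0"
    using det_0_iff_vec_prod_zero_field[of "transpose_mat A" N] A by (metis transpose_carrier_mat unit_vec_carrier)
  then have "det A = 0" using det_transpose[OF A] by simp
  then obtain v where v: "v \<in> carrier_vec N" "v \<noteq> 0\<^sub>v N" "A *\<^sub>v v = 0\<^sub>v N"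
    using det_0_iff_vec_prod_zero_field[OF A] by blast
  have "\<exists>r<N. v $ r \<noteq> 0"
  proof (rule ccontr)
    assume "\<not> (\<exists>r<N. v $ r \<noteq> 0)"
    then have "v = 0\<^sub>v N" using v(1) by (intro eq_vecI) auto
    with v show False by simp
  qed
  moreover have "ip N (f a) (\<lambda>s. v $ s) = 0" if aJ: "a \<in> J" for a
  proof -
    have "a \<in> g ` {0..<card J}" using g aJ by (simp add: bij_betw_def)
    then obtain i where i: "i < card J" "a = g i" by auto
    have "(A *\<^sub>v v) $ i = ip N (f a) (\<lambda>s. v $ s)"
      using i card v(1) by (simp add: A_def ip_def scalar_prod_def lessThan_atLeast0)
    then show ?thesis using v(3) i card by simp
  qed
  ultimately show ?thesis by blast
qed

text \<open>The residual sum of squares is available as a supremum of functions continuous in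
  \<theta>, which yields lower semicontinuity. If no minimum were attained, the open sets where f
  exceeds f y would cover S as y runs through S, and the least value among finitely many y of a
  subcover gives the contradiction.\<close>

lemma lower_semicontinuous_attains_min:
  fixes f :: "'a :: topological_space \<Rightarrow> real"
  assumes S: "compact S" "S \<noteq> {}"
    and lsc: "\<And>c. \<exists>U. open U \<and> U \<inter> S = {x \<in> S. c < f x}"
  shows "\<exists>x\<in>S. \<forall>y\<in>S. f x \<le> f y"
proof (rule ccontr)
  assume "\<not> ?thesis"
  then have no: "\<And>x. x \<in> S \<Longrightarrow> \<exists>y\<in>S. f y < f x" by force
  obtain U where U: "\<And>c. open (U c)" "\<And>c. U c \<inter> S = {x \<in> S. c < f x}" using lsc by metis
  have "S \<subseteq> (\<Union>y\<in>S. U (f y))"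
  proof
    fix x assume x: "x \<in> S"
    then obtain y where "y \<in> S" "f y < f x" using no by blast
    then have "x \<in> U (f y)" using U(2)[of "f y"] x by blast
    then show "x \<in> (\<Union>y\<in>S. U (f y))" using \<open>y \<in> S\<close> by blast
  qed
  then obtain C where C: "C \<subseteq> S" "finite C" "S \<subseteq> (\<Union>y\<in>C. U (f y))"
    using compactE_image[OF S(1), of S "\<lambda>y. U (f y)"] U(1) by metis
  then have "C \<noteq> {}" using S(2) by auto
  then have "Min (f ` C) \<in> f ` C" using C(2) by (intro Min_in) auto
  then obtain x where x: "x \<in> C" "f x = Min (f ` C)" by auto
  then obtain y where "y \<in> C" "x \<in> U (f y)" using C by blast
  then have "f y < f x" using U(2)[of "f y"] x(1) C(1) by blast
  moreover have "f x \<le> f y" using x(2) \<open>y \<in> C\<close> C(2) by simp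
  ultimately show False by simp
qed

lemma compact_box_fun:
  fixes B :: "'i \<Rightarrow> real"
  shows "compact {\<theta>. \<forall>l. 0 \<le> \<theta> l \<and> \<theta> l \<le> B l}"
proof -
  have "compactin (product_topology (\<lambda>_. euclidean) UNIV) (PiE UNIV (\<lambda>l. {0..B l}))"
    by (subst compactin_PiE) auto
  moreover have "PiE UNIV (\<lambda>l. {0..B l}) = {\<theta>. \<forall>l. 0 \<le> \<theta> l \<and> \<theta> l \<le> B l}"
    by auto
  ultimately show ?thesis by (simp add: euclidean_product_topology)
qed

context design
begin

lemma continuous_on_quad: "continuous_on UNIV (\<lambda>\<theta>. ip N u (Hop \<theta> u))"
  unfolding ip_Hop by (intro continuous_intros continuous_on_product_coordinates)

lemma continuous_on_det_HM: "continuous_on UNIV (\<lambda>\<theta>. det (HM \<theta>))"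
proof -
  have "(\<lambda>\<theta>. det (HM \<theta>)) = (\<lambda>\<theta>. \<Sum>p | p permutes {0..<N}. signof p *
     (\<Prod>i = 0..<N. (if i = p i then 1 else 0) + (\<Sum>j<m. \<Sum>l\<in>\<gamma>. \<theta> l * Z j l i * Z j l (p i))))"
    unfolding fun_eq_iff det_def'[OF HM_carrier]
    by (intro allI sum.cong refl arg_cong[where f = "\<lambda>x. _ * x"] prod.cong) (auto simp: HM_def permutes_in_image)
  moreover have "continuous_on UNIV (\<lambda>\<theta>. \<Sum>p | p permutes {0..<N}. signof p *
     (\<Prod>i = 0..<N. (if i = p i then 1 else 0) + (\<Sum>j<m. \<Sum>l\<in>\<gamma>. \<theta> l * Z j l i * Z j l (p i))) :: real)"
    by (intro continuous_intros continuous_on_product_coordinates)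
  ultimately show ?thesis by (rule ssubst[where P = "continuous_on UNIV"])
qed

text \<open>Coordinates of \<theta> outside \<gamma> may influence the choice of \<open>w\<close>
  but not this value: each of two solutions is a trial vector for the other.\<close>

lemma gls_value_cong:
  assumes fin: "finite \<alpha>" and w: "gls \<alpha> y \<theta> w" "gls \<alpha> y \<theta>' w'"
    and \<theta>: "\<And>l. l \<in> \<gamma> \<Longrightarrow> 0 \<le> \<theta> l" and eq: "\<And>l. l \<in> \<gamma> \<Longrightarrow> \<theta> l = \<theta>' l"
  shows "ip N y w = ip N y w'"
proof -
  have H: "Hop \<theta> = Hop \<theta>'" by (rule Hop_cong_\<theta>[OF eq])
  have le: "ip N y w1 \<le> ip N y w2" if "gls \<alpha> y \<theta> w1" "gls \<alpha> y \<theta> w2" for w1 w2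
  proof -
    have "2 * ip N w1 y - ip N w1 (Hop \<theta> w1) \<le> ip N y w2"
      by (rule gls_maximal[OF fin that(2) \<theta> gls_perp[OF that(1)]])
    then show ?thesis using gls_quad[OF fin that(1)] by (simp add: ip_commute[of N w1 y])
  qed
  have "gls \<alpha> y \<theta> w'" using w(2) by (simp add: gls_def H)
  then show ?thesis using le w(1) by (intro order_antisym) auto
qed

text \<open>H(\<theta>) acts on \<open>w0\<close> as the identity, so a multiple of
  \<open>w0\<close> as trial vector gives a bound independent of \<theta>; the multiple
  \<open>s\<close> below is the optimal one.\<close>

lemma gls_lower_bound:
  assumes fin: "finite \<alpha>" and w: "gls \<alpha> y \<theta> w" and \<theta>: "\<And>l. l \<in> \<gamma> \<Longrightarrow> 0 \<le> \<theta> l"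
    and w0: "\<And>a. a \<in> cols \<alpha> \<Longrightarrow> ip N (col a) w0 = 0"
  shows "(ip N w0 y)^2 / ip N w0 w0 \<le> ip N y w"
proof (cases "ip N w0 w0 = 0")
  \<comment> \<open>Division by zero makes the left-hand side 0 here.\<close>
  case True
  have "ip N w w \<le> ip N y w" using ip_self_le_Hop[of \<theta> w] \<theta> gls_quad[OF fin w] by simp
  then show ?thesis using True ip_nonneg[of N w] by simp
next
  case False
  define s where "s = ip N w0 y / ip N w0 w0"
  have X0: "ip N (X j) (\<lambda>r. s * w0 r) = 0" if "j \<in> \<alpha>" for j
    using w0[of "Inl j"] that by (auto simp: ip_scale_right cols_def)
  have "ip N (\<lambda>r. s * w0 r) (Hop \<theta> (\<lambda>r. s * w0 r)) = s * (s * ip N w0 (Hop \<theta> w0))"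
  proof -
    have "Hop \<theta> (\<lambda>r. s * w0 r) = (\<lambda>r. s * Hop \<theta> w0 r)" by (simp add: fun_eq_iff Hop_scale)
    then show ?thesis by (simp add: ip_scale_right ip_commute[of N "\<lambda>r. s * w0 r"] ip_commute[of N _ w0])
  qed
  also have "ip N w0 (Hop \<theta> w0) = ip N w0 w0"
  proof -
    have "ip N (Z i l) w0 = 0" if "i < m" "l \<in> \<gamma>" for i l
      using w0[of "Inr (i, l)"] that by (auto simp: cols_def)
    then show ?thesis by (simp add: ip_Hop)
  qed
  finally have q: "ip N (\<lambda>r. s * w0 r) (Hop \<theta> (\<lambda>r. s * w0 r)) = s * ip N w0 y"
    using False by (simp add: s_def)
  have "2 * ip N (\<lambda>r. s * w0 r) y - ip N (\<lambda>r. s * w0 r) (Hop \<theta> (\<lambda>r. s * w0 r)) \<le> ip N y w"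
    by (rule gls_maximal[OF fin w \<theta> X0])
  moreover have "ip N (\<lambda>r. s * w0 r) y = s * ip N w0 y"
    by (simp add: ip_commute[of N _ y] ip_scale_right)
  ultimately show ?thesis unfolding q by (simp add: s_def power2_eq_square)
qed

text \<open>Two escapes have to be excluded: a vanishing residual, by means of \<open>w0\<close>,
  and \<theta> tending to infinity, by the growth of the determinant. The variance is profiled out,
  so that compactness is required in \<theta> only.\<close>

lemma mle_exists:
  assumes coh: "coherent \<alpha> \<delta>" "\<delta> \<le> 1/4"
    and W: "\<And>\<theta>. (\<And>l. l \<in> \<gamma> \<Longrightarrow> 0 \<le> \<theta> l) \<Longrightarrow> gls \<alpha> y \<theta> (W \<theta>)"
    and w0: "\<And>a. a \<in> cols \<alpha> \<Longrightarrow> ip N (col a) w0 = 0" "ip N w0 y \<noteq> 0"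
    and m: "0 < m"
  shows "\<exists>\<theta> v. pmin W y \<theta> v"
proof -
  have fin: "finite \<alpha>" by (rule coherent_fin[OF coh(1)])
  have N: "0 < N" using w0(2) by (cases N) (auto simp: ip_def)
  have ww: "0 < ip N w0 w0"
  proof (rule ccontr)
    assume "\<not> 0 < ip N w0 w0"
    then have "w0 r = 0" if "r < N" for r using ip_self_zero[of w0] that by simp
    then show False using w0(2) by (simp add: ip_def)
  qed
  define q0 where "q0 = (ip N w0 y)^2 / ip N w0 w0"
  have q0: "0 < q0" using ww w0(2) by (simp add: q0_def)
  define Q where "Q \<theta> = ip N y (W \<theta>)" for \<theta>
  have Q: "q0 \<le> Q \<theta>" if "\<forall>l\<in>\<gamma>. 0 \<le> \<theta> l" for \<theta>
  proof -
    have nn: "\<And>l. l \<in> \<gamma> \<Longrightarrow> 0 \<le> \<theta> l" using that by blast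
    show ?thesis unfolding q0_def Q_def by (rule gls_lower_bound[OF fin W[OF nn] nn w0(1)])
  qed
  \<comment> \<open>The objective with v replaced by its optimum Q/N, up to terms that depend on N
    alone.\<close>
  define g where "g \<theta> = real N * ln (Q \<theta>) + ln (det (HM \<theta>))" for \<theta>
  \<comment> \<open>As \<delta> \<le> 1/4, half of the squared norm in cluster 0 is an admissible
    growth rate of the determinant.\<close>
  define D where "D l = zz 0 l / 2" for l
  have D: "0 < D l" if "l \<in> \<gamma>" for l using coherent_Z_pos[OF coh(1) m that] by (simp add: D_def)
  define gz where "gz = g (\<lambda>_. 0)"
  \<comment> \<open>Beyond \<open>Bd l\<close> the determinant alone lifts \<open>g\<close> above
    its value at 0. Coordinates outside \<gamma> get the bound 0, so the box is compact in the space
    of all functions.\<close>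
  define Bd where "Bd l = (if l \<in> \<gamma> then exp (gz - real N * ln q0) / D l else 0)" for l
  have Bd0: "0 \<le> Bd l" for l using D[of l] by (auto simp: Bd_def)
  define S where "S = {\<theta>. \<forall>l. 0 \<le> \<theta> l \<and> \<theta> l \<le> Bd l}"
  have S: "compact S" unfolding S_def by (rule compact_box_fun)
  have S0: "(\<lambda>_. 0) \<in> S" using Bd0 by (simp add: S_def)
  have Snn: "0 \<le> \<theta> l" if "\<theta> \<in> S" for \<theta> l using that by (simp add: S_def)
  have "\<exists>x\<in>S. \<forall>y\<in>S. g x \<le> g y"
  proof (rule lower_semicontinuous_attains_min[OF S])
    fix c
    define P where "P = {u. \<forall>j\<in>\<alpha>. ip N (X j) u = 0}"
    define q where "q u \<theta> = 2 * ip N u y - ip N u (Hop \<theta> u)" for u \<theta>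
    define V where "V u = {\<theta>. 0 < q u \<theta>} \<inter> {\<theta>. 0 < det (HM \<theta>)}" for u
    define G where "G u \<theta> = real N * ln (q u \<theta>) + ln (det (HM \<theta>))" for u \<theta>
    have qc: "continuous_on UNIV (q u)" for u
      unfolding q_def by (intro continuous_intros continuous_on_quad)
    have Vo: "open (V u)" for u
      unfolding V_def by (intro open_Int open_Collect_less qc continuous_on_det_HM continuous_on_const)
    have Gc: "continuous_on (V u) (G u)" for u
      unfolding G_def
      by (intro continuous_intros continuous_on_subset[OF qc] continuous_on_subset[OF continuous_on_det_HM])
        (auto simp: V_def)
    \<comment> \<open>The set where \<open>g\<close> exceeds \<open>c\<close> as a union over trial
      vectors \<open>u\<close>: \<open>G u\<close> is continuous where both logarithms have positive
      arguments, lies below \<open>g\<close> there on the box, and equals \<open>g\<close> for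
      \<open>u = W \<theta>\<close>.\<close>
    define U where "U = (\<Union>u\<in>P. V u \<inter> G u -` {c<..})"
    have "open U" unfolding U_def
      by (intro open_UN ballI continuous_open_preimage[OF Gc Vo]) auto
    moreover have "U \<inter> S = {\<theta> \<in> S. c < g \<theta>}"
    proof (intro equalityI subsetI)
      fix \<theta> assume "\<theta> \<in> U \<inter> S"
      then obtain u where u: "u \<in> P" "0 < q u \<theta>" "c < G u \<theta>" and \<theta>S: "\<theta> \<in> S"
        by (auto simp: U_def V_def)
      have nn: "0 \<le> \<theta> l" if "l \<in> \<gamma>" for l by (rule Snn[OF \<theta>S])
      have "q u \<theta> \<le> Q \<theta>" unfolding q_def Q_def
        by (rule gls_maximal[OF fin W[OF nn] nn]) (use u in \<open>auto simp: P_def\<close>)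
      then have "real N * ln (q u \<theta>) \<le> real N * ln (Q \<theta>)" using u by (intro mult_left_mono) auto
      then show "\<theta> \<in> {\<theta> \<in> S. c < g \<theta>}" using u \<theta>S by (simp add: G_def g_def)
    next
      fix \<theta> assume "\<theta> \<in> {\<theta> \<in> S. c < g \<theta>}"
      then have \<theta>S: "\<theta> \<in> S" and c: "c < g \<theta>" by auto
      have nn: "0 \<le> \<theta> l" if "l \<in> \<gamma>" for l by (rule Snn[OF \<theta>S])
      have w: "gls \<alpha> y \<theta> (W \<theta>)" by (rule W[OF nn])
      have "q (W \<theta>) \<theta> = Q \<theta>"
        using gls_quad[OF fin w] by (simp add: q_def Q_def ip_commute[of N _ y])
      moreover have "0 < Q \<theta>" using q0 Q[of \<theta>] nn by fastforce
      moreover have "1 \<le> det (HM \<theta>)" by (rule det_HM_ge_1[OF nn])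
      moreover have "W \<theta> \<in> P" using gls_perp[OF w] by (simp add: P_def)
      ultimately show "\<theta> \<in> U \<inter> S" using c \<theta>S by (force simp: U_def V_def G_def g_def)
    qed
    ultimately show "\<exists>U. open U \<and> U \<inter> S = {\<theta> \<in> S. c < g \<theta>}" by blast
  qed (use S0 in auto)
  then obtain \<theta> where \<theta>S: "\<theta> \<in> S" and \<theta>min: "\<And>\<theta>'. \<theta>' \<in> S \<Longrightarrow> g \<theta> \<le> g \<theta>'" by blast
  have nn: "0 \<le> \<theta> l" if "l \<in> \<gamma>" for l by (rule Snn[OF \<theta>S])
  have gmin: "g \<theta> \<le> g \<theta>'" if \<theta>': "\<And>l. l \<in> \<gamma> \<Longrightarrow> 0 \<le> \<theta>' l" for \<theta>'
  proof (cases "\<forall>l\<in>\<gamma>. \<theta>' l \<le> Bd l")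
    case True
    define \<theta>1 where "\<theta>1 l = (if l \<in> \<gamma> then \<theta>' l else 0)" for l
    have "\<theta>1 \<in> S" using True \<theta>' by (auto simp: S_def \<theta>1_def Bd_def)
    have nn1: "0 \<le> \<theta>1 l" if "l \<in> \<gamma>" for l using \<theta>' that by (simp add: \<theta>1_def)
    have "Q \<theta>1 = Q \<theta>'" unfolding Q_def
      by (rule gls_value_cong[OF fin W[OF nn1] W[OF \<theta>'] nn1]) (simp_all add: \<theta>1_def)
    moreover have "HM \<theta>1 = HM \<theta>'" by (rule HM_cong) (simp add: \<theta>1_def)
    ultimately show ?thesis using \<theta>min[OF \<open>\<theta>1 \<in> S\<close>] by (simp add: g_def)
  next
    case False
    then obtain l where l: "l \<in> \<gamma>" "Bd l < \<theta>' l" by auto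
    have "exp (gz - real N * ln q0) = Bd l * D l" using l D[OF l(1)] by (simp add: Bd_def)
    also have "\<dots> \<le> \<theta>' l * D l" using l D[OF l(1)] by (intro mult_right_mono) auto
    also have "\<dots> \<le> 1 + \<theta>' l * ((1 - 2 * \<delta>) * zz 0 l)"
    proof -
      have "D l \<le> (1 - 2 * \<delta>) * zz 0 l"
        unfolding D_def using mult_right_mono[of "1/2" "1 - 2 * \<delta>" "zz 0 l"] coh(2) by (simp add: ip_nonneg)
      then have "\<theta>' l * D l \<le> \<theta>' l * ((1 - 2 * \<delta>) * zz 0 l)"
        using \<theta>'[OF l(1)] by (intro mult_left_mono)
      then show ?thesis by linarith
    qed
    also have "\<dots> \<le> det (HM \<theta>')" by (rule det_HM_coercive[OF coh(1) \<theta>' m l(1)])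
    finally have "gz - real N * ln q0 \<le> ln (det (HM \<theta>'))"
      by (subst ln_ge_iff) (use det_HM_ge_1[of \<theta>'] \<theta>' in auto)
    moreover have "real N * ln q0 \<le> real N * ln (Q \<theta>')" using Q[of \<theta>'] \<theta>' q0 by (intro mult_left_mono) auto
    ultimately have "gz \<le> g \<theta>'" by (simp add: g_def)
    then show ?thesis using \<theta>min[OF S0] by (simp add: gz_def)
  qed
  define v where "v = Q \<theta> / N"
  have Qp: "0 < Q \<theta>" using Q[of \<theta>] nn q0 by fastforce
  have v: "0 < v" using Qp N by (simp add: v_def)
  have prof: "g \<theta>' - N * ln N + N \<le> pobj W y \<theta>' v'" if \<theta>': "\<And>l. l \<in> \<gamma> \<Longrightarrow> 0 \<le> \<theta>' l" and v': "0 < v'" for \<theta>' v'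
  proof -
    have Qp': "0 < Q \<theta>'" using Q[of \<theta>'] \<theta>' q0 by fastforce
    define x where "x = Q \<theta>' / N / v'"
    have x: "0 < x" using Qp' N v' by (simp add: x_def)
    have "ln x \<le> x - 1" by (rule ln_le_minus_one[OF x])
    then have "real N * ln x \<le> real N * (x - 1)" by (intro mult_left_mono) auto
    moreover have "ln x = ln (Q \<theta>') - ln N - ln v'" using Qp' N v' by (simp add: x_def ln_div ln_mult)
    moreover have "real N * x = Q \<theta>' / v'" using N by (simp add: x_def)
    ultimately show ?thesis by (simp add: pobj_def g_def Q_def[symmetric] algebra_simps)
  qed
  have eq: "pobj W y \<theta> v = g \<theta> - N * ln N + N"
    using Qp N by (simp add: pobj_def g_def Q_def[symmetric] v_def ln_div algebra_simps)
  have "pmin W y \<theta> v"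
    unfolding pmin_def
  proof (intro conjI ballI allI impI)
    fix \<theta>' :: "nat \<Rightarrow> real" and v' assume "\<forall>l\<in>\<gamma>. 0 \<le> \<theta>' l" "0 < (v' :: real)"
    then show "pobj W y \<theta> v \<le> pobj W y \<theta>' v'"
      using prof[of \<theta>' v'] gmin[of \<theta>'] unfolding eq by auto
  qed (use nn v in auto)
  then show ?thesis by blast
qed

end

section \<open>The stacked mixed model\<close>

lemma off_Suc: "off n (Suc i) = off n i + n i"
  by (simp add: off_def)

lemma off_mono: "i \<le> j \<Longrightarrow> off n i \<le> off n j"
  unfolding off_def by (intro sum_mono2) auto

lemma clus_eq:
  assumes "off n i \<le> r" "r < off n (Suc i)"
  shows "clus n r = i"
  unfolding clus_def
proof (rule Least_equality)
  fix j assume "r < off n (Suc j)"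
  then have "off n i < off n (Suc j)" using assms by linarith
  then show "i \<le> j" using off_mono[of "Suc j" i n] by (meson not_less not_less_eq_eq linorder_not_le)
qed (use assms in auto)

lemma clus_less:
  assumes "r < Ntot m n"
  shows "clus n r < m"
proof -
  obtain m' where m: "m = Suc m'" using assms by (cases m) (auto simp: Ntot_def off_def)
  have "clus n r \<le> m'" unfolding clus_def using assms by (intro Least_le) (simp add: Ntot_def m)
  then show ?thesis by (simp add: m)
qed

lemma sum_lessThan_add: "(\<Sum>r<a + b. f r) = (\<Sum>r<a. f r) + (\<Sum>t<b. f (a + t :: nat) :: 'a :: comm_monoid_add)"
  by (induction b) (auto simp: add.assoc)

lemma ip_eq_sum_cip: "ip (Ntot m n) f g = (\<Sum>i<m. cip n i f g)"
  unfolding Ntot_def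
  by (induction m) (auto simp: ip_def cip_def off_Suc sum_lessThan_add off_def)

definition Zcol :: "(nat \<Rightarrow> nat) \<Rightarrow> (nat \<Rightarrow> nat \<Rightarrow> real) \<Rightarrow> nat \<Rightarrow> nat \<Rightarrow> nat \<Rightarrow> real" where
  "Zcol n z i l r = (if clus n r = i then z r l else 0)"

lemma cip_cong_clus:
  assumes "\<And>r. clus n r = i \<Longrightarrow> f r = f' r" "\<And>r. clus n r = i \<Longrightarrow> g r = g' r"
  shows "cip n i f g = cip n i f' g'"
  unfolding cip_def
proof (rule sum.cong[OF refl])
  fix t assume "t \<in> {..<n i}"
  then have "clus n (off n i + t) = i" by (intro clus_eq) (auto simp: off_Suc)
  then show "f (off n i + t) * g (off n i + t) = f' (off n i + t) * g' (off n i + t)" using assms by simp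
qed

lemma cip_Zcol: "cip n i f (Zcol n z i' l) = (if i = i' then cip n i f (\<lambda>r. z r l) else 0)"
proof (cases "i = i'")
  case False
  have "cip n i f (Zcol n z i' l) = cip n i f (\<lambda>r. 0)"
    by (rule cip_cong_clus) (use False in \<open>auto simp: Zcol_def\<close>)
  then show ?thesis using False by (simp add: cip_def)
qed (auto intro!: cip_cong_clus simp: Zcol_def)

lemma ip_Zcol:
  assumes "i < m"
  shows "ip (Ntot m n) f (Zcol n z i l) = cip n i f (\<lambda>r. z r l)"
  using assms by (simp add: ip_eq_sum_cip cip_Zcol)

lemma ip_Zcol_Zcol:
  assumes "i < m" "i' < m"
  shows "ip (Ntot m n) (Zcol n z i l) (Zcol n z i' l') = (if i = i' then cip n i (\<lambda>r. z r l) (\<lambda>r. z r l') else 0)"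
proof -
  have "cip n i' (Zcol n z i l) (\<lambda>r. z r l') = (if i = i' then cip n i (\<lambda>r. z r l) (\<lambda>r. z r l') else 0)"
    using cip_Zcol[of n i' "\<lambda>r. z r l'" z i l] by (auto simp: cip_def mult.commute)
  then show ?thesis using assms by (simp add: ip_Zcol)
qed

lemma design_Zcol: "finite \<gamma> \<Longrightarrow> design (Zcol n z) \<gamma>"
  by unfold_locales (auto simp: Zcol_def)

definition mle_resid :: "nat \<Rightarrow> (nat \<Rightarrow> nat) \<Rightarrow> (nat \<Rightarrow> nat \<Rightarrow> real) \<Rightarrow> (nat \<Rightarrow> nat \<Rightarrow> real)
     \<Rightarrow> nat set \<Rightarrow> nat set \<Rightarrow> real vec \<Rightarrow> (nat \<Rightarrow> real) \<Rightarrow> nat \<Rightarrow> real" where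
  "mle_resid m n x z \<alpha> \<gamma> y \<theta> r =
     (minv (Hmat m n z \<gamma> \<theta>) *\<^sub>v ((1\<^sub>m (Ntot m n) - Mmat m n x z \<alpha> \<gamma> \<theta>) *\<^sub>v y)) $ r"

locale stage =
  fixes m :: nat and n :: "nat \<Rightarrow> nat" and p :: nat and x z :: "nat \<Rightarrow> nat \<Rightarrow> real" and \<alpha> \<gamma> :: "nat set"
  assumes fin: "finite \<gamma>" and \<alpha>p: "\<alpha> \<subseteq> {..<p}" and rankX: "full_col_rank_X (Ntot m n) p x"
begin

sublocale design "Ntot m n" m "\<lambda>j r. x r j" "Zcol n z" \<gamma>
  by (rule design_Zcol[OF fin])

lemma Hmat_eq_HM: "Hmat m n z \<gamma> \<theta> = HM \<theta>"
proof (intro eq_matI)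
  fix r s assume "r < dim_row (HM \<theta>)" "s < dim_col (HM \<theta>)"
  then have rs: "r < Ntot m n" "s < Ntot m n" by auto
  have "(\<Sum>i<m. \<Sum>l\<in>\<gamma>. \<theta> l * Zcol n z i l r * Zcol n z i l s)
     = (\<Sum>i<m. if i = clus n r then (if clus n r = clus n s then (\<Sum>l\<in>\<gamma>. \<theta> l * z r l * z s l) else 0) else 0)"
    by (intro sum.cong refl) (auto simp: Zcol_def)
  also have "\<dots> = (if clus n r = clus n s then (\<Sum>l\<in>\<gamma>. \<theta> l * z r l * z s l) else 0)"
    using clus_less[OF rs(1)] by simp
  finally show "Hmat m n z \<gamma> \<theta> $$ (r, s) = HM \<theta> $$ (r, s)" using rs by (simp add: Hmat_def HM_def)
qed (auto simp: Hmat_def)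

lemma fin_\<alpha>: "finite \<alpha>"
  using \<alpha>p finite_subset by blast

lemma gls_mle_resid:
  assumes y: "y \<in> carrier_vec (Ntot m n)" and \<theta>: "\<And>l. l \<in> \<gamma> \<Longrightarrow> 0 \<le> \<theta> l"
  shows "gls \<alpha> (\<lambda>r. y $ r) \<theta> (mle_resid m n x z \<alpha> \<gamma> y \<theta>)"
proof -
  have rk: "\<forall>j\<in>\<alpha>. c j = 0" if c: "\<And>r. r < Ntot m n \<Longrightarrow> (\<Sum>j\<in>\<alpha>. c j * x r j) = 0" for c
  proof -
    define c' where "c' j = (if j \<in> \<alpha> then c j else 0)" for j
    have "(\<Sum>j<p. x r j * c' j) = (\<Sum>j\<in>\<alpha>. c j * x r j)" for r
      using \<alpha>p by (intro sum.mono_neutral_cong_right) (auto simp: c'_def)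
    then have "\<forall>j<p. c' j = 0" using rankX c unfolding full_col_rank_X_def by auto
    then show ?thesis using \<alpha>p by (force simp: c'_def)
  qed
  show ?thesis
    unfolding mle_resid_def Hmat_eq_HM
    by (rule gls_of_minv[OF \<theta> fin_\<alpha> rk _ _ y]) (simp_all add: Mmat_def Xsub_def Let_def Hmat_eq_HM)
qed

lemma neg2loglik_eq:
  assumes y: "y \<in> carrier_vec (Ntot m n)"
  shows "neg2loglik m n x z \<alpha> \<gamma> y \<theta> v
    = real (Ntot m n) * ln (2 * pi) + pobj (mle_resid m n x z \<alpha> \<gamma> y) (\<lambda>r. y $ r) \<theta> v"
proof -
  define w where "w = minv (Hmat m n z \<gamma> \<theta>) *\<^sub>v ((1\<^sub>m (Ntot m n) - Mmat m n x z \<alpha> \<gamma> \<theta>) *\<^sub>v y)"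
  \<comment> \<open>\<theta> is arbitrary here, so \<open>minv\<close> may take its zero default;
    the dimension is right in both cases.\<close>
  have "dim_row (minv (Hmat m n z \<gamma> \<theta>)) = Ntot m n"
  proof (cases "mat_inverse (Hmat m n z \<gamma> \<theta>)")
    case (Some B)
    have "Hmat m n z \<gamma> \<theta> \<in> carrier_mat (Ntot m n) (Ntot m n)" by (simp add: Hmat_def)
    from mat_inverse(2)[OF this Some] show ?thesis by (auto simp: minv_def Some)
  qed (simp add: minv_def Hmat_def)
  then have "dim_vec w = Ntot m n" by (simp add: w_def)
  then have "y \<bullet> w = ip (Ntot m n) (\<lambda>r. y $ r) (mle_resid m n x z \<alpha> \<gamma> y \<theta>)"
    by (simp add: scalar_prod_def ip_def lessThan_atLeast0 mle_resid_def w_def)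
  then show ?thesis by (simp add: neg2loglik_def Let_def pobj_def Hmat_eq_HM[symmetric] w_def)
qed

lemma is_mle_iff_pmin:
  assumes y: "y \<in> carrier_vec (Ntot m n)"
  shows "is_mle m n x z \<alpha> \<gamma> y \<theta> v \<longleftrightarrow> pmin (mle_resid m n x z \<alpha> \<gamma> y) (\<lambda>r. y $ r) \<theta> v"
  unfolding is_mle_def pmin_def neg2loglik_eq[OF y] by simp

end

section \<open>Coherence of the design under (A0)-(A3)\<close>

lemma sqrt_powr_mult:
  assumes "0 < (t :: real)"
  shows "sqrt (t powr \<xi>) * sqrt (t powr l) = t powr ((\<xi> + l) / 2)"
proof -
  have "t powr \<xi> * t powr l = (t powr ((\<xi> + l) / 2))^2"
    by (simp add: power2_eq_square powr_add[symmetric])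
  then show ?thesis by (simp add: real_sqrt_mult[symmetric])
qed

context stage
begin

text \<open>The extra power n_i^(-\<tau>) in the off-diagonal bounds is at most nm^(-\<tau>), while
  (A0) allows at most Kc nm^\<tau> columns. The two powers cancel and leave a multiple of
  \<epsilon>. The loss of 1/2 in the lower norm bounds comes from \<epsilon> \<le> \<mu>/2.\<close>

lemma stage_coherent:
  fixes \<mu> \<epsilon> \<tau> \<xi> ell Kc cu :: real and d c :: "nat \<Rightarrow> nat \<Rightarrow> real" and nm q :: nat
  assumes \<gamma>q: "\<gamma> \<subseteq> {..<q}"
    and nm: "1 \<le> nm" "\<And>i. i < m \<Longrightarrow> nm \<le> n i" and m: "0 < m"
    and \<tau>: "0 \<le> \<tau>" and \<mu>: "0 < \<mu>" and \<epsilon>: "0 \<le> \<epsilon>" "\<epsilon> \<le> \<mu> / 2"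
    and d: "\<And>i j. i < m \<Longrightarrow> \<mu> \<le> d i j" and c: "\<And>i j. i < m \<Longrightarrow> \<mu> \<le> c i j \<and> c i j \<le> cu"
    and A1: "\<forall>i<m. \<forall>j<p. \<forall>j'<p.
        (j = j' \<longrightarrow> \<bar>cip n i (\<lambda>r. x r j) (\<lambda>r. x r j) - d i j * real (n i) powr \<xi>\<bar>
                     \<le> \<epsilon> * real (n i) powr \<xi>) \<and>
        (j \<noteq> j' \<longrightarrow> \<bar>cip n i (\<lambda>r. x r j) (\<lambda>r. x r j')\<bar>
                     \<le> \<epsilon> * real (n i) powr (\<xi> - \<tau>))"
    and A2: "\<forall>i<m. \<forall>j<q. \<forall>j'<q.
        (j = j' \<longrightarrow> \<bar>cip n i (\<lambda>r. z r j) (\<lambda>r. z r j) - c i j * real (n i) powr ell\<bar>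
                     \<le> \<epsilon> * real (n i) powr ell) \<and>
        (j \<noteq> j' \<longrightarrow> \<bar>cip n i (\<lambda>r. z r j) (\<lambda>r. z r j')\<bar>
                     \<le> \<epsilon> * real (n i) powr (ell - \<tau>))"
    and A3: "\<forall>i<m. \<forall>j<p. \<forall>j'<q. \<bar>cip n i (\<lambda>r. x r j) (\<lambda>r. z r j')\<bar>
           \<le> \<epsilon> * real (n i) powr ((\<xi> + ell) / 2 - \<tau>)"
    and Kc: "real (card (cols \<alpha>)) \<le> Kc * real nm powr \<tau>" and small: "Kc * (2 / \<mu> * \<epsilon>) \<le> 1/2"
  shows "coherent \<alpha> (Kc * (2 / \<mu> * \<epsilon>))"
    and "\<And>i l. i < m \<Longrightarrow> l \<in> \<gamma> \<Longrightarrow> \<mu> / 2 * real (n i) powr ell \<le> zz i l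
       \<and> zz i l \<le> 2 * cu * real (n i) powr ell"
proof -
  let ?N = "Ntot m n"
  define \<rho> where "\<rho> = real nm powr (- \<tau>)"
  have np: "0 < real (n i)" if "i < m" for i using nm(1) nm(2)[OF that] by simp
  have nm0: "0 < real nm" using nm by simp
  have \<rho>: "real (n i) powr (s - \<tau>) \<le> \<rho> * real (n i) powr s" if "i < m" for i s
  proof -
    have "real (n i) powr (s - \<tau>) = real (n i) powr (- \<tau>) * real (n i) powr s"
      by (simp add: powr_add[symmetric])
    also have "\<dots> \<le> \<rho> * real (n i) powr s" unfolding \<rho>_def
      using nm(2)[OF that] nm0 \<tau> by (intro mult_right_mono powr_mono2') auto
    finally show ?thesis .
  qed
  have \<rho>0: "0 < \<rho>" using nm0 by (simp add: \<rho>_def)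
  \<comment> \<open>Fixed-effects columns run through all clusters, so their squared norms are
    compared with the total of n_i^\<xi>; against a random column only one cluster counts, and its
    share is at most \<open>P\<close>.\<close>
  define P where "P = (\<Sum>i<m. real (n i) powr \<xi>)"
  have P: "0 < P" unfolding P_def using m np by (intro sum_pos) auto
  have Pge: "real (n i) powr \<xi> \<le> P" if "i < m" for i
    unfolding P_def using that by (intro member_le_sum) auto
  have xs: "\<mu> / 2 * P \<le> ip ?N (\<lambda>r. x r j) (\<lambda>r. x r j)" if "j \<in> \<alpha>" for j
  proof -
    have "\<mu> / 2 * real (n i) powr \<xi> \<le> cip n i (\<lambda>r. x r j) (\<lambda>r. x r j)" if i: "i < m" for i
    proof -
      have "\<bar>cip n i (\<lambda>r. x r j) (\<lambda>r. x r j) - d i j * real (n i) powr \<xi>\<bar> \<le> \<epsilon> * real (n i) powr \<xi>"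
        using A1 i \<open>j \<in> \<alpha>\<close> \<alpha>p by blast
      then have "(d i j - \<epsilon>) * real (n i) powr \<xi> \<le> cip n i (\<lambda>r. x r j) (\<lambda>r. x r j)"
        by (simp add: abs_le_iff algebra_simps)
      moreover have "\<mu> / 2 * real (n i) powr \<xi> \<le> (d i j - \<epsilon>) * real (n i) powr \<xi>"
        using d[OF i, of j] \<epsilon> by (intro mult_right_mono) auto
      ultimately show ?thesis by linarith
    qed
    then show ?thesis unfolding P_def ip_eq_sum_cip by (auto simp: sum_distrib_left intro!: sum_mono)
  qed
  have zs: "\<mu> / 2 * real (n i) powr ell \<le> zz i l
      \<and> zz i l \<le> 2 * cu * real (n i) powr ell" if i: "i < m" and l: "l \<in> \<gamma>" for i l
  proof -
    have e: "zz i l = cip n i (\<lambda>r. z r l) (\<lambda>r. z r l)"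
      by (simp add: ip_Zcol_Zcol[OF i i])
    have "\<bar>cip n i (\<lambda>r. z r l) (\<lambda>r. z r l) - c i l * real (n i) powr ell\<bar> \<le> \<epsilon> * real (n i) powr ell"
      using A2 i l \<gamma>q by blast
    then have "(c i l - \<epsilon>) * real (n i) powr ell \<le> cip n i (\<lambda>r. z r l) (\<lambda>r. z r l)"
      "cip n i (\<lambda>r. z r l) (\<lambda>r. z r l) \<le> (c i l + \<epsilon>) * real (n i) powr ell"
      by (simp_all add: abs_le_iff algebra_simps)
    moreover have "\<mu> / 2 * real (n i) powr ell \<le> (c i l - \<epsilon>) * real (n i) powr ell"
      using c[OF i, of l] \<epsilon> by (intro mult_right_mono) auto
    moreover have "(c i l + \<epsilon>) * real (n i) powr ell \<le> 2 * cu * real (n i) powr ell"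
      using c[OF i, of l] \<epsilon> \<mu> by (intro mult_right_mono) auto
    ultimately show ?thesis unfolding e by linarith
  qed
  show "\<And>i l. i < m \<Longrightarrow> l \<in> \<gamma> \<Longrightarrow> \<mu> / 2 * real (n i) powr ell \<le> zz i l
       \<and> zz i l \<le> 2 * cu * real (n i) powr ell"
    using zs by blast
  have pos: "0 < ip ?N (col a) (col a)" if aC: "a \<in> cols \<alpha>" for a
  proof (cases a)
    case (Inl j)
    then have "\<mu> / 2 * P \<le> ip ?N (col a) (col a)" using xs[of j] aC by (auto simp: cols_def)
    moreover have "0 < \<mu> / 2 * P" using P \<mu> by simp
    ultimately show ?thesis by linarith
  next
    case (Inr il)
    then obtain i l where il: "a = Inr (i, l)" "i < m" "l \<in> \<gamma>" using aC unfolding cols_def by blast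
    moreover have "0 < \<mu> / 2 * real (n i) powr ell" using np[OF il(2)] \<mu> by simp
    ultimately show ?thesis using zs[OF il(2,3)] by fastforce
  qed
  define \<kappa> where "\<kappa> = 2 / \<mu> * \<epsilon> * \<rho>"
  have \<kappa>0: "0 \<le> \<kappa>" using \<mu> \<epsilon> \<rho>0 by (simp add: \<kappa>_def)
  \<comment> \<open>Shared by all pairs of columns: \<open>U\<close> and \<open>V\<close> are the
    growth rates of the two squared norms, and the lower bounds on the norms cost the factor 2/\<mu>
    in total.\<close>
  have fin_step: "g \<le> \<kappa> * sqrt A * sqrt B"
    if g: "g \<le> \<epsilon> * (\<rho> * (sqrt U * sqrt V))" and A: "\<mu> / 2 * U \<le> A" and B: "\<mu> / 2 * V \<le> B" and U: "0 \<le> U" "0 \<le> V" for g U V A B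
  proof -
    have "\<mu> / 2 * (sqrt U * sqrt V) = sqrt (\<mu> / 2 * U) * sqrt (\<mu> / 2 * V)"
    proof -
      have "sqrt (\<mu> / 2 * U) * sqrt (\<mu> / 2 * V) = (sqrt (\<mu> / 2) * sqrt (\<mu> / 2)) * (sqrt U * sqrt V)"
        unfolding real_sqrt_mult[of "\<mu> / 2"] by (simp only: ac_simps)
      then show ?thesis using \<mu> by simp
    qed
    also have "\<dots> \<le> sqrt A * sqrt B"
    proof -
      have "0 \<le> \<mu> / 2 * U" using U \<mu> by simp
      then have "0 \<le> A" using A by linarith
      then show ?thesis using A B U \<mu> by (intro mult_mono) auto
    qed
    finally have "sqrt U * sqrt V \<le> 2 / \<mu> * (sqrt A * sqrt B)" using \<mu> by (simp add: field_simps)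
    then have "\<epsilon> * (\<rho> * (sqrt U * sqrt V)) \<le> \<epsilon> * (\<rho> * (2 / \<mu> * (sqrt A * sqrt B)))"
      using \<epsilon> \<rho>0 by (intro mult_left_mono) auto
    then show ?thesis using g by (simp add: \<kappa>_def ac_simps)
  qed
  have xz: "\<bar>ip ?N (\<lambda>r. x r j) (Zcol n z i l)\<bar>
      \<le> \<kappa> * sqrt (ip ?N (\<lambda>r. x r j) (\<lambda>r. x r j)) * sqrt (zz i l)"
    if j: "j \<in> \<alpha>" and i: "i < m" and l: "l \<in> \<gamma>" for i j l
  proof (rule fin_step)
    have "\<bar>ip ?N (\<lambda>r. x r j) (Zcol n z i l)\<bar> \<le> \<epsilon> * real (n i) powr ((\<xi> + ell) / 2 - \<tau>)"
    proof -
      have "j < p" "l < q" using j l \<alpha>p \<gamma>q by auto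
      then show ?thesis unfolding ip_Zcol[OF i] using A3 i by blast
    qed
    also have "\<dots> \<le> \<epsilon> * (\<rho> * real (n i) powr ((\<xi> + ell) / 2))" using \<rho>[OF i] \<epsilon> by (intro mult_left_mono)
    also have "real (n i) powr ((\<xi> + ell) / 2) = sqrt (real (n i) powr \<xi>) * sqrt (real (n i) powr ell)"
      by (rule sqrt_powr_mult[symmetric, OF np[OF i]])
    finally show "\<bar>ip ?N (\<lambda>r. x r j) (Zcol n z i l)\<bar> \<le> \<epsilon> * (\<rho> * (sqrt (real (n i) powr \<xi>) * sqrt (real (n i) powr ell)))" .
    have "\<mu> / 2 * real (n i) powr \<xi> \<le> \<mu> / 2 * P" using Pge[OF i] \<mu> by (intro mult_left_mono) auto
    then show "\<mu> / 2 * real (n i) powr \<xi> \<le> ip ?N (\<lambda>r. x r j) (\<lambda>r. x r j)" using xs[OF j] by linarith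
  qed (use zs[OF i l] in auto)
  have "\<bar>ip ?N (col a) (col b)\<bar> \<le> \<kappa> * sqrt (ip ?N (col a) (col a)) * sqrt (ip ?N (col b) (col b))"
    if a: "a \<in> cols \<alpha>" and b: "b \<in> cols \<alpha>" and ab: "a \<noteq> b" for a b
  proof -
    consider j j' where "a = Inl j" "b = Inl j'" "j \<in> \<alpha>" "j' \<in> \<alpha>"
      | j i l where "a = Inl j" "b = Inr (i, l)" "j \<in> \<alpha>" "i < m" "l \<in> \<gamma>"
      | j i l where "b = Inl j" "a = Inr (i, l)" "j \<in> \<alpha>" "i < m" "l \<in> \<gamma>"
      | i l i' l' where "a = Inr (i, l)" "b = Inr (i', l')" "i < m" "l \<in> \<gamma>" "i' < m" "l' \<in> \<gamma>"
      using a b unfolding cols_def by blast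
    then show ?thesis
    proof cases
      case 1
      then have jj: "j \<noteq> j'" using ab by auto
      have "\<bar>ip ?N (\<lambda>r. x r j) (\<lambda>r. x r j')\<bar> \<le> (\<Sum>i<m. \<bar>cip n i (\<lambda>r. x r j) (\<lambda>r. x r j')\<bar>)"
        unfolding ip_eq_sum_cip by (rule sum_abs)
      also have "\<dots> \<le> (\<Sum>i<m. \<epsilon> * (\<rho> * real (n i) powr \<xi>))"
      proof (rule sum_mono)
        fix i assume "i \<in> {..<m}"
        then have i: "i < m" by simp
        have "\<bar>cip n i (\<lambda>r. x r j) (\<lambda>r. x r j')\<bar> \<le> \<epsilon> * real (n i) powr (\<xi> - \<tau>)"
          using A1 i jj 1 \<alpha>p by blast
        also have "\<dots> \<le> \<epsilon> * (\<rho> * real (n i) powr \<xi>)" using \<rho>[OF i] \<epsilon> by (intro mult_left_mono)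
        finally show "\<bar>cip n i (\<lambda>r. x r j) (\<lambda>r. x r j')\<bar> \<le> \<epsilon> * (\<rho> * real (n i) powr \<xi>)" .
      qed
      also have "\<dots> = \<epsilon> * (\<rho> * (sqrt P * sqrt P))" using P by (simp add: P_def sum_distrib_left[symmetric])
      finally show ?thesis unfolding 1 col_simps
        by (rule fin_step) (use xs 1 P in auto)
    next
      case 2
      then show ?thesis using xz by simp
    next
      case 3
      then show ?thesis using xz[of j i l] by (simp add: ip_commute[of ?N "Zcol n z i l" "\<lambda>r. x r j"] mult.commute mult.left_commute)
    next
      case 4
      show ?thesis
      proof (cases "i = i'")
        case True
        then have ll: "l \<noteq> l'" using ab 4 by auto
        have "\<bar>ip ?N (Zcol n z i l) (Zcol n z i' l')\<bar> \<le> \<epsilon> * real (n i) powr (ell - \<tau>)"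
          using A2 4 ll \<gamma>q True by (auto simp: ip_Zcol_Zcol)
        also have "\<dots> \<le> \<epsilon> * (\<rho> * real (n i) powr ell)" using \<rho>[OF 4(3)] \<epsilon> by (intro mult_left_mono)
        also have "\<dots> = \<epsilon> * (\<rho> * (sqrt (real (n i) powr ell) * sqrt (real (n i') powr ell)))" using True by simp
        finally show ?thesis unfolding 4 col_simps
          by (rule fin_step) (use zs 4 in auto)
      next
        case False
        then have "ip ?N (col a) (col b) = 0" using 4 by (simp add: ip_Zcol_Zcol)
        moreover have "0 \<le> \<kappa> * sqrt (ip ?N (col a) (col a)) * sqrt (ip ?N (col b) (col b))"
          using \<kappa>0 by (intro mult_nonneg_nonneg) (auto simp: ip_nonneg)
        ultimately show ?thesis by simp
      qed
    qed
  qed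
  moreover have "real (card (cols \<alpha>)) * \<kappa> \<le> Kc * (2 / \<mu> * \<epsilon>)"
  proof -
    have "real (card (cols \<alpha>)) * \<kappa> \<le> Kc * real nm powr \<tau> * \<kappa>" using Kc \<kappa>0 by (rule mult_right_mono)
    also have "\<dots> = Kc * (2 / \<mu> * \<epsilon>) * (real nm powr \<tau> * \<rho>)" by (simp add: \<kappa>_def)
    also have "real nm powr \<tau> * \<rho> = 1" using nm0 by (simp add: \<rho>_def powr_add[symmetric])
    finally show ?thesis by simp
  qed
  ultimately show "coherent \<alpha> (Kc * (2 / \<mu> * \<epsilon>))"
    unfolding coherent_def using fin_\<alpha> small pos \<kappa>0 by blast
qed

end

section \<open>Gaussian product measures\<close>

lemma prob_space_std_normal: "prob_space std_normal"
  unfolding std_normal_def by (rule prob_space_normal_density) simp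

lemma sets_std_normal [measurable_cong, simp]: "sets std_normal = sets borel"
  by (simp add: std_normal_def)

lemma space_std_normal [simp]: "space std_normal = UNIV"
  by (simp add: std_normal_def)

lemma AE_std_normal_neq: "AE x in std_normal. x \<noteq> c"
  unfolding std_normal_def using AE_lborel_singleton[of c]
  by (subst AE_density) (auto elim: eventually_mono)

abbreviation gauss :: "('i \<Rightarrow> real) measure" where
  "gauss \<equiv> PiM UNIV (\<lambda>_. std_normal)"

lemma prob_space_gauss: "prob_space gauss"
  by (intro prob_space_PiM prob_space_std_normal)

lemma space_gauss [simp]: "space gauss = UNIV"
  by (simp add: space_PiM)

lemma measurable_coord [measurable]: "(\<lambda>w. w i) \<in> borel_measurable gauss"
proof -
  have "(\<lambda>w. w i) \<in> measurable gauss std_normal" by (rule measurable_component_singleton) simp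
  then show ?thesis by (simp cong: measurable_cong_sets)
qed

text \<open>Resampling one coordinate leaves the law unchanged, so null sets may be checked on lines.\<close>

lemma AE_gauss_section:
  fixes i :: 'i
  assumes P: "{w. P w} \<in> sets gauss" and ae: "\<And>w. AE x in std_normal. P (w (i := x))"
  shows "AE w in gauss. P w"
proof -
  interpret S: prob_space std_normal by (rule prob_space_std_normal)
  interpret G: prob_space "gauss :: ('i \<Rightarrow> real) measure" by (rule prob_space_gauss)
  interpret pair_sigma_finite std_normal "gauss :: ('i \<Rightarrow> real) measure" ..
  have m: "(\<lambda>(x, X). X(i := x)) \<in> measurable (std_normal \<Otimes>\<^sub>M gauss) gauss"
  proof (rule measurable_PiM_single')
    fix j
    show "(\<lambda>v. (case v of (x, X) \<Rightarrow> X(i := x)) j) \<in> measurable (std_normal \<Otimes>\<^sub>M gauss) std_normal"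
    proof (cases "j = i")
      case True then show ?thesis by (simp add: split_def)
    next
      case False
      have "(\<lambda>X. X j) \<in> measurable gauss std_normal" by (rule measurable_component_singleton) simp
      from measurable_compose[OF measurable_snd this] False show ?thesis by (simp add: split_def)
    qed
  qed (auto simp: space_pair_measure)
  have d: "distr (std_normal \<Otimes>\<^sub>M gauss) gauss (\<lambda>(x, X). X(i := x)) = gauss"
    using distr_pair_PiM_eq_PiM[of UNIV "\<lambda>_. std_normal" i] prob_space_std_normal by simp
  have meas: "{v \<in> space (std_normal \<Otimes>\<^sub>M gauss). P ((snd v)(i := fst v))} \<in> sets (std_normal \<Otimes>\<^sub>M gauss)"
    using measurable_sets[OF m P] by (simp add: vimage_def split_def space_pair_measure)
  have "AE w in gauss. AE x in std_normal. P (w (i := x))" using ae by simp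
  then have "AE x in std_normal. AE w in gauss. P (w (i := x))"
    using AE_commute[of "\<lambda>x w. P (w (i := x))"] meas by simp
  then have "AE v in std_normal \<Otimes>\<^sub>M gauss. P ((snd v)(i := fst v))"
    using meas by (intro AE_pair_measure) auto
  then have "AE w in distr (std_normal \<Otimes>\<^sub>M gauss) gauss (\<lambda>(x, X). X(i := x)). P w"
    using P by (subst AE_distr_iff[OF m]) (simp_all add: split_def)
  then show ?thesis unfolding d .
qed

text \<open>On every line in direction \<open>i\<close> the form vanishes at exactly one
  point.\<close>

lemma AE_gauss_linear_neq_0:
  assumes J: "finite J" "i \<in> J" "a i \<noteq> 0"
  shows "AE w in gauss. (\<Sum>s\<in>J. a s * w s) \<noteq> 0"
proof (rule AE_gauss_section[where i = i])
  have "(\<lambda>w. \<Sum>s\<in>J. a s * w s) \<in> borel_measurable gauss" by measurable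
  then have "(\<lambda>w. \<Sum>s\<in>J. a s * w s) -` (- {0}) \<inter> space gauss \<in> sets gauss" by (rule measurable_sets) simp
  then show "{w. (\<Sum>s\<in>J. a s * w s) \<noteq> 0} \<in> sets gauss" by (simp add: vimage_def)
  fix w :: "'a \<Rightarrow> real"
  define R where "R = (\<Sum>s\<in>J-{i}. a s * w s)"
  have "(\<Sum>s\<in>J. a s * (w (i := x)) s) = a i * x + R" for x
    unfolding R_def using J by (subst sum.remove[of _ i]) (auto intro!: sum.cong)
  moreover have "a i * x + R \<noteq> 0" if "x \<noteq> - R / a i" for x
    using that J(3) by (simp add: field_simps add_eq_0_iff2)
  ultimately show "AE x in std_normal. (\<Sum>s\<in>J. a s * (w (i := x)) s) \<noteq> 0"
    using AE_std_normal_neq[of "- R / a i"] by (auto elim!: eventually_mono)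
qed

text \<open>Each line in a coordinate direction of J meets the sphere in at most two points; hence
  the chi-square law has no atoms.\<close>

lemma AE_gauss_sq_neq:
  assumes J: "finite J" "J \<noteq> {}"
  shows "AE w in gauss. (\<Sum>s\<in>J. (w s)^2) \<noteq> t"
proof -
  obtain i where i: "i \<in> J" using J by auto
  show ?thesis
  proof (rule AE_gauss_section[where i = i])
    have "(\<lambda>w. \<Sum>s\<in>J. (w s)^2) \<in> borel_measurable gauss" by measurable
    then have "(\<lambda>w. \<Sum>s\<in>J. (w s)^2) -` (- {t}) \<inter> space gauss \<in> sets gauss" by (rule measurable_sets) simp
    then show "{w. (\<Sum>s\<in>J. (w s)^2) \<noteq> t} \<in> sets gauss" by (simp add: vimage_def)
    fix w :: "'a \<Rightarrow> real"
    define R where "R = (\<Sum>s\<in>J-{i}. (w s)^2)"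
    have A: "(\<Sum>s\<in>J. ((w (i := x)) s)^2) = x^2 + R" for x
      unfolding R_def using J i by (subst sum.remove[of _ i]) (auto intro!: sum.cong)
    have B: "x^2 + R \<noteq> t" if "x \<noteq> sqrt (t - R)" "x \<noteq> - sqrt (t - R)" for x
    proof
      assume "x^2 + R = t"
      then have "t - R = x^2" by simp
      then have "\<bar>x\<bar> = sqrt (t - R)" by simp
      with that show False by linarith
    qed
    have "AE x in std_normal. x \<noteq> sqrt (t - R) \<and> x \<noteq> - sqrt (t - R)"
      using AE_std_normal_neq by (intro AE_conjI) auto
    then show "AE x in std_normal. (\<Sum>s\<in>J. ((w (i := x)) s)^2) \<noteq> t"
    proof (rule eventually_mono)
      fix x assume "x \<noteq> sqrt (t - R) \<and> x \<noteq> - sqrt (t - R)"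
      then show "(\<Sum>s\<in>J. ((w (i := x)) s)^2) \<noteq> t" unfolding A using B by blast
    qed
  qed
qed

lemma distr_gauss_coord: "distr gauss std_normal (\<lambda>w. w i) = std_normal"
  by (rule distr_PiM_component) (auto intro: prob_space_std_normal)

lemma std_normal_moments:
  "integrable std_normal (\<lambda>x. x)" "integral\<^sup>L std_normal (\<lambda>x. x) = 0"
  "integrable std_normal (\<lambda>x. x^2)" "integral\<^sup>L std_normal (\<lambda>x. x^2) = 1"
proof -
  show "integrable std_normal (\<lambda>x. x)" "integral\<^sup>L std_normal (\<lambda>x. x) = 0"
    unfolding std_normal_def
    using integrable_std_normal_moment[of 1] integral_std_normal_moment_odd[of 0]
    by (simp_all add: integrable_density integral_density)
  show "integrable std_normal (\<lambda>x. x^2)" "integral\<^sup>L std_normal (\<lambda>x. x^2) = 1"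
    unfolding std_normal_def
    using integrable_std_normal_moment[of 2] integral_std_normal_moment_even[of 1]
    by (simp_all add: integrable_density integral_density)
qed

lemma indep_coords: "prob_space.indep_vars gauss (\<lambda>_. borel) (\<lambda>i w. w i) UNIV"
proof -
  interpret G: prob_space "gauss :: ('i \<Rightarrow> real) measure" by (rule prob_space_gauss)
  have "G.indep_vars (\<lambda>_. std_normal) (\<lambda>i w. w i) UNIV"
  proof (subst G.indep_vars_iff_distr_eq_PiM')
    show "distr gauss gauss (\<lambda>x. \<lambda>i\<in>UNIV. x i) = Pi\<^sub>M UNIV (\<lambda>i. distr gauss std_normal (\<lambda>w. w i))"
      by (simp add: distr_gauss_coord restrict_UNIV)
  qed (auto intro: measurable_component_singleton)
  then show ?thesis
    unfolding G.indep_vars_def by (simp cong: measurable_cong_sets)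
qed

lemma gauss_product_moment:
  fixes s t :: 'i
  shows "integrable gauss (\<lambda>w. w s * w t)" "integral\<^sup>L gauss (\<lambda>w. w s * w t) = (if s = t then 1 else 0)"
proof -
  interpret G: prob_space "gauss :: ('i \<Rightarrow> real) measure" by (rule prob_space_gauss)
  have c: "(\<lambda>w. w i) \<in> measurable gauss std_normal" for i :: 'i by (rule measurable_component_singleton) simp
  have i1: "integrable gauss (\<lambda>w. w i)" and e1: "integral\<^sup>L gauss (\<lambda>w. w i) = 0" for i :: 'i
    using std_normal_moments(1,2) integrable_distr_eq[OF c[of i], where f = "\<lambda>x. x"] integral_distr[OF c[of i], where f = "\<lambda>x. x"]
    by (simp_all add: distr_gauss_coord)
  have i2: "integrable gauss (\<lambda>w. (w i)^2)" and e2: "integral\<^sup>L gauss (\<lambda>w. (w i)^2) = 1" for i :: 'i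
    using std_normal_moments(3,4) integrable_distr_eq[OF c[of i], where f = "\<lambda>x. x^2"] integral_distr[OF c[of i], where f = "\<lambda>x. x^2"]
    by (simp_all add: distr_gauss_coord)
  have "integrable gauss (\<lambda>w. w s * w t) \<and> integral\<^sup>L gauss (\<lambda>w. w s * w t) = (if s = t then 1 else 0)"
  proof (cases "s = t")
    case True
    then show ?thesis using i2[of t] e2[of t] by (simp add: power2_eq_square)
  next
    case False
    have ind: "G.indep_vars (\<lambda>_. borel) (\<lambda>i w. w i) {s, t}"
      by (rule G.indep_vars_subset[OF indep_coords]) simp
    show ?thesis
      using G.indep_vars_lebesgue_integral[OF _ ind i1] G.indep_vars_integrable[OF _ ind i1] False e1 by simp
  qed
  then show "integrable gauss (\<lambda>w. w s * w t)" "integral\<^sup>L gauss (\<lambda>w. w s * w t) = (if s = t then 1 else 0)"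
    by auto
qed

lemma gauss_linear_second_moment:
  assumes J: "finite J"
  shows "integrable gauss (\<lambda>w. (\<Sum>s\<in>J. a s * w s)^2)"
    "integral\<^sup>L gauss (\<lambda>w. (\<Sum>s\<in>J. a s * w s)^2) = (\<Sum>s\<in>J. (a s)^2)"
proof -
  have e: "(\<lambda>w. (\<Sum>s\<in>J. a s * w s)^2) = (\<lambda>w. \<Sum>s\<in>J. \<Sum>t\<in>J. (a s * a t) * (w s * w t))"
    by (simp add: power2_eq_square sum_product algebra_simps fun_eq_iff)
  show "integrable gauss (\<lambda>w. (\<Sum>s\<in>J. a s * w s)^2)"
    unfolding e by (intro Bochner_Integration.integrable_sum integrable_mult_right gauss_product_moment)
  have "integral\<^sup>L gauss (\<lambda>w. (\<Sum>s\<in>J. a s * w s)^2) = (\<Sum>s\<in>J. \<Sum>t\<in>J. (a s * a t) * (if s = t then 1 else 0))"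
    unfolding e by (simp add: integral_sum integrable_sum gauss_product_moment)
  also have "\<dots> = (\<Sum>s\<in>J. (a s)^2)"
    using J by (intro sum.cong refl) (simp add: power2_eq_square if_distrib cong: if_cong)
  finally show "integral\<^sup>L gauss (\<lambda>w. (\<Sum>s\<in>J. a s * w s)^2) = (\<Sum>s\<in>J. (a s)^2)" .
qed

text \<open>Second moments suffice: a sum of squares controls all linear forms at once, at a cost
  proportional to their number, and the columns are few compared with their squared norms.\<close>

lemma gauss_markov_sum_sq:
  assumes J: "finite J" and A: "finite A" and c: "0 < c"
  shows "measure gauss {w. c \<le> (\<Sum>k\<in>A. (\<Sum>s\<in>J. a k s * w s)^2)} \<le> (\<Sum>k\<in>A. \<Sum>s\<in>J. (a k s)^2) / c"
proof -
  have "measure gauss {w \<in> space gauss. c \<le> (\<Sum>k\<in>A. (\<Sum>s\<in>J. a k s * w s)^2)}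
     \<le> integral\<^sup>L gauss (\<lambda>w. \<Sum>k\<in>A. (\<Sum>s\<in>J. a k s * w s)^2) / c"
    by (rule integral_Markov_inequality_measure[where A = "{}"])
      (use c J in \<open>auto intro!: gauss_linear_second_moment sum_nonneg\<close>)
  also have "integral\<^sup>L gauss (\<lambda>w. \<Sum>k\<in>A. (\<Sum>s\<in>J. a k s * w s)^2) = (\<Sum>k\<in>A. \<Sum>s\<in>J. (a k s)^2)"
    using J by (simp add: integral_sum gauss_linear_second_moment)
  finally show ?thesis by simp
qed

section \<open>Tightness of the random effects, away from infinity and from 0\<close>

definition tail_event :: "'i set \<Rightarrow> ('i \<Rightarrow> real) \<Rightarrow> real \<Rightarrow> real \<Rightarrow> ('i \<Rightarrow> real) set" where
  "tail_event F a R \<eta> = {w. \<exists>s\<in>F. R < \<bar>a s * w s\<bar> \<or> \<bar>a s * w s\<bar> < \<eta>}"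

lemma tail_event_sets [measurable]: "finite F \<Longrightarrow> tail_event F a R \<eta> \<in> sets gauss"
proof -
  assume "finite F"
  then have "{w \<in> space gauss. \<exists>s\<in>F. R < \<bar>a s * w s\<bar> \<or> \<bar>a s * w s\<bar> < \<eta>} \<in> sets gauss" by measurable
  then show ?thesis by (simp add: tail_event_def)
qed

text \<open>One index n drives both thresholds, so the events decrease. Their intersection is null
  because the modulus of a nonzero number eventually lies between 1/(n+1) and n+1.\<close>

lemma gauss_tight:
  fixes a :: "'i \<Rightarrow> real"
  assumes F: "finite F" "\<And>s. s \<in> F \<Longrightarrow> a s \<noteq> 0" and \<rho>: "0 < \<rho>"
  shows "\<exists>R>0. \<exists>\<eta>>0. measure gauss (tail_event F a R \<eta>) < \<rho>"
proof -
  interpret G: prob_space "gauss :: ('i \<Rightarrow> real) measure" by (rule prob_space_gauss)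
  define B where "B n = tail_event F a (real n + 1) (1 / (real n + 1))" for n :: nat
  have Bm: "B n \<in> sets gauss" for n
    using F(1) by (simp add: B_def tail_event_sets)
  have dec: "decseq B"
  proof (rule antimonoI)
    fix n n' :: nat assume nn: "n \<le> n'"
    have "1 / (real n' + 1) \<le> 1 / (real n + 1)" using nn by (intro divide_left_mono) auto
    then show "B n' \<subseteq> B n" using nn unfolding B_def tail_event_def by force
  qed
  have "(\<lambda>n. measure gauss (B n)) \<longlonglongrightarrow> measure gauss (\<Inter>n. B n)"
    using Bm dec by (intro G.finite_Lim_measure_decseq) auto
  moreover have "measure gauss (\<Inter>n. B n) = 0"
  proof -
    have ae: "AE w in gauss. \<forall>s\<in>F. a s * w s \<noteq> 0"
    proof (rule AE_finite_allI[OF F(1)])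
      fix s assume "s \<in> F"
      then show "AE w in gauss. a s * w s \<noteq> 0"
        using AE_gauss_linear_neq_0[of "{s}" s a] F(2) by simp
    qed
    have "AE w in gauss. w \<notin> (\<Inter>n. B n)"
      using ae
    proof (rule eventually_mono)
      fix w :: "'i \<Rightarrow> real" assume nz: "\<forall>s\<in>F. a s * w s \<noteq> 0"
      have "\<forall>\<^sub>F n in sequentially. \<forall>s\<in>F. \<not> (real n + 1 < \<bar>a s * w s\<bar> \<or> \<bar>a s * w s\<bar> < 1 / (real n + 1))"
      proof (rule eventually_ball_finite[OF F(1)], rule ballI)
        fix s assume "s \<in> F"
        then have p: "0 < \<bar>a s * w s\<bar>" using nz by simp
        obtain N1 :: nat where N1: "\<bar>a s * w s\<bar> < real N1" using reals_Archimedean2 by blast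
        obtain N2 :: nat where N2: "1 / (real N2 + 1) < \<bar>a s * w s\<bar>"
          using reals_Archimedean[OF p] by (auto simp: inverse_eq_divide add.commute)
        show "\<forall>\<^sub>F n in sequentially. \<not> (real n + 1 < \<bar>a s * w s\<bar> \<or> \<bar>a s * w s\<bar> < 1 / (real n + 1))"
          unfolding eventually_sequentially
        proof (intro exI[of _ "max N1 N2"] allI impI)
          fix n assume n: "max N1 N2 \<le> n"
          have "1 / (real n + 1) \<le> 1 / (real N2 + 1)" using n by (intro divide_left_mono) auto
          then show "\<not> (real n + 1 < \<bar>a s * w s\<bar> \<or> \<bar>a s * w s\<bar> < 1 / (real n + 1))"
            using N1 N2 n by auto
        qed
      qed
      then obtain n where "\<forall>s\<in>F. \<not> (real n + 1 < \<bar>a s * w s\<bar> \<or> \<bar>a s * w s\<bar> < 1 / (real n + 1))"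
        unfolding eventually_sequentially by blast
      then have "w \<notin> B n" by (auto simp: B_def tail_event_def)
      then show "w \<notin> (\<Inter>n. B n)" by blast
    qed
    moreover have "(\<Inter>n. B n) \<in> sets gauss" using Bm by (intro sets.countable_INT) auto
    ultimately have "emeasure gauss (\<Inter>n. B n) = 0" using AE_iff_measurable[of "\<Inter>n. B n" gauss "\<lambda>w. w \<notin> (\<Inter>n. B n)"] by auto
    then show ?thesis by (simp add: measure_def)
  qed
  ultimately have "(\<lambda>n. measure gauss (B n)) \<longlonglongrightarrow> 0" by simp
  then have "\<forall>\<^sub>F n in sequentially. measure gauss (B n) < \<rho>" using \<rho> by (rule order_tendstoD)
  then obtain n where "measure gauss (B n) < \<rho>" unfolding eventually_sequentially by blast
  then show ?thesis unfolding B_def by (intro exI[of _ "real n + 1"] conjI exI[of _ "1 / (real n + 1)"]) auto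
qed

section \<open>The chi-square distribution\<close>

text \<open>The chi-square law is defined on coordinates numbered by naturals, whereas the effects
  sit at coordinates of another type; an injective reindexing preserves a product of identical
  factors.\<close>

lemma chisq_cdf_eq_gauss:
  fixes f :: "nat \<Rightarrow> 'i"
  assumes f: "inj f"
  shows "measure gauss {w. (\<Sum>i<m. (w (f i))^2) \<le> t} = chisq_cdf m t"
proof -
  have d: "distr gauss gauss (\<lambda>w :: 'i \<Rightarrow> real. \<lambda>n\<in>UNIV. w (f n)) = gauss"
    using distr_PiM_reindex[of UNIV "\<lambda>_. std_normal" f UNIV] f prob_space_std_normal by simp
  have mf: "(\<lambda>w :: 'i \<Rightarrow> real. \<lambda>n\<in>UNIV. w (f n)) \<in> measurable gauss gauss"
    by (intro measurable_restrict measurable_component_singleton) simp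
  have "{w \<in> space gauss. (\<Sum>i<m. (w i)^2) \<le> t} \<in> sets gauss" for m :: nat by measurable
  then have S: "{w :: nat \<Rightarrow> real. (\<Sum>i<m. (w i)^2) \<le> t} \<in> sets gauss" by simp
  have "chisq_cdf m t = measure gauss {w :: nat \<Rightarrow> real. (\<Sum>i<m. (w i)^2) \<le> t}"
    by (simp add: chisq_cdf_def chisq_space_def)
  also have "\<dots> = measure gauss ((\<lambda>w :: 'i \<Rightarrow> real. \<lambda>n\<in>UNIV. w (f n)) -` {w :: nat \<Rightarrow> real. (\<Sum>i<m. (w i)^2) \<le> t} \<inter> space gauss)"
    by (subst d[symmetric], rule measure_distr[OF mf S])
  finally show ?thesis by (simp add: vimage_def)
qed

lemma real_distribution_chisq:
  fixes f :: "nat \<Rightarrow> 'i"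
  shows "real_distribution (distr gauss borel (\<lambda>w. \<Sum>i<m. (w (f i))^2))"
proof -
  interpret G: prob_space "gauss :: ('i \<Rightarrow> real) measure" by (rule prob_space_gauss)
  interpret D: prob_space "distr gauss borel (\<lambda>w :: 'i \<Rightarrow> real. \<Sum>i<m. (w (f i))^2)"
    by (rule G.prob_space_distr) measurable
  show "real_distribution (distr gauss borel (\<lambda>w :: 'i \<Rightarrow> real. \<Sum>i<m. (w (f i))^2))"
    by unfold_locales auto
qed

lemma cdf_chisq: "cdf (distr gauss borel (\<lambda>w :: nat \<Rightarrow> real. \<Sum>i<m. (w i)^2)) = chisq_cdf m"
proof
  fix t
  have m: "(\<lambda>w :: nat \<Rightarrow> real. \<Sum>i<m. (w i)^2) \<in> borel_measurable gauss" by measurable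
  show "cdf (distr gauss borel (\<lambda>w :: nat \<Rightarrow> real. \<Sum>i<m. (w i)^2)) t = chisq_cdf m t"
    by (simp add: cdf_def measure_distr[OF m] vimage_def chisq_cdf_def chisq_space_def)
qed

lemma gauss_sq_atomless:
  assumes J: "finite J" "J \<noteq> {}"
  shows "measure gauss {w. (\<Sum>s\<in>J. (w s)^2) = t} = 0"
proof -
  have "{w \<in> space gauss. (\<Sum>s\<in>J. (w s)^2) = t} \<in> sets gauss" by measurable
  then have "emeasure gauss {w. (\<Sum>s\<in>J. (w s)^2) = t} = 0"
    using AE_gauss_sq_neq[OF J, of t] AE_iff_measurable[of "{w. (\<Sum>s\<in>J. (w s)^2) = t}" gauss "\<lambda>w. (\<Sum>s\<in>J. (w s)^2) \<noteq> t"]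
    by simp
  then show ?thesis by (simp add: measure_def)
qed

lemma isCont_chisq_cdf:
  assumes m: "1 \<le> m"
  shows "isCont (chisq_cdf m) t"
proof -
  interpret D: real_distribution "distr gauss borel (\<lambda>w :: nat \<Rightarrow> real. \<Sum>i<m. (w i)^2)"
    using real_distribution_chisq[of "\<lambda>i. i" m] by simp
  have mm: "(\<lambda>w :: nat \<Rightarrow> real. \<Sum>i<m. (w i)^2) \<in> borel_measurable gauss" by measurable
  have "measure (distr gauss borel (\<lambda>w :: nat \<Rightarrow> real. \<Sum>i<m. (w i)^2)) {t} = 0"
    using gauss_sq_atomless[of "{..<m}" t] m by (simp add: measure_distr[OF mm] vimage_def lessThan_empty_iff)
  then show ?thesis using D.isCont_cdf[of t] by (simp add: cdf_chisq)
qed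

text \<open>By continuity of the distribution function the value u is taken, and the infimum is
  attained with exactly that value. Positivity holds because the function vanishes on the
  nonpositive axis.\<close>

lemma chisq_quantile:
  assumes m: "1 \<le> m" and u: "0 < u" "u < 1"
  shows "chisq_cdf m (chisq_quantile m u) = u" "0 < chisq_quantile m u"
proof -
  interpret D: real_distribution "distr gauss borel (\<lambda>w :: nat \<Rightarrow> real. \<Sum>i<m. (w i)^2)"
    using real_distribution_chisq[of "\<lambda>i. i" m] by simp
  let ?F = "chisq_cdf m"
  have mono: "?F s \<le> ?F t" if "s \<le> t" for s t using D.cdf_nondecreasing[OF that] by (simp add: cdf_chisq)
  have F0: "?F t = 0" if "t \<le> 0" for t
  proof -
    have "?F t \<le> ?F 0" using mono that by simp
    also have "?F 0 = measure gauss {w :: nat \<Rightarrow> real. (\<Sum>s\<in>{..<m}. (w s)^2) = 0}"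
    proof -
      have "{w :: nat \<Rightarrow> real. (\<Sum>i<m. (w i)^2) \<le> 0} = {w. (\<Sum>s\<in>{..<m}. (w s)^2) = 0}"
      proof (intro Collect_cong iffI)
        fix w :: "nat \<Rightarrow> real" assume "(\<Sum>i<m. (w i)^2) \<le> 0"
        then show "(\<Sum>i<m. (w i)^2) = 0" by (intro order_antisym sum_nonneg) auto
      qed simp
      then show ?thesis by (simp add: chisq_cdf_def chisq_space_def)
    qed
    also have "\<dots> = 0" by (rule gauss_sq_atomless) (use m in \<open>auto simp: lessThan_empty_iff\<close>)
    finally show ?thesis by (simp add: chisq_cdf_def order_antisym)
  qed
  have "\<forall>\<^sub>F t in at_top. u < ?F t"
    using D.cdf_lim_at_top_prob u(2) by (simp add: cdf_chisq order_tendstoD(1))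
  then obtain b where b: "u < ?F b" by (auto simp: eventually_at_top_linorder)
  have b0: "0 \<le> b" using F0[of b] b u by (cases "b \<le> 0") auto
  have "\<exists>t\<ge>0. t \<le> b \<and> ?F t = u"
    by (rule IVT) (use F0[of 0] b b0 u isCont_chisq_cdf[OF m] in auto)
  then obtain t0 where t0: "?F t0 = u" by blast
  define A where "A = {t. u \<le> ?F t}"
  have A: "t0 \<in> A" "bdd_below A"
  proof -
    show "t0 \<in> A" by (simp add: A_def t0)
    have "0 \<le> t" if "t \<in> A" for t using F0[of t] that u by (cases "t \<le> 0") (auto simp: A_def)
    then show "bdd_below A" by (rule bdd_belowI)
  qed
  define q where "q = Inf A"
  have qt0: "q \<le> t0" unfolding q_def using A by (intro cInf_lower)
  have "?F q \<le> u" using mono[OF qt0] t0 by simp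
  moreover have "u \<le> ?F q"
  proof -
    have "closed A" unfolding A_def
      by (intro closed_Collect_le continuous_on_const continuous_at_imp_continuous_on) (use isCont_chisq_cdf[OF m] in auto)
    then have "q \<in> A" unfolding q_def using A by (intro closed_contains_Inf) auto
    then show ?thesis by (simp add: A_def)
  qed
  ultimately have Fq: "?F q = u" by simp
  have q: "chisq_quantile m u = q" by (simp add: chisq_quantile_def q_def A_def)
  show "chisq_cdf m (chisq_quantile m u) = u" using Fq q by simp
  show "0 < chisq_quantile m u" using Fq F0[of q] u q by (cases "q \<le> 0") auto
qed

text \<open>Outside three unlikely events, a gap above e' between \<open>T \<nu>\<close> and
  \<open>S\<close> and the closeness of \<open>S\<close> to either endpoint, both variables lie on
  the same side of each endpoint. Closeness to an endpoint is unlikely because \<open>S\<close> has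
  no atom there.\<close>

lemma (in prob_space) interval_prob_limit:
  fixes T :: "nat \<Rightarrow> 'a \<Rightarrow> real"
  assumes S [measurable]: "S \<in> borel_measurable M" and T [measurable]: "\<And>\<nu>. T \<nu> \<in> borel_measurable M"
    and conv: "\<And>e. 0 < e \<Longrightarrow> (\<lambda>\<nu>. prob {w \<in> space M. e < \<bar>T \<nu> w - S w\<bar>}) \<longlonglongrightarrow> 0"
    and atom: "prob {w \<in> space M. S w = q0} = 0" "prob {w \<in> space M. S w = q1} = 0"
  shows "(\<lambda>\<nu>. prob {w \<in> space M. q0 < T \<nu> w \<and> T \<nu> w < q1}) \<longlonglongrightarrow> prob {w \<in> space M. q0 < S w \<and> S w < q1}"
proof (rule LIMSEQ_I)
  fix \<rho> :: real assume \<rho>: "0 < \<rho>"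
  have near: "\<exists>e>0. prob {w \<in> space M. \<bar>S w - q\<bar> \<le> e} < \<rho> / 3" if at: "prob {w \<in> space M. S w = q} = 0" for q
  proof -
    define B where "B n = {w \<in> space M. \<bar>S w - q\<bar> \<le> 1 / (real n + 1)}" for n :: nat
    have Bm: "B n \<in> sets M" for n unfolding B_def by measurable
    have "decseq B"
    proof (rule antimonoI)
      fix n n' :: nat assume nn: "n \<le> n'"
      have "1 / (real n' + 1) \<le> 1 / (real n + 1)" using nn by (intro divide_left_mono) auto
      then show "B n' \<subseteq> B n" unfolding B_def by force
    qed
    then have "(\<lambda>n. prob (B n)) \<longlonglongrightarrow> prob (\<Inter>n. B n)" using Bm by (intro finite_Lim_measure_decseq) auto
    moreover have "(\<Inter>n. B n) = {w \<in> space M. S w = q}"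
    proof (intro equalityI subsetI)
      fix w assume w: "w \<in> (\<Inter>n. B n)"
      have "\<not> 0 < \<bar>S w - q\<bar>"
      proof
        assume p: "0 < \<bar>S w - q\<bar>"
        obtain n :: nat where "1 / (real n + 1) < \<bar>S w - q\<bar>"
          using reals_Archimedean[OF p] by (auto simp: inverse_eq_divide add.commute)
        moreover have "w \<in> B n" using w by blast
        ultimately show False by (simp add: B_def)
      qed
      moreover have "w \<in> B 0" using w by blast
      ultimately show "w \<in> {w \<in> space M. S w = q}" by (simp add: B_def)
    qed (auto simp: B_def)
    ultimately have "(\<lambda>n. prob (B n)) \<longlonglongrightarrow> 0" using at by simp
    then have "\<forall>\<^sub>F n in sequentially. prob (B n) < \<rho> / 3" using \<rho> by (intro order_tendstoD) auto
    then obtain n where "prob (B n) < \<rho> / 3" unfolding eventually_sequentially by blast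
    then show ?thesis unfolding B_def by (intro exI[of _ "1 / (real n + 1)"]) auto
  qed
  obtain e0 e1 where e: "0 < e0" "0 < e1" "prob {w \<in> space M. \<bar>S w - q0\<bar> \<le> e0} < \<rho> / 3"
    "prob {w \<in> space M. \<bar>S w - q1\<bar> \<le> e1} < \<rho> / 3"
    using near[OF atom(1)] near[OF atom(2)] by blast
  define e' where "e' = min e0 e1"
  have e': "0 < e'" using e by (simp add: e'_def)
  have "\<forall>\<^sub>F \<nu> in sequentially. prob {w \<in> space M. e' < \<bar>T \<nu> w - S w\<bar>} < \<rho> / 3"
    using conv[OF e'] \<rho> by (intro order_tendstoD) auto
  then obtain n0 where n0: "\<And>\<nu>. n0 \<le> \<nu> \<Longrightarrow> prob {w \<in> space M. e' < \<bar>T \<nu> w - S w\<bar>} < \<rho> / 3"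
    unfolding eventually_sequentially by blast
  have "norm (prob {w \<in> space M. q0 < T \<nu> w \<and> T \<nu> w < q1} - prob {w \<in> space M. q0 < S w \<and> S w < q1}) < \<rho>"
    if \<nu>: "n0 \<le> \<nu>" for \<nu>
  proof -
    let ?A = "{w \<in> space M. q0 < T \<nu> w \<and> T \<nu> w < q1}"
    let ?B = "{w \<in> space M. q0 < S w \<and> S w < q1}"
    let ?E = "{w \<in> space M. e' < \<bar>T \<nu> w - S w\<bar>}"
    let ?Lo = "{w \<in> space M. \<bar>S w - q0\<bar> \<le> e0}"
    let ?Hi = "{w \<in> space M. \<bar>S w - q1\<bar> \<le> e1}"
    have mm: "?A \<in> events" "?B \<in> events" "?E \<in> events" "?Lo \<in> events" "?Hi \<in> events" by measurable
    have diff: "(w \<in> ?A) = (w \<in> ?B)" if "w \<in> space M" "w \<notin> ?E" "w \<notin> ?Lo" "w \<notin> ?Hi" for w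
    proof -
      have "e' \<le> e0" "e' \<le> e1" by (simp_all add: e'_def)
      moreover have "\<bar>T \<nu> w - S w\<bar> \<le> e'" "e0 < \<bar>S w - q0\<bar>" "e1 < \<bar>S w - q1\<bar>" using that by auto
      ultimately have "q0 < T \<nu> w \<longleftrightarrow> q0 < S w" "T \<nu> w < q1 \<longleftrightarrow> S w < q1" by linarith+
      then show ?thesis by simp
    qed
    have U: "prob (?E \<union> (?Lo \<union> ?Hi)) < \<rho>"
    proof -
      have "prob (?E \<union> (?Lo \<union> ?Hi)) \<le> prob ?E + prob (?Lo \<union> ?Hi)"
        using mm by (intro measure_Un_le) auto
      also have "prob (?Lo \<union> ?Hi) \<le> prob ?Lo + prob ?Hi" using mm by (intro measure_Un_le) auto
      finally show ?thesis using n0[OF \<nu>] e by simp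
    qed
    have "prob ?A \<le> prob (?B \<union> (?E \<union> (?Lo \<union> ?Hi)))"
      using mm diff by (intro finite_measure_mono) blast+
    also have "\<dots> \<le> prob ?B + prob (?E \<union> (?Lo \<union> ?Hi))" using mm by (intro measure_Un_le) auto
    finally have 1: "prob ?A - prob ?B < \<rho>" using U by linarith
    have "prob ?B \<le> prob (?A \<union> (?E \<union> (?Lo \<union> ?Hi)))"
      using mm diff by (intro finite_measure_mono) blast+
    also have "\<dots> \<le> prob ?A + prob (?E \<union> (?Lo \<union> ?Hi))" using mm by (intro measure_Un_le) auto
    finally have 2: "prob ?B - prob ?A < \<rho>" using U by linarith
    show ?thesis using 1 2 by (simp add: abs_less_iff)
  qed
  then show "\<exists>no. \<forall>\<nu>\<ge>no. norm (prob {w \<in> space M. q0 < T \<nu> w \<and> T \<nu> w < q1} - prob {w \<in> space M. q0 < S w \<and> S w < q1}) < \<rho>"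
    by blast
qed

lemma chisq_interval_prob:
  fixes f :: "nat \<Rightarrow> 'i"
  assumes f: "inj f" and m: "1 \<le> m" and a: "0 < a" "a < 1"
  shows "measure gauss {w. chisq_quantile m (a/2) < (\<Sum>i<m. (w (f i))^2) \<and> (\<Sum>i<m. (w (f i))^2) < chisq_quantile m (1 - a/2)} = 1 - a"
proof -
  interpret G: prob_space "gauss :: ('i \<Rightarrow> real) measure" by (rule prob_space_gauss)
  define S where "S w = (\<Sum>i<m. (w (f i))^2)" for w :: "'i \<Rightarrow> real"
  have Sm [measurable]: "S \<in> borel_measurable gauss" unfolding S_def[abs_def] by measurable
  define q0 where "q0 = chisq_quantile m (a/2)"
  define q1 where "q1 = chisq_quantile m (1 - a/2)"
  have F: "measure gauss {w. S w \<le> t} = chisq_cdf m t" for t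
    unfolding S_def by (rule chisq_cdf_eq_gauss[OF f])
  have F0: "chisq_cdf m q0 = a/2" and F1: "chisq_cdf m q1 = 1 - a/2"
    unfolding q0_def q1_def using chisq_quantile(1)[OF m] a by auto
  have ev: "{w. S w \<le> t} \<in> sets gauss" "{w. S w = t} \<in> sets gauss" for t
  proof -
    have "{w \<in> space gauss. S w \<le> t} \<in> sets gauss" "{w \<in> space gauss. S w = t} \<in> sets gauss" by measurable
    then show "{w. S w \<le> t} \<in> sets gauss" "{w. S w = t} \<in> sets gauss" by simp_all
  qed
  have at: "measure gauss {w. S w = q1} = 0"
  proof -
    have inj: "inj_on f {..<m}" using f by (rule inj_on_subset) simp
    have "S w = (\<Sum>s\<in>f ` {..<m}. (w s)^2)" for w unfolding S_def by (simp add: sum.reindex[OF inj])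
    then show ?thesis using gauss_sq_atomless[of "f ` {..<m}" q1] m by (simp add: lessThan_empty_iff)
  qed
  have lt: "q0 < q1"
  proof (rule ccontr)
    assume "\<not> q0 < q1"
    then have "measure gauss {w. S w \<le> q1} \<le> measure gauss {w. S w \<le> q0}"
      using ev by (intro G.finite_measure_mono) auto
    then show False using F F0 F1 a by simp
  qed
  \<comment> \<open>Only the right endpoint is removed as an atom; the left one already belongs to
    the subtracted set.\<close>
  have "{w. q0 < S w \<and> S w < q1} = ({w. S w \<le> q1} - {w. S w \<le> q0}) - {w. S w = q1}" by auto
  moreover have "measure gauss (({w. S w \<le> q1} - {w. S w \<le> q0}) - {w. S w = q1})
      = measure gauss ({w. S w \<le> q1} - {w. S w \<le> q0}) - measure gauss {w. S w = q1}"
    using ev lt by (intro G.finite_measure_Diff) auto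
  moreover have "measure gauss ({w. S w \<le> q1} - {w. S w \<le> q0})
      = measure gauss {w. S w \<le> q1} - measure gauss {w. S w \<le> q0}"
    using ev lt by (intro G.finite_measure_Diff) auto
  ultimately show ?thesis using F F0 F1 at by (simp add: S_def q0_def q1_def)
qed

section \<open>Failure probability for a fixed sample size\<close>

type_synonym coord = "(nat \<times> nat) + nat"

lemma ip_sum_le:
  assumes "finite S"
  shows "ip N (\<lambda>r. \<Sum>s\<in>S. f s r) (\<lambda>r. \<Sum>s\<in>S. f s r) \<le> real (card S) * (\<Sum>s\<in>S. ip N (f s) (f s))"
proof -
  have "ip N (\<lambda>r. \<Sum>s\<in>S. f s r) (\<lambda>r. \<Sum>s\<in>S. f s r) = (\<Sum>r<N. (\<Sum>s\<in>S. f s r)^2)"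
    by (simp add: ip_def power2_eq_square)
  also have "\<dots> \<le> (\<Sum>r<N. (\<Sum>s\<in>S. (f s r)^2) * card S)"
    by (intro sum_mono sum_squared_le_sum_of_squares)
  also have "\<dots> = real (card S) * (\<Sum>r<N. \<Sum>s\<in>S. (f s r)^2)"
    unfolding sum_distrib_left[of "real (card S)" "\<lambda>r. \<Sum>s\<in>S. (f s r)^2"] by (simp only: mult.commute)
  also have "(\<Sum>r<N. \<Sum>s\<in>S. (f s r)^2) = (\<Sum>s\<in>S. \<Sum>r<N. (f s r)^2)" by (rule sum.swap)
  finally show ?thesis by (simp add: ip_def power2_eq_square)
qed

lemma ip_add_le: "ip N (\<lambda>r. f r + g r) (\<lambda>r. f r + g r) \<le> 2 * ip N f f + 2 * ip N g g"
proof -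
  have "ip N (\<lambda>r. f r + g r) (\<lambda>r. f r + g r) \<le> (\<Sum>r<N. 2 * (f r * f r) + 2 * (g r * g r))"
    unfolding ip_def
  proof (rule sum_mono)
    fix r
    have "0 \<le> (f r - g r) * (f r - g r)" by simp
    then show "(f r + g r) * (f r + g r) \<le> 2 * (f r * f r) + 2 * (g r * g r)" by (simp add: algebra_simps)
  qed
  then show ?thesis by (simp add: ip_def sum.distrib sum_distrib_left)
qed

context stage
begin

text \<open>Correctness of the candidate model enters here: the mean is rewritten on \<alpha>, and
  effects outside \<gamma> have variance 0.\<close>

lemma Yobs_decomp:
  assumes \<gamma>q: "\<gamma> \<subseteq> {..<q}" and \<sigma>0: "\<And>l. l < q \<Longrightarrow> l \<notin> \<gamma> \<Longrightarrow> \<sigma> l = 0"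
    and \<alpha>c: "\<And>r. r < Ntot m n \<Longrightarrow> (\<Sum>j<p. x r j * \<beta> j) = (\<Sum>j\<in>\<alpha>. x r j * bx j)"
    and r: "r < Ntot m n"
  shows "Yobs m n p q x z \<beta> \<sigma> v0 w $ r = (\<Sum>j\<in>\<alpha>. bx j * x r j)
     + (\<Sum>i<m. \<Sum>l\<in>\<gamma>. (sqrt (\<sigma> l) * w (Inl (i, l))) * Zcol n z i l r) + sqrt v0 * w (Inr r)"
proof -
  have "(\<Sum>i<m. \<Sum>l\<in>\<gamma>. (sqrt (\<sigma> l) * w (Inl (i, l))) * Zcol n z i l r)
     = (\<Sum>i<m. if i = clus n r then (\<Sum>l\<in>\<gamma>. z r l * (sqrt (\<sigma> l) * w (Inl (clus n r, l)))) else 0)"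
    by (intro sum.cong refl) (auto simp: Zcol_def mult.commute)
  also have "\<dots> = (\<Sum>l\<in>\<gamma>. z r l * (sqrt (\<sigma> l) * w (Inl (clus n r, l))))"
    using clus_less[OF r] by simp
  also have "\<dots> = (\<Sum>l<q. z r l * (sqrt (\<sigma> l) * w (Inl (clus n r, l))))"
    using \<gamma>q \<sigma>0 by (intro sum.mono_neutral_left) auto
  finally show ?thesis using r \<alpha>c[OF r] by (simp add: Yobs_def mult.commute)
qed

context
  fixes \<delta> Dm c C L R \<eta> \<eta>0 \<eta>1 V u v0 :: real and q I k :: nat and \<gamma>0 :: "nat set" and \<sigma> \<beta> :: "nat \<Rightarrow> real"
  assumes coh: "coherent \<alpha> \<delta>" "\<delta> \<le> 1/4" and m: "0 < m"
    and \<gamma>q: "\<gamma> \<subseteq> {..<q}" and \<gamma>0: "\<gamma>0 = {l. l < q \<and> 0 < \<sigma> l}" "\<gamma>0 \<subseteq> \<gamma>" and \<sigma>: "\<And>l. 0 \<le> \<sigma> l"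
    and \<alpha>c: "\<exists>bx. \<forall>r<Ntot m n. (\<Sum>j<p. x r j * \<beta> j) = (\<Sum>j\<in>\<alpha>. x r j * bx j)"
    and Dm: "0 < Dm" "\<And>i l. i < m \<Longrightarrow> l \<in> \<gamma> \<Longrightarrow> Dm \<le> zz i l"
    and I: "I < m" and c: "1 \<le> c"
      "\<And>i l l'. i < m \<Longrightarrow> l \<in> \<gamma> \<Longrightarrow> l' \<in> \<gamma> \<Longrightarrow> zz i l \<le> c * zz I l'"
    and DN: "\<And>i l. i < m \<Longrightarrow> l \<in> \<gamma> \<Longrightarrow> zz i l \<le> C * real (Ntot m n)"
    and R: "0 \<le> R" and b0: "0 < \<eta>0"
    and V: "V = 2 * (real (m * card \<gamma>0) * (real (m * card \<gamma>0) * (R^2 * C))) + 2 * L"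
    and small: "2 * \<delta> * (R * c + \<eta>) + \<eta> \<le> \<eta>0 / 2" and \<eta>: "0 < \<eta>"
    and \<eta>1: "\<eta>1 = \<eta>0^2 / (32 * real m * (1 + c) * V)"
    and u: "0 < u" "u \<le> 1/8" "\<delta> \<le> u" "1 / Dm \<le> u * \<eta>1" "2 * R / (\<eta>1 * Dm) + 2 * \<eta> \<le> u"
    and k: "k \<in> \<gamma>0"
begin

text \<open>The deterministic core: for a good outcome a minimiser exists, so the chosen estimate is
  one; its variance part is at most \<open>V\<close>, and the localisation applies.\<close>

lemma stage_conclusion:
  assumes w0: "\<And>a. a \<in> cols \<alpha> \<Longrightarrow> ip (Ntot m n) (col a) w0 = 0"
      "ip (Ntot m n) w0 (\<lambda>r. sqrt v0 * w (Inr r)) \<noteq> 0"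
    and noise: "\<And>a. a \<in> cols \<alpha> \<Longrightarrow> \<bar>ip (Ntot m n) (col a) (\<lambda>r. sqrt v0 * w (Inr r))\<bar>
        \<le> \<eta> * sqrt Dm * sqrt (ip (Ntot m n) (col a) (col a))"
      "ip (Ntot m n) (\<lambda>r. sqrt v0 * w (Inr r)) (\<lambda>r. sqrt v0 * w (Inr r)) \<le> L * real (Ntot m n)"
    and bR: "\<And>i l. i < m \<Longrightarrow> l \<in> \<gamma>0 \<Longrightarrow> \<bar>sqrt (\<sigma> l) * w (Inl (i, l))\<bar> \<le> R"
    and bl: "\<And>i l. i < m \<Longrightarrow> l \<in> \<gamma>0 \<Longrightarrow> \<eta>0 \<le> \<bar>sqrt (\<sigma> l) * w (Inl (i, l))\<bar>"
    and Y: "Y = Yobs m n p q x z \<beta> \<sigma> v0 w"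
    and mle: "(\<exists>\<theta> v. is_mle m n x z \<alpha> \<gamma> Y \<theta> v) \<Longrightarrow> is_mle m n x z \<alpha> \<gamma> Y \<theta>h vh"
  shows "\<bar>\<theta>h k * vh - (\<Sum>i<m. (sqrt (\<sigma> k) * w (Inl (i, k)))^2) / real m\<bar> \<le> 30 * (R + 1)^2 * u"
proof -
  let ?N = "Ntot m n"
  define b where "b i l = sqrt (\<sigma> l) * w (Inl (i, l))" for i l
  define \<epsilon> where "\<epsilon> r = sqrt v0 * w (Inr r)" for r
  define y where "y = (\<lambda>r. Y $ r)"
  define W where "W = mle_resid m n x z \<alpha> \<gamma> Y"
  have Yc: "Y \<in> carrier_vec ?N" by (simp add: Y Yobs_def)
  obtain bx where bx: "\<And>r. r < ?N \<Longrightarrow> (\<Sum>j<p. x r j * \<beta> j) = (\<Sum>j\<in>\<alpha>. x r j * bx j)" using \<alpha>c by blast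
  have \<sigma>z: "\<sigma> l = 0" if "l < q" "l \<notin> \<gamma>0" for l using \<gamma>0(1) \<sigma>[of l] that by force
  have \<sigma>g: "\<sigma> l = 0" if "l < q" "l \<notin> \<gamma>" for l using \<sigma>z that \<gamma>0(2) by blast
  have dec: "y r = (\<Sum>j\<in>\<alpha>. bx j * x r j) + (\<Sum>i<m. \<Sum>l\<in>\<gamma>. b i l * Zcol n z i l r) + \<epsilon> r" if "r < ?N" for r
    unfolding y_def Y b_def \<epsilon>_def by (rule Yobs_decomp[OF \<gamma>q \<sigma>g bx that])
  have W: "gls \<alpha> y \<theta> (W \<theta>)" if "\<And>l. l \<in> \<gamma> \<Longrightarrow> 0 \<le> \<theta> l" for \<theta>
    unfolding W_def y_def by (rule gls_mle_resid[OF Yc that])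
  have fin0: "finite \<gamma>0" using \<gamma>0(2) fin finite_subset by blast
  have bz: "b i l = 0" if "l \<in> \<gamma>" "l \<notin> \<gamma>0" for i l
    using \<sigma>z[of l] that \<gamma>q by (auto simp: b_def)
  have w0y: "ip ?N w0 y = ip ?N w0 \<epsilon>"
  proof -
    have "ip ?N w0 y = ip ?N w0 (\<lambda>r. (\<Sum>j\<in>\<alpha>. bx j * x r j) + (\<Sum>i<m. \<Sum>l\<in>\<gamma>. b i l * Zcol n z i l r) + \<epsilon> r)"
      by (rule ip_cong) (auto simp: dec)
    moreover have "ip ?N w0 (\<lambda>r. x r j) = 0" if "j \<in> \<alpha>" for j
      using w0(1)[of "Inl j"] that by (auto simp: cols_def ip_commute[of ?N w0])
    moreover have "ip ?N w0 (Zcol n z i l) = 0" if "i < m" "l \<in> \<gamma>" for i l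
      using w0(1)[of "Inr (i, l)"] that by (auto simp: cols_def ip_commute[of ?N w0])
    ultimately show ?thesis by (simp add: ip_right)
  qed
  have w0e: "ip ?N w0 y \<noteq> 0" using w0(2) unfolding w0y \<epsilon>_def .
  have fa: "finite \<alpha>" by (rule fin_\<alpha>)
  have "\<exists>\<theta> v. pmin W y \<theta> v" by (rule mle_exists[OF coh W w0(1) w0e m])
  moreover have mi: "is_mle m n x z \<alpha> \<gamma> Y \<theta> v \<longleftrightarrow> pmin W y \<theta> v" for \<theta> v
    unfolding W_def y_def by (rule is_mle_iff_pmin[OF Yc])
  ultimately have pm: "pmin W y \<theta>h vh" using mle by simp
  have \<theta>h: "0 \<le> \<theta>h l" if "l \<in> \<gamma>" for l using pm that by (simp add: pmin_def)
  have Npos: "0 < ?N" using w0e by (cases ?N) (auto simp: ip_def)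
  have "(ip ?N w0 y)^2 / ip ?N w0 w0 \<le> ip ?N y (W \<theta>h)"
    by (rule gls_lower_bound[OF fa W[OF \<theta>h] \<theta>h w0(1)])
  moreover have "0 < (ip ?N w0 y)^2 / ip ?N w0 w0"
  proof -
    have "ip ?N w0 w0 \<noteq> 0"
    proof
      assume "ip ?N w0 w0 = 0"
      then have "w0 r = 0" if "r < ?N" for r using ip_self_zero[of w0 r] that by simp
      then have "ip ?N w0 y = 0" by (simp add: ip_def)
      with w0e show False by simp
    qed
    then show ?thesis using ip_nonneg[of ?N w0] w0e by simp
  qed
  ultimately have Qp: "0 < ip ?N y (W \<theta>h)" by linarith
  have vh: "vh = ip ?N y (W \<theta>h) / ?N" by (rule pmin_variance[OF Npos pm Qp])
  \<comment> \<open>The sum of random terms reduces to the pairs over \<open>\<gamma>0\<close>, so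
    that the norm bound has constants free of a possibly growing \<gamma>.\<close>
  define f where "f s r = (case s of (i, l) \<Rightarrow> b i l * Zcol n z i l r)" for s :: "nat \<times> nat" and r
  have fsum: "(\<Sum>i<m. \<Sum>l\<in>\<gamma>. b i l * Zcol n z i l r) = (\<Sum>s\<in>{..<m} \<times> \<gamma>0. f s r)" for r
  proof -
    have "(\<Sum>l\<in>\<gamma>. b i l * Zcol n z i l r) = (\<Sum>l\<in>\<gamma>0. b i l * Zcol n z i l r)" for i
      using \<gamma>0(2) fin bz by (intro sum.mono_neutral_right) auto
    then show ?thesis by (simp add: f_def sum.cartesian_product split_def)
  qed
  have dec': "y r = (\<Sum>j\<in>\<alpha>. bx j * x r j) + ((\<Sum>s\<in>{..<m} \<times> \<gamma>0. f s r) + \<epsilon> r)" if "r < ?N" for r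
    using dec[OF that] by (simp add: fsum)
  have Q1: "ip ?N y (W \<theta>h) \<le> ip ?N (\<lambda>r. (\<Sum>s\<in>{..<m} \<times> \<gamma>0. f s r) + \<epsilon> r) (\<lambda>r. (\<Sum>s\<in>{..<m} \<times> \<gamma>0. f s r) + \<epsilon> r)"
    by (rule gls_le_residual[OF fa W[OF \<theta>h] \<theta>h dec'])
  have Q2: "ip ?N (\<lambda>r. (\<Sum>s\<in>{..<m} \<times> \<gamma>0. f s r) + \<epsilon> r) (\<lambda>r. (\<Sum>s\<in>{..<m} \<times> \<gamma>0. f s r) + \<epsilon> r)
     \<le> 2 * ip ?N (\<lambda>r. \<Sum>s\<in>{..<m} \<times> \<gamma>0. f s r) (\<lambda>r. \<Sum>s\<in>{..<m} \<times> \<gamma>0. f s r) + 2 * ip ?N \<epsilon> \<epsilon>"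
    by (rule ip_add_le)
  have Q3: "ip ?N (\<lambda>r. \<Sum>s\<in>{..<m} \<times> \<gamma>0. f s r) (\<lambda>r. \<Sum>s\<in>{..<m} \<times> \<gamma>0. f s r)
      \<le> real (m * card \<gamma>0) * (\<Sum>s\<in>{..<m} \<times> \<gamma>0. ip ?N (f s) (f s))"
    using ip_sum_le[of "{..<m} \<times> \<gamma>0" ?N f] fin0 by (simp add: card_cartesian_product)
  have Q4: "(\<Sum>s\<in>{..<m} \<times> \<gamma>0. ip ?N (f s) (f s)) \<le> (\<Sum>s\<in>{..<m} \<times> \<gamma>0. R^2 * (C * ?N))"
  proof (rule sum_mono)
    fix s assume "s \<in> {..<m} \<times> \<gamma>0"
    then obtain i l where s: "s = (i, l)" "i < m" "l \<in> \<gamma>0" by auto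
    have "ip ?N (f s) (f s) = (b i l)^2 * zz i l"
    proof -
      have "f s = (\<lambda>r. b i l * Zcol n z i l r)" by (simp add: fun_eq_iff f_def s)
      then show ?thesis
        by (simp add: ip_scale_right ip_commute[of ?N "\<lambda>r. b i l * Zcol n z i l r"] power2_eq_square)
    qed
    also have "\<dots> \<le> R^2 * (C * ?N)"
    proof (rule mult_mono)
      show "(b i l)^2 \<le> R^2" using bR R s by (simp add: b_def abs_le_square_iff[symmetric])
      show "zz i l \<le> C * ?N" using DN s \<gamma>0(2) by blast
    qed (auto simp: ip_nonneg)
    finally show "ip ?N (f s) (f s) \<le> R^2 * (C * ?N)" .
  qed
  have "(\<Sum>s\<in>{..<m} \<times> \<gamma>0. R^2 * (C * ?N)) = real (m * card \<gamma>0) * (R^2 * C) * ?N"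
    by (simp add: card_cartesian_product)
  with Q4 have "real (m * card \<gamma>0) * (\<Sum>s\<in>{..<m} \<times> \<gamma>0. ip ?N (f s) (f s))
     \<le> real (m * card \<gamma>0) * (real (m * card \<gamma>0) * (R^2 * C) * ?N)"
    by (intro mult_left_mono) auto
  moreover have "ip ?N \<epsilon> \<epsilon> \<le> L * ?N" using noise(2) by (simp add: \<epsilon>_def[abs_def])
  \<comment> \<open>The factor \<open>m * card \<gamma>0\<close> occurs twice, from squaring a sum
    of that many terms and from adding up their bounds; the factor 2 comes from separating effects
    and noise.\<close>
  moreover have "V * ?N = 2 * (real (m * card \<gamma>0) * (real (m * card \<gamma>0) * (R^2 * C) * ?N)) + 2 * (L * ?N)"
    by (simp add: V algebra_simps)
  ultimately have "ip ?N y (W \<theta>h) \<le> V * ?N" using Q1 Q2 Q3 by linarith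
  then have vV: "vh \<le> V" unfolding vh using Npos by (simp add: pos_divide_le_eq)
  have bR': "\<bar>b i l\<bar> \<le> R" if "i < m" "l \<in> \<gamma>" for i l
  proof (cases "l \<in> \<gamma>0")
    case True then show ?thesis using bR[OF that(1)] by (simp add: b_def)
  next
    case False then show ?thesis using R bz[OF that(2)] by simp
  qed
  have nz: "\<bar>ip ?N (col a) \<epsilon>\<bar> \<le> \<eta> * sqrt Dm * sqrt (ip ?N (col a) (col a))" if "a \<in> cols \<alpha>" for a
    using noise(1)[OF that] by (simp add: \<epsilon>_def[abs_def])
  have "\<bar>\<theta>h k * vh - (\<Sum>i<m. (b i k)^2) / real m\<bar> \<le> 30 * (R + 1)^2 * u"
    by (rule mle_close[OF coh(1) W pm dec nz Dm I c R bR' b0 vV small less_imp_le[OF \<eta>] \<eta>1 \<gamma>0(2) bz _ u k])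
      (use bl I in \<open>auto simp: b_def\<close>)
  then show ?thesis by (simp add: b_def)
qed

text \<open>Four bad events: an effect of extreme size, noise correlated with a column, noise of
  large energy, and noise orthogonal to \<open>w0\<close>. The first three account for the terms of
  the bound; the last is null.\<close>

lemma stage_prob:
  fixes \<theta>h :: "real vec \<Rightarrow> nat \<Rightarrow> real" and vh :: "real vec \<Rightarrow> real"
  defines "Y \<equiv> Yobs m n p q x z \<beta> \<sigma> v0"
  assumes v0: "0 < v0" and K: "card (cols \<alpha>) < Ntot m n" and L: "0 < L"
    and tight: "measure gauss (tail_event (Inl ` ({..<m} \<times> \<gamma>0) :: coord set) sc R \<eta>0) < \<rho>"
    and sc: "\<And>i l. sc (Inl (i, l)) = sqrt (\<sigma> l)"
    and mle: "\<And>y. dim_vec y = Ntot m n \<Longrightarrow> (\<exists>\<theta> v. is_mle m n x z \<alpha> \<gamma> y \<theta> v) \<Longrightarrow> is_mle m n x z \<alpha> \<gamma> y (\<theta>h y) (vh y)"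
  shows "measure gauss {w. 30 * (R + 1)^2 * u < \<bar>\<theta>h (Y w) k * vh (Y w) - (\<Sum>i<m. (sqrt (\<sigma> k) * w (Inl (i, k)))^2) / real m\<bar>}
     < \<rho> + v0 * real (card (cols \<alpha>)) / (\<eta>^2 * Dm) + v0 / L"
proof -
  interpret G: prob_space "gauss :: (coord \<Rightarrow> real) measure" by (rule prob_space_gauss)
  let ?N = "Ntot m n"
  have fa: "finite \<alpha>" by (rule fin_\<alpha>)
  have fc: "finite (cols \<alpha>)" by (rule finite_cols[OF fa])
  obtain w0 where w0: "\<exists>r<?N. w0 r \<noteq> 0" "\<And>a. a \<in> cols \<alpha> \<Longrightarrow> ip ?N (col a) w0 = 0"
    using exists_orthogonal[OF fc K, of col] by blast
  define J where "J = (Inr ` {..<?N} :: (coord) set)"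
  have J: "finite J" by (simp add: J_def)
  have sumJ: "(\<Sum>s\<in>J. f s) = (\<Sum>r<?N. f (Inr r))" for f :: "coord \<Rightarrow> real"
    unfolding J_def by (subst sum.reindex) auto
  define D where "D a = ip ?N (col a) (col a)" for a
  have D: "0 < D a" if "a \<in> cols \<alpha>" for a using coh(1) that by (simp add: coherent_def D_def)
  define B1 where "B1 = tail_event (Inl ` ({..<m} \<times> \<gamma>0) :: coord set) sc R \<eta>0"
  \<comment> \<open>Coefficients of the noise projected on a column of unit length; every such
    projection has variance \<open>v0\<close>, whatever the column.\<close>
  define ca where "ca a s = (case s of Inl _ \<Rightarrow> 0 | Inr r \<Rightarrow> sqrt v0 * col a r / sqrt (D a))" for a and s :: "coord"
  define B2 where "B2 = {w :: coord \<Rightarrow> real. \<eta>^2 * Dm \<le> (\<Sum>a\<in>cols \<alpha>. (\<Sum>s\<in>J. ca a s * w s)^2)}"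
  define ce where "ce r s = (if s = Inr r then sqrt v0 else 0)" for r and s :: "coord"
  define B3 where "B3 = {w :: coord \<Rightarrow> real. L * ?N \<le> (\<Sum>r<?N. (\<Sum>s\<in>J. ce r s * w s)^2)}"
  define cw where "cw s = (case s of Inl _ \<Rightarrow> 0 | Inr r \<Rightarrow> sqrt v0 * w0 r)" for s :: "coord"
  define B4 where "B4 = {w :: coord \<Rightarrow> real. (\<Sum>s\<in>J. cw s * w s) = 0}"
  have fin0: "finite \<gamma>0" using \<gamma>0(2) fin finite_subset by blast
  have Npos: "0 < ?N" using K by simp
  have m1: "B1 \<in> sets gauss" unfolding B1_def by (rule tail_event_sets) (use fin0 in auto)
  have lin [measurable]: "(\<lambda>w. \<Sum>s\<in>J. f s * w s) \<in> borel_measurable gauss" for f :: "coord \<Rightarrow> real"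
    by measurable
  have Collect_sets: "{w. P w} \<in> sets gauss" if "{w \<in> space gauss. P w} \<in> sets gauss" for P :: "(coord \<Rightarrow> real) \<Rightarrow> bool"
    using that by simp
  have m2: "B2 \<in> sets gauss" and m3: "B3 \<in> sets gauss" and m4: "B4 \<in> sets gauss"
    unfolding B2_def B3_def B4_def by (rule Collect_sets; measurable)+
  have p2: "measure gauss B2 \<le> v0 * real (card (cols \<alpha>)) / (\<eta>^2 * Dm)"
  proof -
    have "measure gauss B2 \<le> (\<Sum>a\<in>cols \<alpha>. \<Sum>s\<in>J. (ca a s)^2) / (\<eta>^2 * Dm)"
      unfolding B2_def by (rule gauss_markov_sum_sq[OF J fc]) (use \<eta> Dm in auto)
    also have "(\<Sum>a\<in>cols \<alpha>. \<Sum>s\<in>J. (ca a s)^2) = (\<Sum>a\<in>cols \<alpha>. v0)"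
    proof (rule sum.cong[OF refl])
      fix a assume a: "a \<in> cols \<alpha>"
      have "(\<Sum>s\<in>J. (ca a s)^2) = (\<Sum>r<?N. v0 / D a * (col a r * col a r))"
        unfolding sumJ using v0 D[OF a]
        by (intro sum.cong refl) (simp add: ca_def power_divide power_mult_distrib power2_eq_square[of "col _ _"])
      also have "\<dots> = v0 / D a * D a" unfolding D_def ip_def by (simp add: sum_distrib_left)
      finally show "(\<Sum>s\<in>J. (ca a s)^2) = v0" using D[OF a] by simp
    qed
    finally show ?thesis by (simp add: mult.commute)
  qed
  have p3: "measure gauss B3 \<le> v0 / L"
  proof -
    have "measure gauss B3 \<le> (\<Sum>r<?N. \<Sum>s\<in>J. (ce r s)^2) / (L * ?N)"
      unfolding B3_def by (rule gauss_markov_sum_sq[OF J]) (use L Npos in auto)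
    also have "(\<Sum>r<?N. \<Sum>s\<in>J. (ce r s)^2) = (\<Sum>r<?N. v0)"
      unfolding sumJ using v0 by (intro sum.cong refl) (simp add: ce_def if_distrib[of "\<lambda>x. x^2"] cong: if_cong)
    finally show ?thesis using Npos by simp
  qed
  have p4: "measure gauss B4 = 0"
  proof -
    obtain r where r: "r < ?N" "w0 r \<noteq> 0" using w0(1) by blast
    have "AE w in gauss. (\<Sum>s\<in>J. cw s * w s) \<noteq> 0"
      by (rule AE_gauss_linear_neq_0[OF J, of "Inr r"]) (use r v0 in \<open>auto simp: J_def cw_def\<close>)
    then have "emeasure gauss B4 = 0"
      using AE_iff_measurable[OF m4, of "\<lambda>w. (\<Sum>s\<in>J. cw s * w s) \<noteq> 0"] by (simp add: B4_def)
    then show ?thesis by (simp add: measure_def)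
  qed
  let ?bad = "{w. 30 * (R + 1)^2 * u < \<bar>\<theta>h (Y w) k * vh (Y w) - (\<Sum>i<m. (sqrt (\<sigma> k) * w (Inl (i, k)))^2) / real m\<bar>}"
  have good: "w \<notin> ?bad" if w: "w \<notin> B1" "w \<notin> B2" "w \<notin> B3" "w \<notin> B4" for w
  proof -
    have le: "\<bar>\<theta>h (Y w) k * vh (Y w) - (\<Sum>i<m. (sqrt (\<sigma> k) * w (Inl (i, k)))^2) / real m\<bar> \<le> 30 * (R + 1)^2 * u"
    proof (rule stage_conclusion[OF w0(2)])
      show "ip ?N w0 (\<lambda>r. sqrt v0 * w (Inr r)) \<noteq> 0"
      proof -
        have "(\<Sum>s\<in>J. cw s * w s) = ip ?N w0 (\<lambda>r. sqrt v0 * w (Inr r))"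
          unfolding sumJ ip_def by (simp add: cw_def mult.commute mult.left_commute)
        then show ?thesis using w(4) by (simp add: B4_def)
      qed
      show "\<bar>ip ?N (col a) (\<lambda>r. sqrt v0 * w (Inr r))\<bar> \<le> \<eta> * sqrt Dm * sqrt (ip ?N (col a) (col a))"
        if a: "a \<in> cols \<alpha>" for a
      proof -
        define I' where "I' = ip ?N (col a) (\<lambda>r. sqrt v0 * w (Inr r))"
        have "(\<Sum>s\<in>J. ca a s * w s) = I' / sqrt (D a)"
          unfolding sumJ I'_def ip_def by (simp add: ca_def sum_divide_distrib ac_simps)
        moreover have "(\<Sum>s\<in>J. ca a s * w s)^2 \<le> (\<Sum>a\<in>cols \<alpha>. (\<Sum>s\<in>J. ca a s * w s)^2)"
          using a fc by (intro member_le_sum[of a _ "\<lambda>a. (\<Sum>s\<in>J. ca a s * w s)^2"]) auto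
        ultimately have "(I' / sqrt (D a))^2 \<le> \<eta>^2 * Dm" using w(2) by (simp add: B2_def)
        then have "\<bar>I' / sqrt (D a)\<bar> \<le> sqrt (\<eta>^2 * Dm)" by (metis real_sqrt_abs real_sqrt_le_iff)
        also have "\<dots> = \<eta> * sqrt Dm" using \<eta> by (simp add: real_sqrt_mult)
        finally show ?thesis using D[OF a] by (simp add: I'_def D_def pos_divide_le_eq)
      qed
      show "ip ?N (\<lambda>r. sqrt v0 * w (Inr r)) (\<lambda>r. sqrt v0 * w (Inr r)) \<le> L * real ?N"
      proof -
        have "(\<Sum>s\<in>J. ce r s * w s) = sqrt v0 * w (Inr r)" if "r < ?N" for r
          unfolding sumJ using that by (simp add: ce_def if_distrib[of "\<lambda>x. x * _"] cong: if_cong)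
        then have "(\<Sum>r<?N. (\<Sum>s\<in>J. ce r s * w s)^2) = ip ?N (\<lambda>r. sqrt v0 * w (Inr r)) (\<lambda>r. sqrt v0 * w (Inr r))"
          by (simp add: ip_def power2_eq_square)
        then show ?thesis using w(3) by (simp add: B3_def)
      qed
      have nb: "\<not> (R < \<bar>sqrt (\<sigma> l) * w (Inl (i, l))\<bar> \<or> \<bar>sqrt (\<sigma> l) * w (Inl (i, l))\<bar> < \<eta>0)" if "i < m" "l \<in> \<gamma>0" for i l
      proof -
        have "(Inl (i, l) :: coord) \<in> Inl ` ({..<m} \<times> \<gamma>0)" using that by simp
        then have "\<not> (R < \<bar>sc (Inl (i, l)) * w (Inl (i, l))\<bar> \<or> \<bar>sc (Inl (i, l)) * w (Inl (i, l))\<bar> < \<eta>0)"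
          using w(1) unfolding B1_def tail_event_def by blast
        then show ?thesis unfolding sc .
      qed
      show "\<bar>sqrt (\<sigma> l) * w (Inl (i, l))\<bar> \<le> R" "\<eta>0 \<le> \<bar>sqrt (\<sigma> l) * w (Inl (i, l))\<bar>" if "i < m" "l \<in> \<gamma>0" for i l
        using nb[OF that] by linarith+
      show "Y w = Yobs m n p q x z \<beta> \<sigma> v0 w" by (simp add: Y_def)
      show "is_mle m n x z \<alpha> \<gamma> (Y w) (\<theta>h (Y w)) (vh (Y w))" if "\<exists>\<theta> v. is_mle m n x z \<alpha> \<gamma> (Y w) \<theta> v"
        by (rule mle[OF _ that]) (simp add: Y_def Yobs_def)
    qed
    then show ?thesis by simp
  qed
  have "measure gauss ?bad \<le> measure gauss (B1 \<union> (B2 \<union> (B3 \<union> B4)))"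
    using good m1 m2 m3 m4 by (intro G.finite_measure_mono) blast+
  also have "\<dots> \<le> measure gauss B1 + measure gauss (B2 \<union> (B3 \<union> B4))"
    using m1 m2 m3 m4 by (intro measure_Un_le) auto
  also have "measure gauss (B2 \<union> (B3 \<union> B4)) \<le> measure gauss B2 + measure gauss (B3 \<union> B4)"
    using m1 m2 m3 m4 by (intro measure_Un_le) auto
  also have "measure gauss (B3 \<union> B4) \<le> measure gauss B3 + measure gauss B4"
    using m1 m2 m3 m4 by (intro measure_Un_le) auto
  finally have "measure gauss ?bad \<le> measure gauss B1 + (measure gauss B2 + (measure gauss B3 + measure gauss B4))" by simp
  moreover have "measure gauss B1 < \<rho>" using tight by (simp add: B1_def)
  ultimately show ?thesis using p2 p3 p4 by linarith
qed

end

end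

section \<open>The asymptotic confidence interval\<close>

theorem theorem2:
  fixes m :: nat
    and n :: "nat \<Rightarrow> nat \<Rightarrow> nat"            \<comment> \<open>n \<nu> i: size of cluster i at stage \<nu>\<close>
    and p q :: "nat \<Rightarrow> nat"
    and x z :: "nat \<Rightarrow> nat \<Rightarrow> nat \<Rightarrow> real"   \<comment> \<open>x \<nu> r j, z \<nu> r k\<close>
    and \<beta>0 :: "nat \<Rightarrow> nat \<Rightarrow> real"
    and \<sigma>0sq :: "nat \<Rightarrow> real" and v0sq :: real
    and \<A> :: "nat \<Rightarrow> nat set set" and \<alpha> \<gamma> :: "nat \<Rightarrow> nat set"
    and \<theta>hat :: "nat \<Rightarrow> real vec \<Rightarrow> nat \<Rightarrow> real" and vhat :: "nat \<Rightarrow> real vec \<Rightarrow> real"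
    and \<tau> cp cq \<xi> ell :: real
    and d c :: "nat \<Rightarrow> nat \<Rightarrow> real"
    and k :: nat and a :: real
  assumes m_pos: "1 \<le> m"
    and n_to_inf: "filterlim (\<lambda>\<nu>. nmin m (n \<nu>)) at_top sequentially"
    and X_rank: "\<And>\<nu>. full_col_rank_X (Ntot m (n \<nu>)) (p \<nu>) (x \<nu>)"
    and Z_rank: "\<And>\<nu>. full_col_rank_Z m (n \<nu>) (q \<nu>) (z \<nu>)"
    and var_nonneg: "\<And>j. 0 \<le> \<sigma>0sq j" and v0_pos: "0 < v0sq"
    \<comment> \<open>(A0)\<close>
    and tau: "0 \<le> \<tau>" "\<tau> < 1/2" and cp: "0 < cp" and cq: "0 < cq"
    and A0p: "(\<lambda>\<nu>. (real (p \<nu>) - cp) / real (nmin m (n \<nu>)) powr \<tau>) \<longlonglongrightarrow> 0"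
    and A0q: "(\<lambda>\<nu>. (real (q \<nu>) - cq) / real (nmin m (n \<nu>)) powr \<tau>) \<longlonglongrightarrow> 0"
    \<comment> \<open>(A1)\<close>
    and xi: "2 * \<tau> < \<xi>" "\<xi> \<le> 1"
    and d_bnd: "\<exists>dl du. 0 < dl \<and> (\<forall>i<m. \<forall>j. dl \<le> d i j \<and> d i j \<le> du)"
    and A1: "\<And>\<epsilon>. 0 < \<epsilon> \<Longrightarrow> eventually (\<lambda>\<nu>. \<forall>i<m. \<forall>j<p \<nu>. \<forall>j'<p \<nu>.
        (j = j' \<longrightarrow> \<bar>cip (n \<nu>) i (\<lambda>r. x \<nu> r j) (\<lambda>r. x \<nu> r j) - d i j * real (n \<nu> i) powr \<xi>\<bar>
                     \<le> \<epsilon> * real (n \<nu> i) powr \<xi>) \<and>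
        (j \<noteq> j' \<longrightarrow> \<bar>cip (n \<nu>) i (\<lambda>r. x \<nu> r j) (\<lambda>r. x \<nu> r j')\<bar>
                     \<le> \<epsilon> * real (n \<nu> i) powr (\<xi> - \<tau>))) sequentially"
    \<comment> \<open>(A2)\<close>
    and ell: "2 * \<tau> < ell" "ell \<le> 1"
    and c_bnd: "\<exists>cl cu. 0 < cl \<and> (\<forall>i<m. \<forall>j. cl \<le> c i j \<and> c i j \<le> cu)"
    and A2: "\<And>\<epsilon>. 0 < \<epsilon> \<Longrightarrow> eventually (\<lambda>\<nu>. \<forall>i<m. \<forall>j<q \<nu>. \<forall>j'<q \<nu>.
        (j = j' \<longrightarrow> \<bar>cip (n \<nu>) i (\<lambda>r. z \<nu> r j) (\<lambda>r. z \<nu> r j) - c i j * real (n \<nu> i) powr ell\<bar>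
                     \<le> \<epsilon> * real (n \<nu> i) powr ell) \<and>
        (j \<noteq> j' \<longrightarrow> \<bar>cip (n \<nu>) i (\<lambda>r. z \<nu> r j) (\<lambda>r. z \<nu> r j')\<bar>
                     \<le> \<epsilon> * real (n \<nu> i) powr (ell - \<tau>))) sequentially"
    \<comment> \<open>(A3)\<close>
    and A3: "\<And>\<epsilon>. 0 < \<epsilon> \<Longrightarrow> eventually (\<lambda>\<nu>. \<forall>i<m. \<forall>j<p \<nu>. \<forall>j'<q \<nu>.
        \<bar>cip (n \<nu>) i (\<lambda>r. x \<nu> r j) (\<lambda>r. z \<nu> r j')\<bar>
           \<le> \<epsilon> * real (n \<nu> i) powr ((\<xi> + ell) / 2 - \<tau>)) sequentially"
    \<comment> \<open>candidate fixed-effects models; alpha \<nu> is a correct candidate\<close>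
    and A_sub: "\<And>\<nu>. \<A> \<nu> \<subseteq> Pow {..<p \<nu>}"
    and alpha_in: "\<And>\<nu>. \<alpha> \<nu> \<in> \<A> \<nu>"
    and alpha_correct: "\<And>\<nu>. \<exists>b. \<forall>r<Ntot m (n \<nu>).
        (\<Sum>j<p \<nu>. x \<nu> r j * \<beta>0 \<nu> j) = (\<Sum>j\<in>\<alpha> \<nu>. x \<nu> r j * b j)"
    and alpha0_fixed: "\<exists>c0>0. \<forall>\<nu>. Min (card ` {a' \<in> \<A> \<nu>. \<exists>b. \<forall>r<Ntot m (n \<nu>).
        (\<Sum>j<p \<nu>. x \<nu> r j * \<beta>0 \<nu> j) = (\<Sum>j\<in>a'. x \<nu> r j * b j)}) = c0"
    \<comment> \<open>random-effects model gamma \<nu> is correct; gamma_0 = {k<q. sigma_{k,0}^2 > 0} of fixed positive size\<close>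
    and gamma_sub: "\<And>\<nu>. \<gamma> \<nu> \<subseteq> {..<q \<nu>}"
    and gamma_correct: "\<And>\<nu>. {j. j < q \<nu> \<and> 0 < \<sigma>0sq j} \<subseteq> \<gamma> \<nu>"
    and gamma0_fixed: "\<exists>c0>0. \<forall>\<nu>. card {j. j < q \<nu> \<and> 0 < \<sigma>0sq j} = c0"
    \<comment> \<open>k \<in> gamma \<inter> gamma_0\<close>
    and k_in: "\<And>\<nu>. k \<in> \<gamma> \<nu> \<inter> {j. j < q \<nu> \<and> 0 < \<sigma>0sq j}"
    \<comment> \<open>maximum-likelihood estimators: a minimiser of -2 log L is chosen whenever one exists\<close>
    and mle: "\<And>\<nu> y. dim_vec y = Ntot m (n \<nu>) \<Longrightarrow>
        (\<exists>\<theta> v2. is_mle m (n \<nu>) (x \<nu>) (z \<nu>) (\<alpha> \<nu>) (\<gamma> \<nu>) y \<theta> v2) \<Longrightarrow>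
        is_mle m (n \<nu>) (x \<nu>) (z \<nu>) (\<alpha> \<nu>) (\<gamma> \<nu>) y (\<theta>hat \<nu> y) (vhat \<nu> y)"
    and mle_meas: "\<And>\<nu>. (\<lambda>\<omega>. let y = Yobs m (n \<nu>) (p \<nu>) (q \<nu>) (x \<nu>) (z \<nu>) (\<beta>0 \<nu>) \<sigma>0sq v0sq \<omega>
                          in \<theta>hat \<nu> y k * vhat \<nu> y) \<in> borel_measurable Omega"
    and a: "0 < a" "a < 1"
  shows "(\<lambda>\<nu>. measure Omega {\<omega> \<in> space Omega.
            let y = Yobs m (n \<nu>) (p \<nu>) (q \<nu>) (x \<nu>) (z \<nu>) (\<beta>0 \<nu>) \<sigma>0sq v0sq \<omega>;
                s = \<theta>hat \<nu> y k * vhat \<nu> y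
            in real m * s / chisq_quantile m (1 - a/2) < \<sigma>0sq k
             \<and> \<sigma>0sq k < real m * s / chisq_quantile m (a/2)})
         \<longlonglongrightarrow> 1 - a"
proof -
  interpret G: prob_space "gauss :: (coord \<Rightarrow> real) measure" by (rule prob_space_gauss)
  have Om: "Omega = gauss" by (simp add: Omega_def)
  have m: "0 < m" using m_pos by simp
  define nm where "nm \<nu> = nmin m (n \<nu>)" for \<nu>
  have nm_le: "nm \<nu> \<le> n \<nu> i" if "i < m" for \<nu> i
    unfolding nm_def nmin_def using that by (intro Min_le) auto
  have nm_inf: "filterlim (\<lambda>\<nu>. real (nm \<nu>)) at_top sequentially"
    unfolding nm_def by (rule filterlim_compose[OF filterlim_real_sequentially n_to_inf])
  have n_le_N: "n \<nu> i \<le> Ntot m (n \<nu>)" if "i < m" for \<nu> i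
    unfolding Ntot_def off_def using that by (intro member_le_sum) auto
  obtain dl du where dl: "0 < dl" "\<And>i j. i < m \<Longrightarrow> dl \<le> d i j" using d_bnd by blast
  obtain cl cu where cl: "0 < cl" "\<And>i j. i < m \<Longrightarrow> cl \<le> c i j \<and> c i j \<le> cu" using c_bnd by blast
  define \<mu> where "\<mu> = min dl cl"
  have \<mu>: "0 < \<mu>" "\<mu> \<le> dl" "\<mu> \<le> cl" using dl cl by (auto simp: \<mu>_def)
  have cu: "\<mu> \<le> cu" using cl(2)[OF m, of 0] \<mu> by linarith
  have \<alpha>p: "\<alpha> \<nu> \<subseteq> {..<p \<nu>}" for \<nu> using A_sub alpha_in by blast
  have fg: "finite (\<gamma> \<nu>)" for \<nu> using gamma_sub finite_subset by blast
  have st: "stage m (n \<nu>) (p \<nu>) (x \<nu>) (\<alpha> \<nu>) (\<gamma> \<nu>)" for \<nu>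
    by unfold_locales (use fg \<alpha>p X_rank in auto)
  define \<gamma>0 where "\<gamma>0 = {j. j < q 0 \<and> 0 < \<sigma>0sq j}"
  \<comment> \<open>The sets at two stages are nested, one of the \<open>q\<close> being smaller, so
    equal cardinality makes them equal: the true random effects are the same at every stage.\<close>
  have \<gamma>0: "\<gamma>0 = {j. j < q \<nu> \<and> 0 < \<sigma>0sq j}" for \<nu>
  proof -
    have fin: "finite {j. j < Q \<and> 0 < \<sigma>0sq j}" for Q :: nat by simp
    have eq: "card {j. j < q 0 \<and> 0 < \<sigma>0sq j} = card {j. j < q \<nu> \<and> 0 < \<sigma>0sq j}"
      using gamma0_fixed by metis
    show ?thesis
    proof (cases "q 0 \<le> q \<nu>")
      case True
      show ?thesis unfolding \<gamma>0_def by (rule card_subset_eq[OF fin _ eq]) (use True in auto)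
    next
      case False
      show ?thesis unfolding \<gamma>0_def by (rule card_subset_eq[OF fin _ eq[symmetric], symmetric]) (use False in auto)
    qed
  qed
  have fin0: "finite \<gamma>0" by (simp add: \<gamma>0_def)
  have k0: "k \<in> \<gamma>0" using k_in[of 0] by (simp add: \<gamma>0_def)
  have \<sigma>k: "0 < \<sigma>0sq k" using k0 by (simp add: \<gamma>0_def)
  define Y where "Y \<nu> = Yobs m (n \<nu>) (p \<nu>) (q \<nu>) (x \<nu>) (z \<nu>) (\<beta>0 \<nu>) \<sigma>0sq v0sq" for \<nu>
  define s where "s \<nu> w = \<theta>hat \<nu> (Y \<nu> w) k * vhat \<nu> (Y \<nu> w)" for \<nu> w
  have s_meas [measurable]: "s \<nu> \<in> borel_measurable gauss" for \<nu>
    using mle_meas[of \<nu>] unfolding Om s_def[abs_def] Y_def Let_def .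
  \<comment> \<open>The normals behind effect k do not change with the stage, so the limit is one
    fixed chi-square variable and convergence in probability can be used.\<close>
  define S where "S w = (\<Sum>i<m. (w (Inl (i, k)))^2)" for w :: "coord \<Rightarrow> real"
  have S_meas [measurable]: "S \<in> borel_measurable gauss" unfolding S_def[abs_def] by measurable
  define T where "T \<nu> w = real m * s \<nu> w / \<sigma>0sq k" for \<nu> w
  have T_meas [measurable]: "T \<nu> \<in> borel_measurable gauss" for \<nu> unfolding T_def[abs_def] by measurable
  have conv: "(\<lambda>\<nu>. G.prob {w \<in> space gauss. e < \<bar>T \<nu> w - S w\<bar>}) \<longlonglongrightarrow> 0" if e: "0 < e" for e
  proof (rule LIMSEQ_I)
    fix \<rho> :: real assume \<rho>: "0 < \<rho>"
    \<comment> \<open>\<open>sc\<close> turns coordinates into effects. Tightness is applied to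
      effects in \<open>\<gamma>0\<close> only, whose scales are nonzero.\<close>
    define sc where "sc s = (case s of Inl (i, l) \<Rightarrow> sqrt (\<sigma>0sq l) | Inr _ \<Rightarrow> 0)" for s :: "coord"
    have "\<exists>R>0. \<exists>\<eta>>0. measure gauss (tail_event (Inl ` ({..<m} \<times> \<gamma>0) :: coord set) sc R \<eta>) < \<rho> / 3"
      by (rule gauss_tight) (use fin0 \<rho> in \<open>auto simp: sc_def \<gamma>0_def\<close>)
    then obtain R \<eta>0 where R: "0 < R" and \<eta>0: "0 < \<eta>0"
      and tight: "measure gauss (tail_event (Inl ` ({..<m} \<times> \<gamma>0) :: coord set) sc R \<eta>0) < \<rho> / 3"
      by blast
    \<comment> \<open>Gives the event of large noise energy one third of \<rho>; tightness and noise
      correlation share the rest.\<close>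
    define L where "L = 3 * v0sq / \<rho>"
    have L: "0 < L" using \<rho> v0_pos by (simp add: L_def)
    have vL: "v0sq / L = \<rho> / 3" using v0_pos \<rho> by (simp add: L_def)
    define C where "C = 2 * cu"
    define V where "V = 2 * (real (m * card \<gamma>0) * (real (m * card \<gamma>0) * (R^2 * C))) + 2 * L"
    have C0: "0 \<le> C" using cu \<mu> by (simp add: C_def)
    have V: "0 < V" unfolding V_def using L C0 by (intro add_nonneg_pos mult_nonneg_nonneg) auto
    \<comment> \<open>Ratio of the upper bound 2 cu n^ell to the lower bound (\<mu>/2) n^ell for the
      squared norm of a random column.\<close>
    define cc where "cc = 4 * cu / \<mu>"
    have cc: "1 \<le> cc" using cu \<mu> by (simp add: cc_def pos_le_divide_eq)
    define \<eta>1 where "\<eta>1 = \<eta>0^2 / (32 * real m * (1 + cc) * V)"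
    have \<eta>1: "0 < \<eta>1" unfolding \<eta>1_def using \<eta>0 m cc V by (intro divide_pos_pos mult_pos_pos) auto
    \<comment> \<open>Converts the error bound for \<theta> k v, up to the factor \<open>u\<close>,
      into one for \<open>T\<close>; then \<open>u\<close> is chosen to make it at most
      \<open>e\<close>.\<close>
    define W where "W = real m / \<sigma>0sq k * (30 * (R + 1)^2)"
    have W: "0 < W" unfolding W_def using m \<sigma>k R by (intro mult_pos_pos divide_pos_pos) auto
    define u where "u = min (1/8) (e / W)"
    have u: "0 < u" "u \<le> 1/8" using e W unfolding u_def by (simp, intro min.cobounded1)
    have uW: "W * u \<le> e"
    proof -
      have "W * u \<le> W * (e / W)" using W by (intro mult_left_mono) (auto simp: u_def)
      then show ?thesis using W by simp
    qed
    \<comment> \<open>Budget: 2 \<eta> uses u/4, and the term with Dm will use u/2. Of the allowance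
      \<open>\<eta>0 / 2\<close>, \<eta> takes one eighth of \<open>\<eta>0\<close> and the
      coherence term one quarter.\<close>
    define \<eta> where "\<eta> = min (u / 8) (\<eta>0 / 8)"
    have \<eta>: "0 < \<eta>" "\<eta> \<le> u / 8" "\<eta> \<le> \<eta>0 / 8" using u \<eta>0 by (auto simp: \<eta>_def)
    have Rc: "0 < R * cc + \<eta>" using R cc \<eta> by (intro add_pos_pos mult_pos_pos) auto
    define \<delta>m where "\<delta>m = min u (\<eta>0 / (8 * (R * cc + \<eta>)))"
    have \<delta>m: "0 < \<delta>m" "\<delta>m \<le> u" using u \<eta>0 Rc by (auto simp: \<delta>m_def)
    have \<delta>mR: "2 * \<delta>m * (R * cc + \<eta>) \<le> \<eta>0 / 4"
    proof -
      have "2 * \<delta>m * (R * cc + \<eta>) \<le> 2 * (\<eta>0 / (8 * (R * cc + \<eta>))) * (R * cc + \<eta>)"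
        using Rc by (intro mult_right_mono mult_left_mono) (auto simp: \<delta>m_def)
      also have "\<dots> = \<eta>0 / 4" using Rc by (simp add: field_simps)
      finally show ?thesis .
    qed
    define Kc where "Kc = (cp + 1) + real m * (cq + 1)"
    have Kc: "0 < Kc" using cp cq m by (simp add: Kc_def add_pos_nonneg)
    \<comment> \<open>The accuracy demanded of (A1)-(A3); it makes the resulting coherence \<delta>
      at most \<open>\<delta>m\<close>.\<close>
    define \<epsilon> where "\<epsilon> = min (\<mu> / 2) (\<delta>m * \<mu> / (2 * Kc))"
    have \<epsilon>: "0 < \<epsilon>" "\<epsilon> \<le> \<mu> / 2" using \<mu> \<delta>m Kc by (auto simp: \<epsilon>_def)
    define \<delta> where "\<delta> = Kc * (2 / \<mu> * \<epsilon>)"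
    have \<delta>: "0 \<le> \<delta>" "\<delta> \<le> \<delta>m"
    proof -
      show "0 \<le> \<delta>" using Kc \<mu> \<epsilon> by (simp add: \<delta>_def)
      have "\<delta> \<le> Kc * (2 / \<mu> * (\<delta>m * \<mu> / (2 * Kc)))"
        unfolding \<delta>_def using Kc \<mu> by (intro mult_left_mono) (auto simp: \<epsilon>_def)
      also have "\<dots> = \<delta>m" using Kc \<mu> by (simp add: field_simps)
      finally show "\<delta> \<le> \<delta>m" .
    qed
    have small: "2 * \<delta> * (R * cc + \<eta>) + \<eta> \<le> \<eta>0 / 2"
    proof -
      have "2 * \<delta> * (R * cc + \<eta>) \<le> 2 * \<delta>m * (R * cc + \<eta>)" using \<delta> Rc by (intro mult_right_mono) auto
      then show ?thesis using \<delta>mR \<eta> by linarith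
    qed
    define Dm where "Dm \<nu> = \<mu> / 2 * real (nm \<nu>) powr ell" for \<nu>
    have ell0: "0 < ell" "\<tau> < ell" using ell tau by auto
    have to0: "((\<lambda>t. B * t powr (- r)) \<longlongrightarrow> 0) at_top" if "0 < r" for B r :: real
      using tendsto_mult_right_zero[OF tendsto_neg_powr[OF _ filterlim_ident], of "- r" B] that by simp
    have ev: "\<forall>\<^sub>F \<nu> in sequentially. B * real (nm \<nu>) powr (- r) < b" if "0 < r" "0 < b" for B r b :: real
      using order_tendstoD(2)[OF filterlim_compose[OF to0[OF that(1), of B] nm_inf] that(2)] .
    have E0: "\<forall>\<^sub>F \<nu> in sequentially. 1 \<le> nm \<nu>"
      using filterlim_at_top[THEN iffD1, OF n_to_inf, rule_format, of 1] by (simp add: nm_def)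
    have Ep: "\<forall>\<^sub>F \<nu> in sequentially. \<bar>(real (p \<nu>) - cp) / real (nm \<nu>) powr \<tau>\<bar> < 1"
      using order_tendstoD(2)[OF tendsto_rabs_zero[OF A0p], of 1] by (simp add: nm_def)
    have Eq: "\<forall>\<^sub>F \<nu> in sequentially. \<bar>(real (q \<nu>) - cq) / real (nm \<nu>) powr \<tau>\<bar> < 1"
      using order_tendstoD(2)[OF tendsto_rabs_zero[OF A0q], of 1] by (simp add: nm_def)
    \<comment> \<open>Fewer columns than observations, so that a direction orthogonal to all columns
      exists.\<close>
    have E1: "\<forall>\<^sub>F \<nu> in sequentially. Kc * real (nm \<nu>) powr (- (1 - \<tau>)) < 1" by (rule ev) (use tau in auto)
    \<comment> \<open>Noise correlation: of order nm^\<tau> columns against squared norms of order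
      at least nm^ell, where ell > \<tau>.\<close>
    have E2: "\<forall>\<^sub>F \<nu> in sequentially. v0sq * Kc / (\<eta>^2 * (\<mu> / 2)) * real (nm \<nu>) powr (- (ell - \<tau>)) < \<rho> / 3"
      by (rule ev) (use ell0 \<rho> in auto)
    have E3: "\<forall>\<^sub>F \<nu> in sequentially. 2 / \<mu> * real (nm \<nu>) powr (- ell) < u * \<eta>1"
      by (rule ev) (use ell0 u \<eta>1 in auto)
    have E4: "\<forall>\<^sub>F \<nu> in sequentially. 2 * R / (\<eta>1 * (\<mu> / 2)) * real (nm \<nu>) powr (- ell) < u / 2"
      by (rule ev) (use ell0 u in auto)
    have "\<forall>\<^sub>F \<nu> in sequentially. G.prob {w \<in> space gauss. e < \<bar>T \<nu> w - S w\<bar>} < \<rho>"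
      using E0 Ep Eq E1 E2 E3 E4 A1[OF \<epsilon>(1)] A2[OF \<epsilon>(1)] A3[OF \<epsilon>(1)]
    proof eventually_elim
      case (elim \<nu>)
      interpret St: stage m "n \<nu>" "p \<nu>" "x \<nu>" "z \<nu>" "\<alpha> \<nu>" "\<gamma> \<nu>" by (rule st)
      have nm1: "1 \<le> real (nm \<nu>)" using elim(1) by simp
      have nm0: "0 < real (nm \<nu>)" using nm1 by simp
      have powt: "1 \<le> real (nm \<nu>) powr \<tau>" using nm1 tau by (simp add: ge_one_powr_ge_zero)
      have pb: "real P \<le> (cP + 1) * real (nm \<nu>) powr \<tau>"
        if "\<bar>(real P - cP) / real (nm \<nu>) powr \<tau>\<bar> < 1" "0 < cP" for P :: nat and cP :: real
      proof -
        have "0 < real (nm \<nu>) powr \<tau>" using powt by linarith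
        then have "\<bar>real P - cP\<bar> < real (nm \<nu>) powr \<tau>" using that(1) by (simp add: abs_divide pos_divide_less_eq)
        moreover have "cP * 1 \<le> cP * real (nm \<nu>) powr \<tau>" using that(2) powt by (intro mult_left_mono) auto
        ultimately show ?thesis by (simp add: distrib_right)
      qed
      have cardc: "real (card (St.cols (\<alpha> \<nu>))) \<le> Kc * real (nm \<nu>) powr \<tau>"
      proof -
        have "card (St.cols (\<alpha> \<nu>)) \<le> card (Inl ` \<alpha> \<nu> :: (nat + nat \<times> nat) set) + card (Inr ` ({..<m} \<times> \<gamma> \<nu>) :: (nat + nat \<times> nat) set)"
          unfolding St.cols_def by (rule card_Un_le)
        also have "\<dots> = card (\<alpha> \<nu>) + m * card (\<gamma> \<nu>)"
          by (simp add: card_image card_cartesian_product)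
        also have "\<dots> \<le> p \<nu> + m * q \<nu>"
          using card_mono[OF _ \<alpha>p[of \<nu>]] card_mono[OF _ gamma_sub[of \<nu>]] by (intro add_mono mult_left_mono) auto
        finally have "real (card (St.cols (\<alpha> \<nu>))) \<le> real (p \<nu>) + real m * real (q \<nu>)"
          by (metis of_nat_add of_nat_le_iff of_nat_mult)
        also have "\<dots> \<le> (cp + 1) * real (nm \<nu>) powr \<tau> + real m * ((cq + 1) * real (nm \<nu>) powr \<tau>)"
          using pb[OF elim(2) cp] pb[OF elim(3) cq] by (intro add_mono mult_left_mono) auto
        finally show ?thesis by (simp add: Kc_def algebra_simps)
      qed
      have dd: "\<And>i j. i < m \<Longrightarrow> \<mu> \<le> d i j" using dl \<mu> by (meson order_trans)
      have cd: "\<And>i j. i < m \<Longrightarrow> \<mu> \<le> c i j \<and> c i j \<le> cu" using cl \<mu> by (meson order_trans)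
      have sm: "Kc * (2 / \<mu> * \<epsilon>) \<le> 1/2" using \<delta> \<delta>m u by (simp add: \<delta>_def)
      note X = St.stage_coherent[OF gamma_sub elim(1) nm_le m tau(1) \<mu>(1) less_imp_le[OF \<epsilon>(1)] \<epsilon>(2) dd cd elim(8,9,10) cardc sm]
      have coh: "St.coherent (\<alpha> \<nu>) \<delta>" unfolding \<delta>_def by (rule X(1))
      have Db: "\<mu> / 2 * real (n \<nu> i) powr ell \<le> St.zz i l \<and> St.zz i l \<le> 2 * cu * real (n \<nu> i) powr ell"
        if "i < m" "l \<in> \<gamma> \<nu>" for i l
        by (rule X(2)) (use that in auto)
      have Dm0: "0 < Dm \<nu>" using nm0 \<mu> by (simp add: Dm_def)
      have Dmi: "1 / Dm \<nu> = 2 / \<mu> * real (nm \<nu>) powr (- ell)" using \<mu> nm0 by (simp add: Dm_def powr_minus field_simps)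
      have powr_le: "real a powr ell \<le> real b powr ell" if "a \<le> b" for a b :: nat
        using that ell0 by (intro powr_mono2) auto
      \<comment> \<open>The largest cluster may be a different one at every stage; no bound depends
        on which.\<close>
      obtain I where I: "I < m" "\<And>i. i < m \<Longrightarrow> n \<nu> i \<le> n \<nu> I"
      proof -
        have "Max (n \<nu> ` {..<m}) \<in> n \<nu> ` {..<m}" using m by (intro Max_in) auto
        then obtain I where "I < m" "n \<nu> I = Max (n \<nu> ` {..<m})" by auto
        then show ?thesis using that by simp
      qed
      have DmD: "Dm \<nu> \<le> St.zz i l" if "i < m" "l \<in> \<gamma> \<nu>" for i l
      proof -
        have "Dm \<nu> \<le> \<mu> / 2 * real (n \<nu> i) powr ell" unfolding Dm_def
          using powr_le[OF nm_le[OF that(1), of \<nu>]] \<mu> by (intro mult_left_mono) auto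
        then show ?thesis using Db[OF that] by linarith
      qed
      have cmp: "St.zz i l
          \<le> cc * St.zz I l'"
        if "i < m" "l \<in> \<gamma> \<nu>" "l' \<in> \<gamma> \<nu>" for i l l'
      proof -
        have "St.zz i l \<le> 2 * cu * real (n \<nu> i) powr ell"
          using Db that by blast
        also have "\<dots> \<le> 2 * cu * real (n \<nu> I) powr ell" using powr_le[OF I(2)[OF that(1)]] C0 by (intro mult_left_mono) (auto simp: C_def)
        also have "\<dots> = cc * (\<mu> / 2 * real (n \<nu> I) powr ell)" using \<mu> by (simp add: cc_def)
        also have "\<dots> \<le> cc * St.zz I l'"
          using Db[OF I(1) that(3)] cc by (intro mult_left_mono) auto
        finally show ?thesis .
      qed
      have DN: "St.zz i l \<le> C * real (Ntot m (n \<nu>))"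
        if "i < m" "l \<in> \<gamma> \<nu>" for i l
      proof -
        have ni: "1 \<le> real (n \<nu> i)" using nm_le[OF that(1), of \<nu>] elim(1) by simp
        have "real (n \<nu> i) powr ell \<le> real (n \<nu> i) powr 1" using ni ell by (intro powr_mono) auto
        also have "\<dots> \<le> real (Ntot m (n \<nu>))" using n_le_N[OF that(1), of \<nu>] ni by simp
        finally have "C * real (n \<nu> i) powr ell \<le> C * real (Ntot m (n \<nu>))" using C0 by (intro mult_left_mono)
        then show ?thesis using Db[OF that] by (simp add: C_def)
      qed
      have KN: "card (St.cols (\<alpha> \<nu>)) < Ntot m (n \<nu>)"
      proof -
        have "Kc * real (nm \<nu>) powr \<tau> = Kc * real (nm \<nu>) powr (- (1 - \<tau>)) * real (nm \<nu>)"
        proof -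
          have "real (nm \<nu>) powr \<tau> = real (nm \<nu>) powr (- (1 - \<tau>)) * real (nm \<nu>) powr 1"
            by (simp only: powr_add[symmetric]) simp
          then show ?thesis using nm0 by simp
        qed
        also have "\<dots> < 1 * real (nm \<nu>)" using elim(4) nm0 by (intro mult_strict_right_mono) auto
        finally have "real (card (St.cols (\<alpha> \<nu>))) < real (nm \<nu>)" using cardc by linarith
        moreover have "nm \<nu> \<le> Ntot m (n \<nu>)" using nm_le[OF m, of \<nu>] n_le_N[OF m, of \<nu>] by linarith
        ultimately show ?thesis by linarith
      qed
      have noise: "v0sq * real (card (St.cols (\<alpha> \<nu>))) / (\<eta>^2 * Dm \<nu>) < \<rho> / 3"
      proof -
        have "v0sq * real (card (St.cols (\<alpha> \<nu>))) / (\<eta>^2 * Dm \<nu>) \<le> v0sq * (Kc * real (nm \<nu>) powr \<tau>) / (\<eta>^2 * Dm \<nu>)"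
          using cardc v0_pos Dm0 by (intro divide_right_mono mult_left_mono) auto
        also have "\<dots> = v0sq * Kc / (\<eta>^2 * (\<mu> / 2)) * real (nm \<nu>) powr (- (ell - \<tau>))"
        proof -
          have "real (nm \<nu>) powr (- (ell - \<tau>)) = real (nm \<nu>) powr \<tau> / real (nm \<nu>) powr ell"
            by (simp add: powr_diff[symmetric])
          then show ?thesis by (simp only: Dm_def) (simp add: mult.assoc)
        qed
        finally show ?thesis using elim(5) by linarith
      qed
      have sub: "{w \<in> space gauss. e < \<bar>T \<nu> w - S w\<bar>} \<subseteq>
        {w. 30 * (R + 1)^2 * u < \<bar>s \<nu> w - (\<Sum>i<m. (sqrt (\<sigma>0sq k) * w (Inl (i, k)))^2) / real m\<bar>}"
      proof
        fix w assume "w \<in> {w \<in> space gauss. e < \<bar>T \<nu> w - S w\<bar>}"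
        then have lt: "W * u < \<bar>T \<nu> w - S w\<bar>" using uW by simp
        define M where "M = (\<Sum>i<m. (sqrt (\<sigma>0sq k) * w (Inl (i, k)))^2) / real m"
        have M: "M = \<sigma>0sq k * S w / real m"
          using \<sigma>k by (simp add: M_def S_def power_mult_distrib sum_distrib_left)
        have "T \<nu> w - S w = real m / \<sigma>0sq k * (s \<nu> w - M)"
          using \<sigma>k m by (simp add: T_def M field_simps)
        then have "\<bar>T \<nu> w - S w\<bar> = real m / \<sigma>0sq k * \<bar>s \<nu> w - M\<bar>"
          using \<sigma>k by (simp add: abs_mult)
        then have "real m / \<sigma>0sq k * (30 * (R + 1)^2 * u) < real m / \<sigma>0sq k * \<bar>s \<nu> w - M\<bar>"
          using lt by (simp add: W_def mult.assoc)
        then have "30 * (R + 1)^2 * u < \<bar>s \<nu> w - M\<bar>"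
          by (rule mult_less_cancel_left_pos[THEN iffD1, rotated]) (use \<sigma>k m in simp)
        then show "w \<in> {w. 30 * (R + 1)^2 * u < \<bar>s \<nu> w - (\<Sum>i<m. (sqrt (\<sigma>0sq k) * w (Inl (i, k)))^2) / real m\<bar>}"
          by (simp add: M_def)
      qed
      have badm: "{w. 30 * (R + 1)^2 * u < \<bar>s \<nu> w - (\<Sum>i<m. (sqrt (\<sigma>0sq k) * w (Inl (i, k)))^2) / real m\<bar>} \<in> sets gauss"
      proof -
        have "{w \<in> space gauss. 30 * (R + 1)^2 * u < \<bar>s \<nu> w - (\<Sum>i<m. (sqrt (\<sigma>0sq k) * w (Inl (i, k)))^2) / real m\<bar>} \<in> sets gauss"
          by measurable
        then show ?thesis by simp
      qed
      have "G.prob {w \<in> space gauss. e < \<bar>T \<nu> w - S w\<bar>} \<le>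
        G.prob {w. 30 * (R + 1)^2 * u < \<bar>s \<nu> w - (\<Sum>i<m. (sqrt (\<sigma>0sq k) * w (Inl (i, k)))^2) / real m\<bar>}"
        by (rule G.finite_measure_mono[OF sub badm])
      also have "\<dots> < \<rho> / 3 + v0sq * real (card (St.cols (\<alpha> \<nu>))) / (\<eta>^2 * Dm \<nu>) + v0sq / L"
        unfolding s_def Y_def
      proof (rule St.stage_prob[OF coh _ m gamma_sub \<gamma>0 _ var_nonneg alpha_correct Dm0 DmD I(1) cc cmp DN less_imp_le[OF R] \<eta>0 V_def small \<eta>(1) \<eta>1_def u _ _ _ k0 v0_pos KN L tight])
        show "\<delta> \<le> 1/4" "\<delta> \<le> u" using \<delta> \<delta>m u by auto
        show "\<gamma>0 \<subseteq> \<gamma> \<nu>" unfolding \<gamma>0[of \<nu>] by (rule gamma_correct)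
        show "1 / Dm \<nu> \<le> u * \<eta>1" unfolding Dmi using elim(6) by simp
        show "2 * R / (\<eta>1 * Dm \<nu>) + 2 * \<eta> \<le> u"
        proof -
          have "2 * R / (\<eta>1 * Dm \<nu>) = 2 * R / (\<eta>1 * (\<mu> / 2)) * real (nm \<nu>) powr (- ell)"
            using \<mu> nm0 \<eta>1 by (simp add: Dm_def powr_minus field_simps)
          then show ?thesis using elim(7) \<eta>(2) u by linarith
        qed
      qed (use mle in \<open>auto simp: sc_def\<close>)
      finally show ?case using noise vL by linarith
    qed
    then show "\<exists>no. \<forall>\<nu>\<ge>no. norm (G.prob {w \<in> space gauss. e < \<bar>T \<nu> w - S w\<bar>} - 0) < \<rho>"
      unfolding eventually_sequentially by simp
  qed
  define q0 where "q0 = chisq_quantile m (a/2)"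
  define q1 where "q1 = chisq_quantile m (1 - a/2)"
  have q: "0 < q0" "0 < q1" unfolding q0_def q1_def using chisq_quantile(2)[OF m_pos] a by auto
  have inj: "inj (\<lambda>i. Inl (i, k) :: coord)" by (auto simp: inj_on_def)
  have atom: "G.prob {w \<in> space gauss. S w = t} = 0" for t
  proof -
    have "S w = (\<Sum>s\<in>(\<lambda>i. Inl (i, k)) ` {..<m}. (w s)^2)" for w
      unfolding S_def by (subst sum.reindex[OF inj_on_subset[OF inj]]) auto
    then show ?thesis using gauss_sq_atomless[of "(\<lambda>i. Inl (i, k) :: coord) ` {..<m}" t] m
      by (simp add: lessThan_empty_iff)
  qed
  have "(\<lambda>\<nu>. G.prob {w \<in> space gauss. q0 < T \<nu> w \<and> T \<nu> w < q1}) \<longlonglongrightarrow> G.prob {w \<in> space gauss. q0 < S w \<and> S w < q1}"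
    by (rule G.interval_prob_limit[OF S_meas T_meas conv atom atom])
  also have "G.prob {w \<in> space gauss. q0 < S w \<and> S w < q1} = 1 - a"
    using chisq_interval_prob[OF inj m_pos a] by (simp add: S_def q0_def q1_def)
  also have "(\<lambda>\<nu>. G.prob {w \<in> space gauss. q0 < T \<nu> w \<and> T \<nu> w < q1})
    = (\<lambda>\<nu>. measure Omega {w \<in> space Omega.
            let y = Yobs m (n \<nu>) (p \<nu>) (q \<nu>) (x \<nu>) (z \<nu>) (\<beta>0 \<nu>) \<sigma>0sq v0sq w;
                s = \<theta>hat \<nu> y k * vhat \<nu> y
            in real m * s / chisq_quantile m (1 - a/2) < \<sigma>0sq k
             \<and> \<sigma>0sq k < real m * s / chisq_quantile m (a/2)})"
  proof -
    \<comment> \<open>Solving for the variance puts the estimate over the quantiles, so the upper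
      quantile yields the lower confidence limit.\<close>
    have "q0 < T \<nu> w \<and> T \<nu> w < q1 \<longleftrightarrow> real m * s \<nu> w / q1 < \<sigma>0sq k \<and> \<sigma>0sq k < real m * s \<nu> w / q0" for \<nu> w
      using q \<sigma>k by (auto simp: T_def field_simps)
    then show ?thesis unfolding Om by (simp add: s_def Y_def q0_def q1_def Let_def)
  qed
  finally show ?thesis .
qed

end
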